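(* Let $\Gamma$ be a Gromov hyperbolic group with a finite symmetric generating set $S$ such that the Cayley graph $G=G(\Gamma,S)$ is planar. Let $\mu=(\mu_k)_{k\ge 0}$ be an offspring distribution with mean $m=\sum_k k\mu_k>1$, $\mu_0=0$ and $\mu_1>0$, and let $q$ be a probability measure on $S\cup\{e\}$ with $q(s)=q(s^{-1})$ for all $s\in S$ and $\mathrm{supp}(q)=S\cup\{e\}$. Suppose the branching random walk with offspring distribution $\mu$ and driving measure $q$ is transient, i.e. $m\rho\le 1$, where $\rho=\limsup_{n\to\infty}(p^{(n)}(e,e))^{1/n}$ is the spectral radius of the random walk with transition probabilities $p(x,y)=q(x^{-1}y)$. Then almost surely the trace of the branching random walk has continuum many ends and no isolated end.
   Context: Branching random walk (BRW) on $G$: the process starts with one particle at the identity $e$ (the root $o$ of $G$). At each time step every particle, independently of everything else, is replaced by $k$ offspring with probability $\mu_k$, and each offspring independently moves one step according to the transition kernel $p(x,y)=q(x^{-1}y)$ (equivalently: a random walk on $G$ indexed by a Galton–Watson tree with offspring law $\mu$, edges of the tree labelled by i.i.d. $q$-distributed increments). The trace $\mathtt{Tr}$ of the BRW is the random subgraph of $G$ consisting of all vertices ever visited by particles and all edges ever traversed by particles. Ends: for a locally finite graph, a ray is a sequence of distinct vertices with consecutive vertices adjacent; two rays are equivalent if for every finite vertex set $F$ they eventually lie in the same connected component of the graph with $F$ removed; ends are equivalence classes of rays. The end space is topologized by taking, for each finite $F$ and each end $w$, the set of ends whose rays end up in the component of the complement of $F$ containing the rays of $w$, as a neighbourhood base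 of $w$; an isolated end is an isolated point of this space. *)

theory Defs
  imports "HOL-Probability.Probability" "HOL-Algebra.Generated_Groups" "HOL-Library.Equipollence"
begin

definition word_dist :: "('a, 'b) monoid_scheme \<Rightarrow> 'a set \<Rightarrow> 'a \<Rightarrow> 'a \<Rightarrow> nat" where
  "word_dist G S x y =
     (LEAST n. \<exists>l. length l = n \<and> set l \<subseteq> S \<and> x \<otimes>\<^bsub>G\<^esub> foldr (\<lambda>s a. s \<otimes>\<^bsub>G\<^esub> a) l \<one>\<^bsub>G\<^esub> = y)"

definition gromov_product :: "('a \<Rightarrow> 'a \<Rightarrow> real) \<Rightarrow> 'a \<Rightarrow> 'a \<Rightarrow> 'a \<Rightarrow> real" where
  "gromov_product d w x y = (d x w + d y w - d x y) / 2"

definition hyperbolic_group :: "('a, 'b) monoid_scheme \<Rightarrow> 'a set \<Rightarrow> bool" where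
  "hyperbolic_group G S \<longleftrightarrow>
     (\<exists>\<delta>\<ge>0. \<forall>x\<in>carrier G. \<forall>y\<in>carrier G. \<forall>z\<in>carrier G. \<forall>w\<in>carrier G.
        gromov_product (\<lambda>a b. real (word_dist G S a b)) w x z \<ge>
          min (gromov_product (\<lambda>a b. real (word_dist G S a b)) w x y)
              (gromov_product (\<lambda>a b. real (word_dist G S a b)) w y z) - \<delta>)"

definition cayley_edges :: "('a, 'b) monoid_scheme \<Rightarrow> 'a set \<Rightarrow> 'a set set" where
  "cayley_edges G S = {{x, x \<otimes>\<^bsub>G\<^esub> s} | x s. x \<in> carrier G \<and> s \<in> S \<and> x \<otimes>\<^bsub>G\<^esub> s \<noteq> x}"

definition planar_cayley :: "('a, 'b) monoid_scheme \<Rightarrow> 'a set \<Rightarrow> bool" where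
  "planar_cayley G S \<longleftrightarrow>
     (\<exists>(f :: 'a \<Rightarrow> complex) (\<gamma> :: 'a set \<Rightarrow> real \<Rightarrow> complex).
        inj_on f (carrier G) \<and>
        (\<forall>e\<in>cayley_edges G S. arc (\<gamma> e) \<and> {pathstart (\<gamma> e), pathfinish (\<gamma> e)} = f ` e \<and>
            (\<forall>v\<in>carrier G. f v \<in> path_image (\<gamma> e) \<longrightarrow> v \<in> e)) \<and>
        (\<forall>e\<in>cayley_edges G S. \<forall>e'\<in>cayley_edges G S. e \<noteq> e' \<longrightarrow>
            path_image (\<gamma> e) \<inter> path_image (\<gamma> e') \<subseteq> f ` (e \<inter> e')))"

primrec rw_step_dist :: "('a, 'b) monoid_scheme \<Rightarrow> 'a pmf \<Rightarrow> nat \<Rightarrow> 'a pmf" where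
  "rw_step_dist G q 0 = return_pmf \<one>\<^bsub>G\<^esub>"
| "rw_step_dist G q (Suc n) = bind_pmf (rw_step_dist G q n) (\<lambda>x. map_pmf (\<lambda>s. x \<otimes>\<^bsub>G\<^esub> s) q)"

definition return_prob :: "('a, 'b) monoid_scheme \<Rightarrow> 'a pmf \<Rightarrow> nat \<Rightarrow> real" where
  "return_prob G q n = pmf (rw_step_dist G q n) \<one>\<^bsub>G\<^esub>"

definition spectral_radius_rw :: "('a, 'b) monoid_scheme \<Rightarrow> 'a pmf \<Rightarrow> ennreal" where
  "spectral_radius_rw G q = limsup (\<lambda>n. ennreal (return_prob G q n powr (1 / real n)))"

definition offspring_mean :: "nat pmf \<Rightarrow> ennreal" where
  "offspring_mean \<mu> = (\<integral>\<^sup>+ k. ennreal (real k) \<partial>measure_pmf \<mu>)"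

text \<open>A sample point assigns to every label u (a finite list of child indices) a pair
  (number of children of u, increment of the step into u); these pairs are i.i.d.\<close>
definition brw_space :: "nat pmf \<Rightarrow> 'a pmf \<Rightarrow> (nat list \<Rightarrow> nat \<times> 'a) measure" where
  "brw_space \<mu> q = PiM (UNIV :: nat list set) (\<lambda>_. measure_pmf (pair_pmf \<mu> q))"

definition in_tree :: "(nat list \<Rightarrow> nat \<times> 'a) \<Rightarrow> nat list \<Rightarrow> bool" where
  "in_tree \<omega> u \<longleftrightarrow> (\<forall>j < length u. u ! j < fst (\<omega> (take j u)))"

definition brw_pos :: "('a, 'b) monoid_scheme \<Rightarrow> (nat list \<Rightarrow> nat \<times> 'a) \<Rightarrow> nat list \<Rightarrow> 'a" where
  "brw_pos G \<omega> u = foldl (\<lambda>x j. x \<otimes>\<^bsub>G\<^esub> snd (\<omega> (take (Suc j) u))) \<one>\<^bsub>G\<^esub> [0..<length u]"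

definition trace_V :: "('a, 'b) monoid_scheme \<Rightarrow> (nat list \<Rightarrow> nat \<times> 'a) \<Rightarrow> 'a set" where
  "trace_V G \<omega> = {brw_pos G \<omega> u | u. in_tree \<omega> u}"

definition trace_E :: "('a, 'b) monoid_scheme \<Rightarrow> (nat list \<Rightarrow> nat \<times> 'a) \<Rightarrow> 'a \<Rightarrow> 'a \<Rightarrow> bool" where
  "trace_E G \<omega> x y \<longleftrightarrow>
     (\<exists>u i. in_tree \<omega> (u @ [i]) \<and> {x, y} = {brw_pos G \<omega> u, brw_pos G \<omega> (u @ [i])})"

section \<open>Ends of a graph (V, E), E symmetric\<close>

definition conn_in :: "'v set \<Rightarrow> ('v \<Rightarrow> 'v \<Rightarrow> bool) \<Rightarrow> 'v \<Rightarrow> 'v \<Rightarrow> bool" where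
  "conn_in V E x y \<longleftrightarrow> x \<in> V \<and> y \<in> V \<and> (\<lambda>a b. a \<in> V \<and> b \<in> V \<and> E a b)\<^sup>*\<^sup>* x y"

definition is_ray :: "'v set \<Rightarrow> ('v \<Rightarrow> 'v \<Rightarrow> bool) \<Rightarrow> (nat \<Rightarrow> 'v) \<Rightarrow> bool" where
  "is_ray V E r \<longleftrightarrow> (\<forall>n. r n \<in> V) \<and> inj r \<and> (\<forall>n. E (r n) (r (Suc n)))"

definition ray_equiv :: "'v set \<Rightarrow> ('v \<Rightarrow> 'v \<Rightarrow> bool) \<Rightarrow> ((nat \<Rightarrow> 'v) \<times> (nat \<Rightarrow> 'v)) set" where
  "ray_equiv V E = {(r, r'). is_ray V E r \<and> is_ray V E r' \<and>
      (\<forall>F. finite F \<longrightarrow> (\<exists>N. \<forall>n\<ge>N. \<forall>m\<ge>N. conn_in (V - F) E (r n) (r' m)))}"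

definition graph_ends :: "'v set \<Rightarrow> ('v \<Rightarrow> 'v \<Rightarrow> bool) \<Rightarrow> (nat \<Rightarrow> 'v) set set" where
  "graph_ends V E = {r. is_ray V E r} // ray_equiv V E"

definition end_nbhd :: "'v set \<Rightarrow> ('v \<Rightarrow> 'v \<Rightarrow> bool) \<Rightarrow> 'v set \<Rightarrow> (nat \<Rightarrow> 'v) set \<Rightarrow> (nat \<Rightarrow> 'v) set set" where
  "end_nbhd V E F w = {w' \<in> graph_ends V E. \<exists>r\<in>w. \<exists>r'\<in>w'.
      \<exists>N. \<forall>n\<ge>N. \<forall>m\<ge>N. conn_in (V - F) E (r n) (r' m)}"

definition isolated_end :: "'v set \<Rightarrow> ('v \<Rightarrow> 'v \<Rightarrow> bool) \<Rightarrow> (nat \<Rightarrow> 'v) set \<Rightarrow> bool" where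
  "isolated_end V E w \<longleftrightarrow> w \<in> graph_ends V E \<and> (\<exists>F. finite F \<and> end_nbhd V E F w \<subseteq> {w})"

end

theory Submission
  imports Defs "HOL-Real_Asymp.Real_Asymp" "HOL-Library.Sublist"
begin

text \<open>
  Write \<open>P\<close> for the transition operator of the walk and \<open>m\<close> for the offspring mean, so that \<open>m \<rho> \<le> 1\<close>.

  \<^item> \<^emph>\<open>The Green function at \<open>m\<close> is finite\<close>, even if \<open>m \<rho> = 1\<close>: for \<open>1 < z < m\<close>, inverting the
    Green function on the two points \<open>1, s\<close> gives \<open>G(1) - G(s) \<le> 1 / (2 z q(s))\<close>, and
    \<open>G(1) = 1 + z \<Sum> q(s) G(s)\<close> then bounds \<open>(z - 1) G(1)\<close> uniformly in \<open>z\<close>.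

  \<^item> \<^emph>\<open>Two independent branching random walks meet finitely often.\<close> Let \<open>A\<close> be the trace of the first,
    grown from both ends of a root edge. Changing the root edge preserves the law, so that \<open>A\<close> obeys
    a mass transport principle. The second walk, observed when it is in \<open>A\<close>, is a branching process
    whose mean kernel \<open>Q\<close> is the first-return kernel of \<open>m P\<close> to \<open>A\<close>. By mass transport and the
    symmetry of the walk, \<open>Q\<close> is symmetric on \<open>L\<^sup>2\<close> of the law of \<open>A\<close> weighted by the inverse number
    of edges at the identity. For \<open>z < m\<close> the kernels \<open>Q\<^sub>z\<close> have \<open>\<Sum>\<^sub>n \<langle>1, Q\<^sub>z\<^sup>n 1\<rangle> < \<infinity>\<close>, which forces
    \<open>\<parallel>Q\<^sub>z f\<parallel> \<le> \<parallel>f\<parallel>\<close> by repeated use of the Cauchy-Schwarz inequality; hence \<open>\<parallel>Q f\<parallel> \<le> \<parallel>f\<parallel>\<close>. On the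
    other hand the probabilities \<open>s\<^sub>n\<close> of surviving \<open>n\<close> returns satisfy \<open>s\<^sub>n\<^sub>+\<^sub>1 + c s\<^sub>n\<^sup>2 \<le> Q s\<^sub>n\<close>, as the
    walk may split and stay put. Together these force \<open>s\<^sub>n \<rightarrow> 0\<close>: the return process is critical at
    best, and dies out.

  \<^item> \<^emph>\<open>Ends.\<close> Disjoint subtrees of the genealogical tree leave traces with finite intersection, and every
    particle has two disjoint lines of descent. So every subtree contains two rays that a finite set
    separates in the whole trace, while every neighbourhood of an end contains the trace of a whole
    subtree.
\<close>


section \<open>Resampling the tree\<close>

text \<open>When \<open>m \<rho> = 1\<close>, the expected number of meetings of two walks is a sum
  of squared Green functions, which may diverge although the Green function at \<open>m\<close> is
  finite. A first-moment argument thus fails, and the second walk is studied in the fixed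
  environment \<open>A\<close>. A single tree has a distinguished root; only with a second tree
  attached does the root edge look like every other edge, which is what makes mass transport exact.
  The return operator is not known in advance to be bounded. It is therefore cut off at return time
  \<open>t\<close>: lowering the weight from \<open>m\<close> to \<open>r m\<close> then costs at
  most a factor \<open>r^t\<close> per return, so the contraction bound passes to
  \<open>r = 1\<close> for each \<open>t\<close> and, being uniform in \<open>t\<close>, survives
  the removal of the cut-off by monotone convergence. The final clash: pairing the inequality for
  \<open>s_n\<close> with \<open>s_(n+1)\<close> and contracting shows that the squared norm of
  \<open>s_(n+1)\<close> plus \<open>c\<close> times the integral of its cube is at most the squared
  norm of \<open>s_n\<close>. The integrals of the cubes are summable, so the decreasing limit of
  the \<open>s_n\<close> vanishes.\<close>

lemma distr_PiM_graft:
  fixes f :: "'i \<Rightarrow> 'i" and M :: "'b measure"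
  assumes M: "prob_space M" and f: "inj f"
  shows "distr (PiM UNIV (\<lambda>_. M) \<Otimes>\<^sub>M PiM UNIV (\<lambda>_. M)) (PiM UNIV (\<lambda>_. M))
           (\<lambda>(\<eta>, \<omega>) v. if v \<in> range f then \<eta> (inv_into UNIV f v) else \<omega> v) = PiM UNIV (\<lambda>_. M)"
proof (rule measure_eqI_PiM_infinite[symmetric, OF refl])
  interpret M: prob_space M by fact
  let ?N = "PiM (UNIV :: 'i set) (\<lambda>_. M)"
  interpret N: prob_space ?N by (intro prob_space_PiM M)
  show "finite_measure ?N" by unfold_locales
  let ?g = "\<lambda>(\<eta>, \<omega>) v. if v \<in> range f then \<eta> (inv_into UNIV f v) else \<omega> v"
  have meas [measurable]: "?g \<in> measurable (?N \<Otimes>\<^sub>M ?N) ?N"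
    unfolding case_prod_beta
    by (rule measurable_PiM_single') (auto simp: space_pair_measure space_PiM PiE_iff)
  fix A and J :: "'i set"
  assume J: "finite J" "J \<subseteq> UNIV" and A: "\<And>i. i \<in> J \<Longrightarrow> A i \<in> sets M"
  let ?X = "prod_emb UNIV (\<lambda>_. M) J (Pi\<^sub>E J A)"
  \<comment> \<open>A cylinder over \<open>J\<close> splits into coordinates read from the copy,
    pulled back along \<open>f\<close>, and coordinates that keep their old value; the two blocks
    are independent.\<close>
  define I1 where "I1 = f -` J"
  define J2 where "J2 = J - range f"
  have fin: "finite I1" "finite J2"
    using finite_vimageI[OF J(1) f] J by (auto simp: I1_def J2_def)
  let ?X1 = "prod_emb UNIV (\<lambda>_. M) I1 (Pi\<^sub>E I1 (\<lambda>i. A (f i)))"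
  let ?X2 = "prod_emb UNIV (\<lambda>_. M) J2 (Pi\<^sub>E J2 A)"
  have Jeq: "J = f ` I1 \<union> J2" "f ` I1 \<inter> J2 = {}" by (auto simp: I1_def J2_def)
  have "emeasure ?N ?X = (\<Prod>i\<in>J. emeasure M (A i))"
    using J A by (intro emeasure_PiM_emb) (auto intro: M)
  also have "\<dots> = (\<Prod>i\<in>f ` I1. emeasure M (A i)) * (\<Prod>i\<in>J2. emeasure M (A i))"
    using Jeq fin by (subst Jeq(1), subst prod.union_disjoint) auto
  also have "(\<Prod>i\<in>f ` I1. emeasure M (A i)) = (\<Prod>i\<in>I1. emeasure M (A (f i)))"
    using f by (subst prod.reindex) (auto intro: inj_on_subset)
  also have "\<dots> = emeasure ?N ?X1"
    using fin A by (intro emeasure_PiM_emb[symmetric]) (auto simp: I1_def M)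
  also have "(\<Prod>i\<in>J2. emeasure M (A i)) = emeasure ?N ?X2"
    using fin A by (intro emeasure_PiM_emb[symmetric]) (auto simp: J2_def M)
  also have "emeasure ?N ?X1 * emeasure ?N ?X2 = emeasure (?N \<Otimes>\<^sub>M ?N) (?X1 \<times> ?X2)"
    using fin A by (intro N.emeasure_pair_measure_Times[symmetric] sets_PiM_I) (auto simp: I1_def J2_def)
  also have "?X1 \<times> ?X2 = ?g -` ?X \<inter> space (?N \<Otimes>\<^sub>M ?N)"
    using f by (auto simp: prod_emb_def space_pair_measure space_PiM PiE_iff I1_def J2_def inv_into_f_f
        split: if_splits)
      (metis rangeI inv_into_f_f UNIV_I)
  also have "emeasure (?N \<Otimes>\<^sub>M ?N) \<dots> = emeasure (distr (?N \<Otimes>\<^sub>M ?N) ?N ?g) ?X"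
    using J A by (intro emeasure_distr[symmetric] meas sets_PiM_I) auto
  finally show "emeasure ?N ?X = emeasure (distr (?N \<Otimes>\<^sub>M ?N) ?N ?g) ?X" .
qed simp

definition child :: "nat \<Rightarrow> (nat list \<Rightarrow> 'b) \<Rightarrow> nat list \<Rightarrow> 'b" where
  "child i \<omega> = (\<lambda>v. \<omega> (i # v))"

text \<open>The slot of child \<open>i\<close> is overwritten whether or not the root has that many
  children: labels outside the tree carry coordinates too, so resampling never needs
  conditioning.\<close>

definition plug :: "nat \<Rightarrow> (nat list \<Rightarrow> 'b) \<Rightarrow> (nat list \<Rightarrow> 'b) \<Rightarrow> nat list \<Rightarrow> 'b" where
  "plug i \<eta> \<omega> = (\<lambda>v. case v of [] \<Rightarrow> \<omega> [] | j # u \<Rightarrow> if j = i then \<eta> u else \<omega> v)"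

text \<open>The increment stored at the root labels a step into the root, which the walk started
  there never makes. This spare coordinate later becomes the increment of the root edge of the
  two-sided tree.\<close>

definition set_inc :: "'a \<Rightarrow> (nat list \<Rightarrow> nat \<times> 'a) \<Rightarrow> nat list \<Rightarrow> nat \<times> 'a" where
  "set_inc s \<omega> = fun_upd \<omega> [] (fst (\<omega> []), s)"

lemma child_plug [simp]: "child i (plug j \<eta> \<omega>) = (if i = j then \<eta> else child i \<omega>)"
  by (auto simp: child_def plug_def fun_eq_iff)

lemma plug_Nil [simp]: "plug j \<eta> \<omega> [] = \<omega> []"
  by (simp add: plug_def)

lemma plug_plug [simp]: "plug i \<eta> (plug i \<zeta> \<omega>) = plug i \<eta> \<omega>"
  by (auto simp: plug_def fun_eq_iff split: list.split)

lemma plug_child [simp]: "plug i (child i \<omega>) \<omega> = \<omega>"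
  by (auto simp: plug_def child_def fun_eq_iff split: list.split)

lemma child_set_inc [simp]: "child i (set_inc s \<omega>) = child i \<omega>"
  by (auto simp: child_def set_inc_def)

lemma set_inc_Nil [simp]: "set_inc s \<omega> [] = (fst (\<omega> []), s)"
  by (simp add: set_inc_def)

lemma set_inc_set_inc [simp]: "set_inc s (set_inc t \<omega>) = set_inc s \<omega>"
  by (simp add: set_inc_def)

lemma set_inc_snd [simp]: "set_inc (snd (\<omega> [])) \<omega> = \<omega>"
  by (simp add: set_inc_def)

lemma space_brw [simp]: "space (brw_space \<mu> q) = UNIV"
  by (simp add: brw_space_def space_PiM PiE_UNIV_domain)

lemma prob_space_brw: "prob_space (brw_space \<mu> q)"
  unfolding brw_space_def by (intro prob_space_PiM prob_space_measure_pmf)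

lemma measurable_brw_coord [measurable]:
  "(\<lambda>\<omega>. \<omega> u) \<in> measurable (brw_space \<mu> q) (count_space UNIV)"
proof -
  have "(\<lambda>\<omega>. \<omega> u) \<in> measurable (brw_space \<mu> q) (measure_pmf (pair_pmf \<mu> q))"
    unfolding brw_space_def by (rule measurable_component_singleton) simp
  then show ?thesis by (simp cong: measurable_cong_sets)
qed

lemma measurable_into_brw:
  assumes "\<And>u. (\<lambda>x. f x u) \<in> measurable M (count_space UNIV)"
  shows "f \<in> measurable M (brw_space \<mu> q)"
  unfolding brw_space_def
  by (rule measurable_PiM_single') (use assms in \<open>auto cong: measurable_cong_sets\<close>)

lemma measurable_brw_coord' [measurable (raw)]:
  "f \<in> measurable M (brw_space \<mu> q) \<Longrightarrow> (\<lambda>x. f x u) \<in> measurable M (count_space UNIV)"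
  by (rule measurable_compose[OF _ measurable_brw_coord])

lemma measurable_child [measurable (raw)]:
  "f \<in> measurable M (brw_space \<mu> q) \<Longrightarrow> (\<lambda>x. child i (f x)) \<in> measurable M (brw_space \<mu> q)"
  by (rule measurable_into_brw) (simp add: child_def)

lemma measurable_plug [measurable (raw)]:
  "f \<in> measurable M (brw_space \<mu> q) \<Longrightarrow> g \<in> measurable M (brw_space \<mu> q) \<Longrightarrow>
   (\<lambda>x. plug i (f x) (g x)) \<in> measurable M (brw_space \<mu> q)"
  apply (rule measurable_into_brw)
  subgoal for u by (cases u) (auto simp: plug_def)
  done

lemma measurable_set_inc [measurable (raw)]:
  assumes f: "f \<in> measurable M (brw_space \<mu> q)"
  shows "(\<lambda>x. set_inc s (f x)) \<in> measurable M (brw_space \<mu> q)"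
proof (rule measurable_into_brw)
  have [measurable]: "(\<lambda>x. (fst (f x []), s)) \<in> measurable M (count_space UNIV)"
    by (rule measurable_compose[OF measurable_brw_coord'[OF f]]) auto
  fix u show "(\<lambda>x. set_inc s (f x) u) \<in> measurable M (count_space UNIV)"
    using measurable_brw_coord'[OF f, of u] by (auto simp: set_inc_def)
qed

lemma nn_integral_graft:
  fixes f :: "nat list \<Rightarrow> nat list"
  assumes f: "inj f" and F [measurable]: "F \<in> borel_measurable (brw_space \<mu> q)"
  shows "(\<integral>\<^sup>+\<omega>. F \<omega> \<partial>brw_space \<mu> q) =
    (\<integral>\<^sup>+\<omega>. \<integral>\<^sup>+\<eta>. F (\<lambda>v. if v \<in> range f then \<eta> (inv_into UNIV f v) else \<omega> v) \<partial>brw_space \<mu> q \<partial>brw_space \<mu> q)"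
proof -
  let ?N = "brw_space \<mu> q"
  interpret N: prob_space ?N by (rule prob_space_brw)
  interpret NN: pair_sigma_finite ?N ?N ..
  let ?g = "\<lambda>(\<eta>, \<omega>) v. if v \<in> range f then \<eta> (inv_into UNIV f v) else \<omega> v"
  have meas [measurable]: "?g \<in> measurable (?N \<Otimes>\<^sub>M ?N) ?N"
  proof (rule measurable_into_brw)
    fix u :: "nat list"
    show "(\<lambda>x. ?g x u) \<in> measurable (?N \<Otimes>\<^sub>M ?N) (count_space UNIV)"
      by (cases "u \<in> range f") (simp_all add: case_prod_beta)
  qed
  have "?N = distr (?N \<Otimes>\<^sub>M ?N) ?N ?g"
    unfolding brw_space_def by (intro distr_PiM_graft[symmetric] f prob_space_measure_pmf)
  then have "(\<integral>\<^sup>+\<omega>. F \<omega> \<partial>?N) = (\<integral>\<^sup>+\<omega>. F \<omega> \<partial>distr (?N \<Otimes>\<^sub>M ?N) ?N ?g)" by simp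
  also have "\<dots> = (\<integral>\<^sup>+x. F (?g x) \<partial>(?N \<Otimes>\<^sub>M ?N))"
    by (rule nn_integral_distr) measurable
  also have "\<dots> = (\<integral>\<^sup>+\<omega>. \<integral>\<^sup>+\<eta>. F (?g (\<eta>, \<omega>)) \<partial>?N \<partial>?N)"
    by (rule NN.nn_integral_snd[symmetric]) measurable
  finally show ?thesis by simp
qed

lemma nn_integral_plug:
  fixes q :: "'b pmf"
  assumes F: "F \<in> borel_measurable (brw_space \<mu> q)"
  shows "(\<integral>\<^sup>+\<omega>. F \<omega> \<partial>brw_space \<mu> q) = (\<integral>\<^sup>+\<omega>. \<integral>\<^sup>+\<eta>. F (plug i \<eta> \<omega>) \<partial>brw_space \<mu> q \<partial>brw_space \<mu> q)"
proof -
  have "(\<lambda>v. if v \<in> range ((#) i) then \<eta> (inv_into UNIV ((#) i) v) else \<omega> v) = plug i \<eta> \<omega>"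
    for \<eta> \<omega> :: "nat list \<Rightarrow> nat \<times> 'b"
    by (auto simp: plug_def fun_eq_iff inv_into_f_f split: list.split)
  then show ?thesis
    using nn_integral_graft[of "(#) i" F \<mu> q] F by simp
qed

lemma nn_integral_set_inc:
  assumes F [measurable]: "F \<in> borel_measurable (brw_space \<mu> q)"
  and fin: "finite (set_pmf q)"
  shows "(\<integral>\<^sup>+\<omega>. F \<omega> \<partial>brw_space \<mu> q) = (\<integral>\<^sup>+\<omega>. \<integral>\<^sup>+s. F (set_inc s \<omega>) \<partial>measure_pmf q \<partial>brw_space \<mu> q)"
proof -
  let ?N = "brw_space \<mu> q" and ?p = "measure_pmf (pair_pmf \<mu> q)"
  interpret N: prob_space ?N by (rule prob_space_brw)
  interpret PN: pair_sigma_finite ?p ?N ..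
  have *: "(\<lambda>(c, \<omega>). fun_upd \<omega> [] c) \<in> measurable (?p \<Otimes>\<^sub>M ?N) ?N"
  proof (rule measurable_into_brw)
    fix u :: "nat list"
    have "fst \<in> measurable (?p \<Otimes>\<^sub>M ?N) (count_space UNIV)"
      using measurable_fst[of ?p ?N] by (simp cong: measurable_cong_sets)
    then show "(\<lambda>x. (case x of (c, \<omega>) \<Rightarrow> fun_upd \<omega> [] c) u) \<in> measurable (?p \<Otimes>\<^sub>M ?N) (count_space UNIV)"
      by (cases "u = []") (auto simp: case_prod_beta)
  qed
  have "distr (?p \<Otimes>\<^sub>M ?N) ?N (\<lambda>(c, \<omega>). fun_upd \<omega> [] c) = ?N"
    using distr_pair_PiM_eq_PiM[of "UNIV :: nat list set" "\<lambda>_. ?p" "[]"]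
    by (simp add: brw_space_def prob_space_measure_pmf)
  then have eq: "(\<integral>\<^sup>+\<omega>. H \<omega> \<partial>?N) = (\<integral>\<^sup>+\<omega>. \<integral>\<^sup>+k. \<integral>\<^sup>+s. H (fun_upd \<omega> [] (k, s)) \<partial>measure_pmf q \<partial>measure_pmf \<mu> \<partial>?N)"
    if H [measurable]: "H \<in> borel_measurable ?N" for H
  proof -
    have "(\<integral>\<^sup>+\<omega>. H \<omega> \<partial>?N) = (\<integral>\<^sup>+\<omega>. H \<omega> \<partial>distr (?p \<Otimes>\<^sub>M ?N) ?N (\<lambda>(c, \<omega>). fun_upd \<omega> [] c))"
      using \<open>distr _ _ _ = ?N\<close> by simp
    also have "\<dots> = (\<integral>\<^sup>+x. H ((\<lambda>(c, \<omega>). fun_upd \<omega> [] c) x) \<partial>(?p \<Otimes>\<^sub>M ?N))"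
      by (rule nn_integral_distr[OF *]) measurable
    also have "\<dots> = (\<integral>\<^sup>+\<omega>. \<integral>\<^sup>+c. H ((\<lambda>(c, \<omega>). fun_upd \<omega> [] c) (c, \<omega>)) \<partial>?p \<partial>?N)"
      by (rule PN.nn_integral_snd[symmetric]) (rule measurable_compose[OF * H])
    finally show ?thesis by (simp add: nn_integral_pair_pmf')
  qed
  have [measurable]: "(\<lambda>\<omega>. \<integral>\<^sup>+s. F (set_inc s \<omega>) \<partial>measure_pmf q) \<in> borel_measurable ?N"
    using fin by (subst nn_integral_measure_pmf_finite) auto
  \<comment> \<open>On the right, \<open>eq\<close> first draws an increment \<open>s'\<close>,
    which is then overwritten; integrating it out leaves the same iterated integral as on the
    left.\<close>
  have u: "set_inc s (fun_upd \<omega> [] (k, s')) = fun_upd \<omega> [] (k, s)" for s s' k and \<omega> :: "nat list \<Rightarrow> nat \<times> 'a"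
    by (simp add: set_inc_def)
  show ?thesis
    by (simp add: eq u)
qed

section \<open>The random walk and its Green function\<close>

locale brw = group G for G :: "('a, 'b) monoid_scheme" (structure) +
  fixes S :: "'a set" and \<mu> :: "nat pmf" and q :: "'a pmf" and m :: real
  assumes finS: "finite S" and S_carrier: "S \<subseteq> carrier G"
    and S_inv: "\<And>s. s \<in> S \<Longrightarrow> inv s \<in> S" and S_gen: "generate G S = carrier G"
    and mean: "offspring_mean \<mu> = ennreal m" and m_gt: "1 < m" and mu0: "pmf \<mu> 0 = 0"
    and q_supp: "set_pmf q = insert \<one> S" and q_sym: "\<And>s. s \<in> S \<Longrightarrow> pmf q s = pmf q (inv s)"
    and critical: "ennreal m * spectral_radius_rw G q \<le> 1"
begin

abbreviation "T \<equiv> set_pmf q"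
abbreviation "C \<equiv> carrier G"

lemma T_fin [simp]: "finite T" by (simp add: q_supp finS)
lemma T_C [simp, intro]: "s \<in> T \<Longrightarrow> s \<in> C" using S_carrier by (auto simp: q_supp)
lemma T_inv [simp]: "s \<in> T \<Longrightarrow> inv s \<in> T" using S_inv by (auto simp: q_supp)
lemma one_T [simp]: "\<one> \<in> T" by (simp add: q_supp)
lemma p_sym: "s \<in> T \<Longrightarrow> pmf q (inv s) = pmf q s" using q_sym by (auto simp: q_supp)
lemma pmf_T_pos: "s \<in> T \<Longrightarrow> 0 < pmf q s" by (simp add: pmf_positive)

lemma sum_T_inv: "(\<Sum>s\<in>T. f s) = (\<Sum>s\<in>T. f (inv s))"
  by (rule sum.reindex_bij_witness[where i = "\<lambda>s. inv s" and j = "\<lambda>s. inv s"]) auto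

lemma sum_T_one: "(\<Sum>s\<in>T. ennreal (pmf q s)) = 1"
  by (simp add: sum_pmf_eq_1)

definition avg :: "('a \<Rightarrow> ennreal) \<Rightarrow> 'a \<Rightarrow> ennreal" where
  "avg \<psi> x = (\<Sum>s\<in>T. ennreal (pmf q s) * \<psi> (x \<otimes> s))"

lemma avg_mono: "x \<in> C \<Longrightarrow> (\<And>y. y \<in> C \<Longrightarrow> \<psi> y \<le> \<phi> y) \<Longrightarrow> avg \<psi> x \<le> avg \<phi> x"
  unfolding avg_def by (intro sum_mono mult_left_mono) auto

lemma avg_cong: "x \<in> C \<Longrightarrow> (\<And>y. y \<in> C \<Longrightarrow> \<psi> y = \<phi> y) \<Longrightarrow> avg \<psi> x = avg \<phi> x"
  unfolding avg_def by (intro sum.cong) auto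

lemma avg_add: "avg (\<lambda>x. \<psi> x + \<phi> x) x = avg \<psi> x + avg \<phi> x"
  unfolding avg_def by (simp add: distrib_left sum.distrib)

lemma avg_cmult: "avg (\<lambda>x. c * \<psi> x) x = c * avg \<psi> x"
  unfolding avg_def by (simp add: sum_distrib_left mult_ac)

lemma avg_const [simp]: "avg (\<lambda>_. c) x = c"
  unfolding avg_def by (simp add: sum_T_one flip: sum_distrib_right)

lemma avg_suminf: "avg (\<lambda>x. \<Sum>n. f n x) x = (\<Sum>n. avg (f n) x)"
  unfolding avg_def by (simp add: suminf_sum flip: ennreal_suminf_cmult)

lemma avg_translate: "g \<in> C \<Longrightarrow> x \<in> C \<Longrightarrow> avg (\<lambda>y. \<psi> (g \<otimes> y)) x = avg \<psi> (g \<otimes> x)"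
  unfolding avg_def by (intro sum.cong refl) (simp add: m_assoc)

lemma stpn_mono: "x \<in> C \<Longrightarrow> (\<And>y. y \<in> C \<Longrightarrow> \<psi> y \<le> \<phi> y) \<Longrightarrow> (avg ^^ n) \<psi> x \<le> (avg ^^ n) \<phi> x"
  by (induction n arbitrary: x) (auto intro: avg_mono)

lemma stpn_cong: "x \<in> C \<Longrightarrow> (\<And>y. y \<in> C \<Longrightarrow> \<psi> y = \<phi> y) \<Longrightarrow> (avg ^^ n) \<psi> x = (avg ^^ n) \<phi> x"
  by (intro antisym stpn_mono) auto

lemma stpn_translate: "g \<in> C \<Longrightarrow> x \<in> C \<Longrightarrow> (avg ^^ n) (\<lambda>y. \<psi> (g \<otimes> y)) x = (avg ^^ n) \<psi> (g \<otimes> x)"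
proof (induction n arbitrary: x)
  case (Suc n)
  have "(avg ^^ Suc n) (\<lambda>y. \<psi> (g \<otimes> y)) x = avg (\<lambda>y. (avg ^^ n) \<psi> (g \<otimes> y)) x"
    using Suc by (auto intro!: avg_cong)
  then show ?case using Suc.prems by (simp add: avg_translate)
qed simp

lemma stpn_cmult: "(avg ^^ n) (\<lambda>x. c * \<psi> x) x = c * (avg ^^ n) \<psi> x"
proof -
  have "(avg ^^ n) (\<lambda>x. c * \<psi> x) = (\<lambda>x. c * (avg ^^ n) \<psi> x)"
    by (induction n) (auto simp: avg_cmult intro!: ext)
  then show ?thesis by simp
qed

lemma stpn_add: "(avg ^^ n) (\<lambda>x. \<psi> x + \<phi> x) x = (avg ^^ n) \<psi> x + (avg ^^ n) \<phi> x"
proof -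
  have "(avg ^^ n) (\<lambda>x. \<psi> x + \<phi> x) = (\<lambda>x. (avg ^^ n) \<psi> x + (avg ^^ n) \<phi> x)"
    by (induction n) (auto simp: avg_add intro!: ext)
  then show ?thesis by simp
qed

lemma stpn_suminf: "(avg ^^ n) (\<lambda>x. \<Sum>k. f k x) x = (\<Sum>k. (avg ^^ n) (f k) x)"
proof -
  have "(avg ^^ n) (\<lambda>x. \<Sum>k. f k x) = (\<lambda>x. \<Sum>k. (avg ^^ n) (f k) x)"
    by (induction n) (auto simp: avg_suminf intro!: ext)
  then show ?thesis by simp
qed

text \<open>The probability that the walk from \<open>x\<close> is at the identity after
  \<open>n\<close> steps.\<close>

definition heat :: "nat \<Rightarrow> 'a \<Rightarrow> ennreal" where
  "heat n = (avg ^^ n) (indicator {\<one>})"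

lemma heat_0: "heat 0 = indicator {\<one>}" by (simp add: heat_def)
lemma heat_Suc: "heat (Suc n) x = avg (heat n) x" by (simp add: heat_def)
lemma stpn_heat: "(avg ^^ k) (heat n) = heat (k + n)" by (simp add: heat_def funpow_add)

text \<open>For one step, \<open>x s = 1\<close> iff \<open>s x = 1\<close>; for more, left and
  right multiplication commute. Peeling a step off on the other side is what turns the symmetry of
  \<open>q\<close> into invariance under inversion.\<close>

lemma heat_Suc_left: "x \<in> C \<Longrightarrow> heat (Suc n) x = (\<Sum>s\<in>T. ennreal (pmf q s) * heat n (s \<otimes> x))"
proof (induction n arbitrary: x)
  case 0
  have "x \<otimes> s = \<one> \<longleftrightarrow> s \<otimes> x = \<one>" if "s \<in> T" for s
    using 0 that by (metis T_C inv_comm)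
  then show ?case
    unfolding heat_Suc avg_def heat_0 by (intro sum.cong refl) (auto simp: indicator_def)
next
  case (Suc n)
  have "heat (Suc (Suc n)) x = (\<Sum>s\<in>T. ennreal (pmf q s) * (\<Sum>t\<in>T. ennreal (pmf q t) * heat n (t \<otimes> (x \<otimes> s))))"
    using Suc.prems by (subst heat_Suc) (simp add: avg_def Suc.IH)
  also have "\<dots> = (\<Sum>t\<in>T. ennreal (pmf q t) * (\<Sum>s\<in>T. ennreal (pmf q s) * heat n (t \<otimes> (x \<otimes> s))))"
    unfolding sum_distrib_left by (subst sum.swap) (simp add: mult_ac)
  also have "\<dots> = (\<Sum>t\<in>T. ennreal (pmf q t) * heat (Suc n) (t \<otimes> x))"
    using Suc.prems by (intro sum.cong refl) (simp add: heat_Suc avg_def m_assoc)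
  finally show ?case .
qed

lemma heat_inv: "x \<in> C \<Longrightarrow> heat n (inv x) = heat n x"
proof (induction n arbitrary: x)
  case (Suc n)
  have "heat (Suc n) (inv x) = (\<Sum>s\<in>T. ennreal (pmf q s) * heat n (inv (inv s \<otimes> x)))"
    using Suc.prems by (simp add: heat_Suc avg_def inv_mult_group)
  also have "\<dots> = (\<Sum>s\<in>T. ennreal (pmf q s) * heat n (inv s \<otimes> x))"
    using Suc by (intro sum.cong refl) auto
  also have "\<dots> = (\<Sum>s\<in>T. ennreal (pmf q s) * heat n (s \<otimes> x))"
    by (subst sum_T_inv) (simp add: p_sym)
  finally show ?case using Suc.prems by (simp add: heat_Suc_left)
qed (auto simp: heat_0 indicator_def)

lemma nn_integral_q: "(\<integral>\<^sup>+s. f s \<partial>measure_pmf q) = (\<Sum>s\<in>T. ennreal (pmf q s) * f s)"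
  by (subst nn_integral_measure_pmf_finite) (auto simp: mult.commute)

lemma nn_integral_rw: "(\<integral>\<^sup>+x. \<psi> x \<partial>measure_pmf (rw_step_dist G q n)) = (avg ^^ n) \<psi> \<one>"
proof (induction n arbitrary: \<psi>)
  case (Suc n)
  have "(\<integral>\<^sup>+x. \<psi> x \<partial>measure_pmf (rw_step_dist G q (Suc n)))
      = (\<integral>\<^sup>+x. avg \<psi> x \<partial>measure_pmf (rw_step_dist G q n))"
    by (simp add: nn_integral_q avg_def)
  then show ?case by (simp add: Suc funpow_swap1)
qed simp

lemma return_prob_heat: "ennreal (return_prob G q n) = heat n \<one>"
  using nn_integral_rw[where \<psi> = "indicator {\<one>}" and n = n]
  by (simp add: return_prob_def heat_def emeasure_pmf_single)

section \<open>The Green function for weights up to and including \<open>m\<close>\<close>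

definition green :: "ennreal \<Rightarrow> 'a \<Rightarrow> ennreal" where
  "green z x = (\<Sum>n. z ^ n * heat n x)"

lemma suminf_head_ennreal: "(\<Sum>n. f n) = f 0 + (\<Sum>n. f (Suc n))" for f :: "nat \<Rightarrow> ennreal"
proof -
  have "(\<lambda>n. f (Suc n)) sums (\<Sum>n. f (Suc n))" by (simp add: summable_sums)
  from sums_Suc[OF this] show ?thesis by (simp add: sums_iff add.commute)
qed

lemma green_unfold: "green z x = indicator {\<one>} x + z * avg (green z) x"
proof -
  have "green z x = heat 0 x + (\<Sum>n. z * (z ^ n * avg (heat n) x))"
    unfolding green_def by (subst suminf_head_ennreal) (simp add: heat_Suc mult.assoc)
  also have "(\<Sum>n. z * (z ^ n * avg (heat n) x)) = z * avg (green z) x"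
    unfolding green_def avg_suminf avg_cmult by simp
  finally show ?thesis by (simp add: heat_0)
qed

lemma green_inv: "x \<in> C \<Longrightarrow> green z (inv x) = green z x"
  by (simp add: green_def heat_inv)

text \<open>Iterates the Green equation \<open>t\<close> times. It identifies the first term as the
  tail of a convergent series, hence as an error that can be made small.\<close>

lemma green_tail: "z ^ t * (avg ^^ t) (green z) x + (\<Sum>n<t. z ^ n * heat n x) = green z x"
proof (induction t)
  case (Suc t)
  have "z ^ t * (avg ^^ t) (green z) x
     = z ^ t * (avg ^^ t) (\<lambda>x. indicator {\<one>} x + z * avg (green z) x) x"
    by (subst green_unfold[abs_def]) simp
  also have "\<dots> = z ^ t * heat t x + z ^ Suc t * (avg ^^ Suc t) (green z) x"
    by (simp add: stpn_add stpn_cmult heat_def distrib_left funpow_swap1 mult_ac del: funpow.simps)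
       (simp add: funpow_swap1 funpow_Suc_right o_def mult_ac)
  finally show ?case using Suc by (simp add: add_ac)
qed simp

lemma green_one_finite:
  assumes z: "0 < z" "z < m" shows "green (ennreal z) \<one> < \<infinity>"
proof -
  \<comment> \<open>Room between \<open>z\<close> and \<open>m\<close>: the return probabilities are
    eventually at most \<open>(1 / z')^n\<close>, so the series is dominated by a geometric one of
    ratio \<open>z / z'\<close>.\<close>
  obtain z' where z': "z < z'" "z' < m" using z dense by blast
  have "spectral_radius_rw G q < ennreal (1 / z')"
  proof (rule ccontr)
    assume "\<not> ?thesis"
    then have "ennreal m * ennreal (1 / z') \<le> ennreal m * spectral_radius_rw G q"
      by (intro mult_left_mono) auto
    also have "\<dots> \<le> 1" by (rule critical)
    finally have "m * (1 / z') \<le> 1"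
      using m_gt z z' by (simp add: ennreal_mult[symmetric] del: ennreal_1 flip: ennreal_1)
    then show False using z z' by (simp add: field_simps)
  qed
  then have "\<forall>\<^sub>F n in sequentially. ennreal (return_prob G q n powr (1 / real n)) < ennreal (1 / z')"
    unfolding spectral_radius_rw_def by (rule Limsup_lessD)
  then obtain n0 where n0: "\<And>n. n \<ge> n0 \<Longrightarrow> return_prob G q n powr (1 / real n) < 1 / z'"
    using z z' by (auto simp: eventually_sequentially ennreal_less_iff)
  have le: "return_prob G q n \<le> (1 / z') ^ n" if n: "n \<ge> Suc n0" for n
  proof (cases "return_prob G q n = 0")
    case False
    then have pos: "0 < return_prob G q n" by (simp add: return_prob_def order_less_le pmf_nonneg)
    have "return_prob G q n = (return_prob G q n powr (1 / real n)) powr real n"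
      using n pos by (simp add: powr_powr)
    also have "\<dots> \<le> (1 / z') powr real n"
      using n0[of n] n z z' by (intro powr_mono2) auto
    also have "\<dots> = (1 / z') ^ n" using z z' by (simp add: powr_realpow)
    finally show ?thesis .
  qed (use z z' in auto)
  have "summable (\<lambda>n. z ^ n * return_prob G q n)"
  proof (rule summable_comparison_test[OF _ summable_geometric[of "z / z'"]])
    have "norm (z ^ n * return_prob G q n) \<le> (z / z') ^ n" if "n \<ge> Suc n0" for n
    proof -
      have "z ^ n * return_prob G q n \<le> z ^ n * (1 / z') ^ n"
        using le[OF that] z by (intro mult_left_mono) auto
      then show ?thesis using z by (simp add: return_prob_def power_divide)
    qed
    then show "\<exists>N. \<forall>n\<ge>N. norm (z ^ n * return_prob G q n) \<le> (z / z') ^ n" by blast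
    show "norm (z / z') < 1" using z z' by simp
  qed
  then have "(\<Sum>n. ennreal (z ^ n * return_prob G q n)) \<noteq> \<infinity>"
    using z by (subst suminf_ennreal_eq[OF _ summable_sums]) (auto simp: return_prob_def)
  moreover have "green (ennreal z) \<one> = (\<Sum>n. ennreal (z ^ n * return_prob G q n))"
    using z by (simp add: green_def ennreal_mult return_prob_def ennreal_power flip: return_prob_heat)
  ultimately show ?thesis by (simp add: less_top)
qed

text \<open>
  The sum of \<open>z\<^sup>n P(first return to A at time n) \<psi>(position)\<close> over \<open>1 \<le> n \<le> t\<close>, for the walk from \<open>x\<close>.
\<close>

primrec hit :: "ennreal \<Rightarrow> ('a \<Rightarrow> bool) \<Rightarrow> ('a \<Rightarrow> ennreal) \<Rightarrow> nat \<Rightarrow> 'a \<Rightarrow> ennreal" where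
  "hit z A \<psi> 0 x = 0"
| "hit z A \<psi> (Suc t) x = z * avg (\<lambda>y. if A y then \<psi> y else hit z A \<psi> t y) x"

text \<open>Maximum principle: off \<open>A\<close> a supersolution can only lose weight along the
  walk, so stopping at \<open>A\<close> collects at most its one-step average.\<close>

lemma hit_le_super:
  assumes "\<And>y. y \<in> C \<Longrightarrow> A y \<Longrightarrow> \<psi> y \<le> \<Phi> y" "\<And>y. y \<in> C \<Longrightarrow> \<not> A y \<Longrightarrow> z * avg \<Phi> y \<le> \<Phi> y"
  shows "x \<in> C \<Longrightarrow> hit z A \<psi> t x \<le> z * avg \<Phi> x"
proof (induction t arbitrary: x)
  case (Suc t)
  have "(if A y then \<psi> y else hit z A \<psi> t y) \<le> \<Phi> y" if "y \<in> C" for y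
    using assms[OF that] Suc.IH[OF that] by (auto intro: order_trans)
  then show ?case using Suc.prems by (auto intro!: mult_left_mono avg_mono)
qed simp

text \<open>The converse bound, for subsolutions. Paths that have not met \<open>A\<close> in time
  are still owed their final value; counting all paths of that length bounds this debt.\<close>

lemma hit_ge_child:
  assumes "\<And>y. y \<in> C \<Longrightarrow> \<not> A y \<Longrightarrow> \<Phi> y \<le> z * avg \<Phi> y"
  shows "x \<in> C \<Longrightarrow> z * avg \<Phi> x \<le> hit z A \<Phi> t x + z ^ Suc t * (avg ^^ Suc t) \<Phi> x"
proof (induction t arbitrary: x)
  case (Suc t)
  have "\<Phi> y \<le> (if A y then \<Phi> y else hit z A \<Phi> t y) + z ^ Suc t * (avg ^^ Suc t) \<Phi> y" if "y \<in> C" for y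
    using assms[OF that] Suc.IH[OF that] by (auto intro: order_trans)
  then have "z * avg \<Phi> x \<le> z * avg (\<lambda>y. (if A y then \<Phi> y else hit z A \<Phi> t y) + z ^ Suc t * (avg ^^ Suc t) \<Phi> y) x"
    using Suc.prems by (intro mult_left_mono avg_mono) auto
  also have "\<dots> = hit z A \<Phi> (Suc t) x + z ^ Suc (Suc t) * (avg ^^ Suc (Suc t)) \<Phi> x"
    by (simp add: avg_add distrib_left mult_ac flip: avg_cmult)
  finally show ?case .
qed simp

text \<open>Only the two values of \<open>\<psi>\<close> on the set matter, and \<open>hit\<close>
  is linear in them.\<close>

lemma hit_two_points:
  assumes "s \<noteq> \<one>" "x \<in> C"
  shows "hit z (\<lambda>y. y = \<one> \<or> y = s) \<psi> t x = hit z (\<lambda>y. y = \<one> \<or> y = s) (indicator {\<one>}) t x * \<psi> \<one>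
     + hit z (\<lambda>y. y = \<one> \<or> y = s) (indicator {s}) t x * \<psi> s"
  using assms(2)
proof (induction t arbitrary: x)
  case (Suc t)
  let ?h = "\<lambda>\<psi> y. if y = \<one> \<or> y = s then \<psi> y else hit z (\<lambda>y. y = \<one> \<or> y = s) \<psi> t y"
  have "avg (?h \<psi>) x = avg (\<lambda>y. \<psi> \<one> * ?h (indicator {\<one>}) y + \<psi> s * ?h (indicator {s}) y) x"
    using Suc assms(1) by (intro avg_cong) (auto simp: mult.commute)
  then show ?case by (simp only: hit.simps avg_add avg_cmult distrib_left mult_ac)
qed simp

text \<open>
  Here \<open>\<alpha>\<close> and \<open>\<beta>\<close> are the first-return weights from \<open>1\<close> to \<open>1\<close> and to \<open>s\<close> for the set \<open>{1, s}\<close>. Up to the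
  error \<open>\<epsilon>\<close>, the values \<open>g, h\<close> of the Green function satisfy \<open>(g - h)(1 - \<alpha> + \<beta>) = 1\<close> and
  \<open>(g + h)(1 - \<alpha> - \<beta>) = 1\<close>.
\<close>

lemma two_point_real:
  fixes g h \<alpha> \<beta> \<epsilon> b :: real
  assumes "g \<le> 1 + \<alpha> * g + \<beta> * h + \<epsilon>" "1 + \<alpha> * g + \<beta> * h \<le> g" "\<alpha> * h + \<beta> * g \<le> h"
    "b \<le> \<beta>" "0 \<le> b" "0 \<le> g" "0 \<le> h" "0 \<le> \<epsilon>"
  shows "2 * b * (g - h) \<le> 1 + \<epsilon>"
proof (cases "g \<le> h")
  case True
  then have "2 * b * (g - h) \<le> 0" using assms by (simp add: mult_nonneg_nonpos)
  then show ?thesis using assms by linarith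
next
  case False
  have "1 \<le> (1 - \<alpha> - \<beta>) * (g + h)" using assms by (simp add: algebra_simps)
  then have "0 < (1 - \<alpha> - \<beta>) * (g + h)" by linarith
  then have ab: "\<alpha> + \<beta> < 1" using assms by (auto simp: zero_less_mult_iff)
  have "(1 - \<alpha> + \<beta>) * (g - h) \<le> 1 + \<epsilon>" using assms by (simp add: algebra_simps)
  moreover have "2 * b * (g - h) \<le> (1 - \<alpha> + \<beta>) * (g - h)"
    using False ab assms by (intro mult_right_mono) auto
  ultimately show ?thesis by linarith
qed

text \<open>Both the Green function and its translate by \<open>s\<close> are harmonic off
  \<open>{1, s}\<close>, and by symmetry the translate has the same two values interchanged. This
  yields the inequalities of \<open>two_point_real\<close>. The sum on the right avoids subtraction
  in \<open>ennreal\<close>.\<close>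

lemma green_diff:
  assumes z: "1 < z" "z < m" and s: "s \<in> T" "s \<noteq> \<one>"
  shows "ennreal (2 * z * pmf q s) * green (ennreal z) \<one> \<le> 1 + ennreal (2 * z * pmf q s) * green (ennreal z) s"
proof -
  let ?z = "ennreal z" and ?A = "\<lambda>y. y = \<one> \<or> y = s"
  define g where "g = enn2real (green ?z \<one>)"
  define h where "h = enn2real (green ?z s)"
  have gfin: "green ?z \<one> < \<infinity>" using green_one_finite z by auto
  \<comment> \<open>The Green equation at the identity bounds \<open>q(s) G(s)\<close> by
    \<open>G(1)\<close>, which gives the finiteness of \<open>G(s)\<close>.\<close>
  have "ennreal (pmf q s) * green ?z s \<le> avg (green ?z) \<one>"
    using s member_le_sum[of s T "\<lambda>s. ennreal (pmf q s) * green ?z s"] by (simp add: avg_def)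
  also have "\<dots> \<le> ?z * avg (green ?z) \<one>"
    using z by (metis ennreal_le_iff ennreal_1 less_eq_real_def mult_right_mono mult_1 zero_le
        order_less_trans zero_less_one)
  also have "\<dots> \<le> green ?z \<one>" by (subst green_unfold) simp
  finally have "ennreal (pmf q s) * green ?z s < \<infinity>" using gfin by (simp add: less_le_trans le_less_trans)
  then have hfin: "green ?z s < \<infinity>"
    using pmf_T_pos[OF s(1)] by (auto simp: ennreal_mult_less_top)
  have g: "green ?z \<one> = ennreal g" and h: "green ?z s = ennreal h" and gh: "0 \<le> g" "0 \<le> h"
    using gfin hfin by (auto simp: g_def h_def)
  have sC: "s \<in> C" using s by auto
  let ?\<Phi> = "\<lambda>x. green ?z (inv s \<otimes> x)"
  have off: "green ?z y = ?z * avg (green ?z) y" if "y \<noteq> \<one>" for y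
    using that by (subst green_unfold) simp
  have offs: "?\<Phi> y = ?z * avg ?\<Phi> y" if "y \<in> C" "y \<noteq> s" for y
  proof -
    have "inv s \<otimes> y \<noteq> \<one>" using that sC by (metis inv_closed inv_equality inv_inv)
    then show ?thesis using that sC by (subst off) (simp_all add: avg_translate)
  qed
  have g1: "green ?z \<one> = 1 + ?z * avg (green ?z) \<one>" by (subst green_unfold) simp
  have main: "2 * (z * pmf q s) * (g - h) \<le> 1 + \<epsilon>" if \<epsilon>: "0 < \<epsilon>" for \<epsilon>
  proof -
    have "(\<lambda>t. \<Sum>n<t. ?z ^ n * heat n \<one>) \<longlonglongrightarrow> green ?z \<one>"
      unfolding green_def by (rule summable_LIMSEQ) simp
    moreover have "ennreal (g - \<epsilon>) < green ?z \<one>"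
    proof -
      have "1 \<le> green ?z \<one>" by (subst green_unfold) simp
      then have "1 \<le> g" by (simp add: g)
      then show ?thesis using \<epsilon> by (simp add: g ennreal_lessI)
    qed
    ultimately have "\<forall>\<^sub>F t in sequentially. ennreal (g - \<epsilon>) < (\<Sum>n<t. ?z ^ n * heat n \<one>)"
      by (rule order_tendstoD)
    then obtain t0 where t0: "\<And>t. t \<ge> t0 \<Longrightarrow> ennreal (g - \<epsilon>) < (\<Sum>n<t. ?z ^ n * heat n \<one>)"
      by (auto simp: eventually_sequentially)
    \<comment> \<open>One more than \<open>t0\<close>, so that \<open>hit\<close> contains at least
      the direct step from the identity to \<open>s\<close>; that step gives the lower bound
      \<open>z q(s)\<close> for \<open>\<beta>\<close>.\<close>
    define t where "t = Suc t0"
    define e where "e = enn2real (?z ^ Suc t * (avg ^^ Suc t) (green ?z) \<one>)"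
    define p where "p = enn2real (\<Sum>n<Suc t. ?z ^ n * heat n \<one>)"
    have tail: "?z ^ Suc t * (avg ^^ Suc t) (green ?z) \<one> + (\<Sum>n<Suc t. ?z ^ n * heat n \<one>) = green ?z \<one>"
      by (rule green_tail)
    then have fin: "?z ^ Suc t * (avg ^^ Suc t) (green ?z) \<one> < \<infinity>" "(\<Sum>n<Suc t. ?z ^ n * heat n \<one>) < \<infinity>"
      using gfin unfolding tail[symmetric] infinity_ennreal_def ennreal_add_less_top by blast+
    then have ep: "?z ^ Suc t * (avg ^^ Suc t) (green ?z) \<one> = ennreal e"
        "(\<Sum>n<Suc t. ?z ^ n * heat n \<one>) = ennreal p" "0 \<le> e" "0 \<le> p"
      by (simp_all only: e_def p_def ennreal_enn2real infinity_ennreal_def enn2real_nonneg)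
    have "e + p = g" using tail gh ep by (simp add: g flip: ennreal_plus del: funpow.simps sum.lessThan_Suc power_Suc)
    moreover have "g - \<epsilon> < p" using t0[of "Suc t"] ep gh
      by (cases "0 \<le> g - \<epsilon>") (simp_all add: t_def ennreal_less_iff del: sum.lessThan_Suc)
    ultimately have e: "e \<le> \<epsilon>" by simp
    define \<alpha> where "\<alpha> = enn2real (hit ?z ?A (indicator {\<one>}) t \<one>)"
    define \<beta> where "\<beta> = enn2real (hit ?z ?A (indicator {s}) t \<one>)"
    have up: "green ?z \<one> \<le> 1 + (hit ?z ?A (green ?z) t \<one> + ennreal e)"
      unfolding ep(1)[symmetric] by (subst g1) (intro add_left_mono hit_ge_child, auto simp: off[symmetric])
    have lo: "1 + hit ?z ?A (green ?z) t \<one> \<le> green ?z \<one>"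
      by (subst g1) (intro add_left_mono hit_le_super, auto simp: off[symmetric])
    have "hit ?z ?A ?\<Phi> t \<one> \<le> ?z * avg ?\<Phi> \<one>"
      by (rule hit_le_super) (auto simp: offs[symmetric])
    also have "\<dots> = green ?z (inv s)" using offs[of \<one>] s sC by simp
    finally have hi: "hit ?z ?A ?\<Phi> t \<one> \<le> ennreal h" using sC by (simp add: green_inv h)
    have dec: "hit ?z ?A \<psi> t \<one> = hit ?z ?A (indicator {\<one>}) t \<one> * \<psi> \<one> + hit ?z ?A (indicator {s}) t \<one> * \<psi> s" for \<psi>
      by (rule hit_two_points) (use s in auto)
    have g_ge: "1 \<le> g"
    proof -
      have "1 \<le> green ?z \<one>" by (subst green_unfold) simp
      then show ?thesis by (simp add: g)
    qed
    have lo': "1 + (hit ?z ?A (indicator {\<one>}) t \<one> * ennreal g + hit ?z ?A (indicator {s}) t \<one> * ennreal h) \<le> ennreal g"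
      using lo by (simp only: dec[of "green ?z"] g h)
    have hi': "hit ?z ?A (indicator {\<one>}) t \<one> * ennreal h + hit ?z ?A (indicator {s}) t \<one> * ennreal g \<le> ennreal h"
      using hi sC by (simp add: dec[of ?\<Phi>] green_inv g h)
    have "hit ?z ?A (indicator {\<one>}) t \<one> * ennreal g \<le> ennreal g"
      by (rule order_trans[OF add_increasing[OF zero_le add_increasing2[OF zero_le order_refl]] lo'])
    moreover have "hit ?z ?A (indicator {s}) t \<one> * ennreal g \<le> ennreal h"
      by (rule order_trans[OF add_increasing[OF zero_le order_refl] hi'])
    ultimately have "hit ?z ?A (indicator {\<one>}) t \<one> * ennreal g < \<infinity>"
        "hit ?z ?A (indicator {s}) t \<one> * ennreal g < \<infinity>"
      by (simp_all add: le_less_trans)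
    then have "hit ?z ?A (indicator {\<one>}) t \<one> < \<infinity>" "hit ?z ?A (indicator {s}) t \<one> < \<infinity>"
      using g_ge by (auto simp: ennreal_mult_less_top)
    then have ab: "hit ?z ?A (indicator {\<one>}) t \<one> = ennreal \<alpha>" "hit ?z ?A (indicator {s}) t \<one> = ennreal \<beta>"
        "0 \<le> \<alpha>" "0 \<le> \<beta>"
      by (simp_all only: \<alpha>_def \<beta>_def ennreal_enn2real infinity_ennreal_def enn2real_nonneg)
    have "?z * (ennreal (pmf q s) * 1) \<le> hit ?z ?A (indicator {s}) t \<one>"
      unfolding t_def hit.simps avg_def
      by (intro mult_left_mono order_trans[OF _ member_le_sum[of s T]]) (use s sC in auto)
    then have b: "z * pmf q s \<le> \<beta>" using z ab by (simp add: ennreal_mult[symmetric])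
    show ?thesis
    proof (rule two_point_real[of g \<alpha> \<beta> h, THEN order_trans])
      show "g \<le> 1 + \<alpha> * g + \<beta> * h + e"
        using up[unfolded dec[of "green ?z"] g h ab(1,2)] ab gh ep(3)
        by (simp add: add_ac flip: ennreal_plus ennreal_mult ennreal_1)
      show "1 + \<alpha> * g + \<beta> * h \<le> g"
        using lo'[unfolded ab(1,2)] ab gh by (simp add: add_ac flip: ennreal_plus ennreal_mult ennreal_1)
      show "\<alpha> * h + \<beta> * g \<le> h"
        using hi'[unfolded ab(1,2)] ab gh by (simp add: add_ac flip: ennreal_plus ennreal_mult)
    qed (use b e ep gh z in auto)
  qed
  have "2 * (z * pmf q s) * (g - h) \<le> 1"
    by (rule field_le_epsilon) (rule main)
  then have "2 * z * pmf q s * g \<le> 1 + 2 * z * pmf q s * h" by (simp add: algebra_simps)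
  then show ?thesis using gh z by (simp add: g h flip: ennreal_plus ennreal_mult ennreal_1)
qed

text \<open>Sum \<open>green_diff\<close> over the support: the weights add up to 1 and
  \<open>z P G(1) \<le> G(1)\<close>, so \<open>(2 z - 2) G(1)\<close> is at most the size of the
  support. This bound does not blow up as \<open>z\<close> approaches \<open>m\<close>.\<close>

lemma green_one_bound:
  assumes z: "1 < z" "z < m"
  shows "green (ennreal z) \<one> \<le> ennreal (real (card T) / (2 * (z - 1)))"
proof -
  let ?z = "ennreal z"
  have gfin: "green ?z \<one> < \<infinity>" using green_one_finite z by auto
  define g where "g = enn2real (green ?z \<one>)"
  have g: "green ?z \<one> = ennreal g" "0 \<le> g" using gfin by (auto simp: g_def)
  have "ennreal (2 * z * pmf q s) * ennreal g \<le> 1 + ennreal (2 * z * pmf q s) * green ?z s" if "s \<in> T" for s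
    using green_diff[OF z that] g by (cases "s = \<one>") auto
  then have "(\<Sum>s\<in>T. ennreal (2 * z * pmf q s) * ennreal g) \<le> (\<Sum>s\<in>T. 1 + ennreal (2 * z * pmf q s) * green ?z s)"
    by (rule sum_mono)
  also have "\<dots> = ennreal (real (card T)) + 2 * (?z * avg (green ?z) \<one>)"
    using z by (simp add: sum.distrib avg_def sum_distrib_left ennreal_mult mult.assoc ennreal_of_nat_eq_real_of_nat)
  also have "(\<Sum>s\<in>T. ennreal (2 * z * pmf q s) * ennreal g) = ennreal (2 * z * g)"
    using z g by (simp add: ennreal_mult mult_ac flip: sum_distrib_left sum_distrib_right) (simp add: sum_pmf_eq_1)
  finally have 1: "ennreal (2 * z * g) \<le> ennreal (real (card T)) + 2 * (?z * avg (green ?z) \<one>)" .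
  have "?z * avg (green ?z) \<one> \<le> ennreal g" unfolding g(1)[symmetric] by (subst green_unfold) simp
  then have "2 * (?z * avg (green ?z) \<one>) \<le> 2 * ennreal g" by (rule mult_left_mono) simp
  with 1 have "ennreal (2 * z * g) \<le> ennreal (real (card T)) + 2 * ennreal g"
    by (meson add_left_mono order_trans)
  also have "\<dots> = ennreal (real (card T) + 2 * g)" using g by (simp add: ennreal_mult)
  finally have "2 * z * g \<le> real (card T) + 2 * g" using g by (subst (asm) ennreal_le_iff) auto
  then have "g * (2 * (z - 1)) \<le> real (card T)" by (simp add: algebra_simps)
  then show ?thesis using z g by (simp add: pos_le_divide_eq)
qed

definition Gm :: ennreal where "Gm = green (ennreal m) \<one>"

lemma Gm_finite: "Gm < \<infinity>"
proof -
  let ?B = "ennreal (real (card T) / (m - 1))"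
  have bnd: "green (ennreal y) \<one> \<le> ?B" if y: "1 < y" "y < m" "(m - 1) / 2 \<le> y - 1" for y
  proof -
    have "m - 1 \<le> 2 * (y - 1)" "0 < m - 1" using y by auto
    then have "real (card T) / (2 * (y - 1)) \<le> real (card T) / (m - 1)"
      by (intro divide_left_mono mult_pos_pos) auto
    then show ?thesis using green_one_bound[OF y(1,2)] by (meson ennreal_leI order_trans)
  qed
  have eq: "(\<Sum>n<N. ennreal y ^ n * heat n \<one>) = ennreal (\<Sum>n<N. y ^ n * return_prob G q n)" if "0 \<le> y" for y N
    using that by (simp add: sum_ennreal[symmetric] ennreal_mult ennreal_power return_prob_def flip: return_prob_heat)
  have "(\<Sum>n<N. ennreal m ^ n * heat n \<one>) \<le> ?B" for N
  proof -
    \<comment> \<open>These weights increase to \<open>m\<close> and stay at least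
      \<open>(1 + m) / 2\<close>, the threshold above which \<open>bnd\<close> gives the common
      bound \<open>?B\<close>. Each partial sum is a polynomial in the weight, hence
      continuous.\<close>
    have pos: "0 \<le> m - (m - 1) / (real k + 2)" for k using m_gt by (simp add: field_simps)
    have lim: "(\<lambda>k. m - (m - 1) / (real k + 2)) \<longlonglongrightarrow> m" by real_asymp
    have "(\<lambda>k. \<Sum>n<N. ennreal (m - (m - 1) / (real k + 2)) ^ n * heat n \<one>) \<longlonglongrightarrow> (\<Sum>n<N. ennreal m ^ n * heat n \<one>)"
      using m_gt by (subst eq[OF pos], subst eq) (auto intro!: tendsto_ennrealI tendsto_sum tendsto_mult tendsto_power lim)
    moreover have "(\<Sum>n<N. ennreal (m - (m - 1) / (real k + 2)) ^ n * heat n \<one>) \<le> ?B" for k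
    proof -
      let ?y = "m - (m - 1) / (real k + 2)"
      have "(m - 1) / (real k + 2) \<le> (m - 1) / 2"
        by (rule divide_left_mono) (use m_gt in auto)
      moreover have "0 < (m - 1) / (real k + 2)" "0 < m - 1"
        using m_gt by auto
      moreover have "1 < m - d \<and> m - d < m \<and> (m - 1) / 2 \<le> m - d - 1"
        if "d \<le> (m - 1) / 2" "0 < d" "0 < m - 1" for d
        using that by auto
      ultimately have y: "1 < ?y" "?y < m" "(m - 1) / 2 \<le> ?y - 1"
        by blast+
      have "(\<Sum>n<N. ennreal ?y ^ n * heat n \<one>) \<le> green (ennreal ?y) \<one>"
        unfolding green_def by (rule sum_le_suminf) auto
      also have "\<dots> \<le> ?B" by (rule bnd[OF y])
      finally show ?thesis .
    qed
    ultimately show ?thesis by (intro LIMSEQ_le_const2[where X = "\<lambda>k. \<Sum>n<N. ennreal (m - (m - 1) / (real k + 2)) ^ n * heat n \<one>"]) auto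
  qed
  then have "Gm \<le> ?B" unfolding Gm_def green_def by (intro suminf_le_const) auto
  then show ?thesis by (simp add: le_less_trans)
qed

end

section \<open>The branching random walk as a walk indexed by a tree\<close>

lemma nn_integral_lists_Cons:
  "(\<integral>\<^sup>+l. f l \<partial>count_space {l :: nat list. l \<noteq> []}) = (\<Sum>i. \<integral>\<^sup>+l. f (i # l) \<partial>count_space UNIV)"
proof -
  have "bij_betw (\<lambda>(i, l). i # l) (UNIV :: (nat \<times> nat list) set) {l. l \<noteq> []}"
    by (auto simp: bij_betw_def inj_on_def image_def) (metis list.exhaust)
  from nn_integral_bij_count_space[OF this, of f]
  have "(\<integral>\<^sup>+l. f l \<partial>count_space {l. l \<noteq> []}) = (\<integral>\<^sup>+x. f (fst x # snd x) \<partial>count_space (UNIV :: (nat \<times> nat list) set))"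
    by (simp add: case_prod_beta)
  also have "\<dots> = (\<integral>\<^sup>+i. \<integral>\<^sup>+l. f (i # l) \<partial>count_space UNIV \<partial>count_space UNIV)"
    by (subst nn_integral_fst_count_space[symmetric]) simp
  finally show ?thesis by (simp add: nn_integral_count_space_nat)
qed

lemma nn_integral_lists_snoc:
  "(\<integral>\<^sup>+l. f l \<partial>count_space {l :: nat list. l \<noteq> []}) = (\<integral>\<^sup>+l. (\<Sum>i. f (l @ [i])) \<partial>count_space UNIV)"
proof -
  have "bij_betw (\<lambda>(l, i). l @ [i]) (UNIV :: (nat list \<times> nat) set) {l. l \<noteq> []}"
    by (auto simp: bij_betw_def inj_on_def image_def) (metis rev_exhaust)
  from nn_integral_bij_count_space[OF this, of f]
  have "(\<integral>\<^sup>+l. f l \<partial>count_space {l. l \<noteq> []}) = (\<integral>\<^sup>+x. f (fst x @ [snd x]) \<partial>count_space (UNIV :: (nat list \<times> nat) set))"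
    by (simp add: case_prod_beta)
  also have "\<dots> = (\<integral>\<^sup>+l. \<integral>\<^sup>+i. f (l @ [i]) \<partial>count_space UNIV \<partial>count_space UNIV)"
    by (subst nn_integral_fst_count_space[symmetric]) simp
  finally show ?thesis by (simp add: nn_integral_count_space_nat)
qed

lemma nn_integral_lists_split:
  "(\<integral>\<^sup>+l. f l \<partial>count_space (UNIV :: nat list set)) = f [] + (\<integral>\<^sup>+l. f l \<partial>count_space {l. l \<noteq> []})"
proof -
  have "(\<integral>\<^sup>+l. f l \<partial>count_space (UNIV :: nat list set))
     = (\<integral>\<^sup>+l. f l * indicator {[]} l + f l * indicator {l. l \<noteq> []} l \<partial>count_space UNIV)"
    by (intro nn_integral_cong) (auto simp: indicator_def)
  also have "\<dots> = f [] + (\<integral>\<^sup>+l. f l * indicator {l. l \<noteq> []} l \<partial>count_space UNIV)"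
    by (subst nn_integral_add) auto
  finally show ?thesis by (simp add: nn_integral_count_space_indicator)
qed

lemma nn_integral_lists_length:
  "(\<integral>\<^sup>+l. f l \<partial>count_space (UNIV :: nat list set)) = (\<Sum>n. \<integral>\<^sup>+l. f l \<partial>count_space {l. length l = n})"
proof -
  have "f l = (\<Sum>n. f l * indicator {l. length l = n} l)" for l
    by (subst suminf_finite[of "{length l}"]) auto
  then have "(\<integral>\<^sup>+l. f l \<partial>count_space (UNIV :: nat list set))
     = (\<integral>\<^sup>+l. (\<Sum>n. f l * indicator {l. length l = n} l) \<partial>count_space UNIV)"
    by simp
  also have "\<dots> = (\<Sum>n. \<integral>\<^sup>+l. f l * indicator {l. length l = n} l \<partial>count_space UNIV)"
    by (rule nn_integral_suminf) simp
  finally show ?thesis by (simp add: nn_integral_count_space_indicator)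
qed

lemma nn_integral_lists_length_Suc:
  "(\<integral>\<^sup>+l. f l \<partial>count_space {l :: nat list. length l = Suc n})
     = (\<Sum>i. \<integral>\<^sup>+l. f (i # l) \<partial>count_space {l. length l = n})"
proof -
  have "(\<integral>\<^sup>+l. f l \<partial>count_space {l :: nat list. length l = Suc n})
      = (\<integral>\<^sup>+l. f l * indicator {l. length l = Suc n} l \<partial>count_space {l. l \<noteq> []})"
    by (subst nn_integral_count_space_indicator, simp, subst (2) nn_integral_count_space_indicator, simp)
       (auto intro!: nn_integral_cong simp: indicator_def)
  also have "\<dots> = (\<Sum>i. \<integral>\<^sup>+l. f (i # l) * indicator {l. length l = n} l \<partial>count_space UNIV)"
    by (subst nn_integral_lists_Cons) (auto simp: indicator_def intro!: arg_cong[where f = suminf] ext nn_integral_cong)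
  finally show ?thesis by (simp add: nn_integral_count_space_indicator)
qed

lemma sum_less_suminf: "(\<Sum>i<k. f i) = (\<Sum>i. if i < k then f i else 0)" for f :: "nat \<Rightarrow> ennreal"
  by (subst suminf_finite[of "{..<k}"]) auto

lemma borel_measurable_count_space_integral:
  fixes f :: "'i \<Rightarrow> 'x \<Rightarrow> ennreal"
  assumes "countable I" "\<And>i. i \<in> I \<Longrightarrow> f i \<in> borel_measurable M"
  shows "(\<lambda>x. \<integral>\<^sup>+i. f i x \<partial>count_space I) \<in> borel_measurable M"
proof -
  interpret sigma_finite_measure "count_space I"
    using assms by (rule_tac sigma_finite_measure_count_space_countable)
  have "case_prod f \<in> borel_measurable (count_space I \<Otimes>\<^sub>M M)"
    using assms by (intro measurable_pair_measure_countable1) auto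
  from measurable_compose[OF measurable_pair_swap' this] show ?thesis
    by (intro borel_measurable_nn_integral) (simp add: case_prod_beta')
qed

context brw begin

abbreviation "N \<equiv> brw_space \<mu> q"

text \<open>
  Increments are clamped to the support of \<open>q\<close>: the product of two random elements of an uncountable
  type need not be measurable.
\<close>

definition clamp :: "'a \<Rightarrow> 'a" where "clamp s = (if s \<in> T then s else \<one>)"
definition inc :: "(nat list \<Rightarrow> nat \<times> 'a) \<Rightarrow> 'a" where "inc \<omega> = clamp (snd (\<omega> []))"

lemma clamp_T [simp]: "clamp s \<in> T" by (simp add: clamp_def)
lemma clamp_id [simp]: "s \<in> T \<Longrightarrow> clamp s = s" by (simp add: clamp_def)
lemma inc_T [simp]: "inc \<omega> \<in> T" by (simp add: inc_def)
lemma inc_set_inc [simp]: "inc (set_inc s \<omega>) = clamp s" by (simp add: inc_def)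

text \<open>\<open>tree\<close> and \<open>site\<close> recompute \<open>in_tree\<close> and
  \<open>brw_pos\<close> by recursion through the subtrees of the children, the form in which
  independence is used. For positions the translation back holds only almost surely, since
  \<open>site\<close> clamps increments.\<close>

primrec tree :: "nat list \<Rightarrow> (nat list \<Rightarrow> nat \<times> 'a) \<Rightarrow> bool" where
  "tree [] \<omega> \<longleftrightarrow> True"
| "tree (i # l) \<omega> \<longleftrightarrow> i < fst (\<omega> []) \<and> tree l (child i \<omega>)"

primrec site :: "nat list \<Rightarrow> (nat list \<Rightarrow> nat \<times> 'a) \<Rightarrow> 'a" where
  "site [] \<omega> = \<one>"
| "site (i # l) \<omega> = inc (child i \<omega>) \<otimes> site l (child i \<omega>)"

lemma site_C [simp]: "site l \<omega> \<in> C" by (induction l arbitrary: \<omega>) auto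
lemma tree_set_inc [simp]: "tree l (set_inc s \<omega>) = tree l \<omega>" by (cases l) auto
lemma site_set_inc [simp]: "site l (set_inc s \<omega>) = site l \<omega>" by (cases l) auto

text \<open>Every element is a word in the finite set \<open>S\<close>. Countability allows a random
  position to be inserted into a family of measurable functions, and null sets to be united over all
  positions.\<close>

lemma countable_C: "countable C"
proof -
  have "\<exists>l\<in>lists S. x = foldr (\<otimes>) l \<one>" if "x \<in> generate G S" for x
    using that
  proof (induction x rule: generate.induct)
    case one then show ?case by (intro bexI[of _ "[]"]) auto
  next
    case (incl h) then show ?case using S_carrier by (intro bexI[of _ "[h]"]) auto
  next
    case (inv h) then show ?case using S_carrier S_inv by (intro bexI[of _ "[inv h]"]) auto
  next
    case (eng h1 h2)
    then obtain l1 l2 where l: "l1 \<in> lists S" "h1 = foldr (\<otimes>) l1 \<one>" "l2 \<in> lists S" "h2 = foldr (\<otimes>) l2 \<one>"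
      by blast
    have cl: "set l \<subseteq> S \<Longrightarrow> foldr (\<otimes>) l \<one> \<in> C" for l
      using S_carrier by (induction l) auto
    have "set l2 \<subseteq> S" using l(3) by auto
    then have l2C: "foldr (\<otimes>) l2 \<one> \<in> C" by (rule cl)
    have "set l1 \<subseteq> S \<Longrightarrow> foldr (\<otimes>) (l1 @ l2) \<one> = foldr (\<otimes>) l1 \<one> \<otimes> foldr (\<otimes>) l2 \<one>"
    proof (induction l1)
      case Nil then show ?case using l2C by simp
    next
      case (Cons a l1)
      then show ?case using l2C cl[of l1] S_carrier by (auto simp: m_assoc)
    qed
    moreover have "set l1 \<subseteq> S" using l(1) by auto
    ultimately show ?case using l by (intro bexI[of _ "l1 @ l2"]) auto
  qed
  then have "C \<subseteq> (\<lambda>l. foldr (\<otimes>) l \<one>) ` lists S" using S_gen by auto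
  moreover have "countable (lists S)" using finS by (intro countable_lists countable_finite)
  ultimately show ?thesis by (meson countable_image countable_subset)
qed

lemma measurable_inc [measurable (raw)]:
  assumes "f \<in> measurable M N" shows "(\<lambda>x. inc (f x)) \<in> measurable M (count_space T)"
proof -
  have "(\<lambda>c. clamp (snd c)) \<in> measurable (count_space UNIV) (count_space T)" by auto
  from measurable_compose[OF measurable_brw_coord'[OF assms] this] show ?thesis
    by (simp add: inc_def)
qed

lemma measurable_offspring [measurable (raw)]:
  assumes "f \<in> measurable M N" shows "(\<lambda>x. fst (f x u)) \<in> measurable M (count_space UNIV)"
  by (rule measurable_compose[OF measurable_brw_coord'[OF assms]]) auto

lemma measurable_tree [measurable (raw)]:
  "f \<in> measurable M N \<Longrightarrow> Measurable.pred M (\<lambda>x. tree l (f x))"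
  by (induction l arbitrary: f) auto

lemma measurable_site [measurable (raw)]:
  "f \<in> measurable M N \<Longrightarrow> (\<lambda>x. site l (f x)) \<in> measurable M (count_space C)"
proof (induction l arbitrary: f)
  case (Cons i l)
  have "(\<lambda>x. s \<otimes> site l (child i (f x))) \<in> measurable M (count_space C)" if "s \<in> T" for s
    using that by (intro measurable_compose[OF Cons.IH]) (auto intro: measurable_child Cons.prems)
  from measurable_compose_countable'[OF this measurable_inc[OF measurable_child[OF Cons.prems]]]
  show ?case by (simp add: countable_finite)
qed simp

lemma measurable_fun_site [measurable (raw)]:
  "f \<in> measurable M N \<Longrightarrow> (\<lambda>x. \<psi> (site l (f x))) \<in> borel_measurable M" for \<psi> :: "'a \<Rightarrow> ennreal"
  by (rule measurable_compose[OF measurable_site]) auto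

lemma measurable_fun_inc:
  assumes "f \<in> measurable M N" "\<And>s. s \<in> T \<Longrightarrow> g s \<in> measurable M L"
  shows "(\<lambda>x. g (inc (f x)) x) \<in> measurable M L"
  by (rule measurable_compose_countable'[OF _ measurable_inc[OF assms(1)]])
     (auto intro: assms countable_finite)

lemma measurable_fun_step_root:
  assumes "\<And>s. s \<in> T \<Longrightarrow> g s \<in> measurable N L"
  shows "(\<lambda>\<eta>. g (inc \<eta>) \<eta>) \<in> measurable N L"
  by (rule measurable_fun_inc[where f = "\<lambda>\<eta>. \<eta>", OF _ assms]) simp_all

sublocale N: prob_space N by (rule prob_space_brw)

text \<open>The probability that child \<open>i\<close> is born.\<close>

definition tailp :: "nat \<Rightarrow> ennreal" where "tailp i = emeasure (measure_pmf \<mu>) {k. i < k}"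

lemma nn_integral_root:
  "(\<integral>\<^sup>+\<omega>. F (fst (\<omega> [])) \<partial>N) = (\<integral>\<^sup>+k. F k \<partial>measure_pmf \<mu>)" for F :: "nat \<Rightarrow> ennreal"
proof -
  let ?p = "measure_pmf (pair_pmf \<mu> q)"
  have "distr N ?p (\<lambda>\<omega>. \<omega> []) = ?p"
    unfolding brw_space_def by (rule distr_PiM_component) (auto intro: prob_space_measure_pmf)
  then have "(\<integral>\<^sup>+k. F (fst k) \<partial>?p) = (\<integral>\<^sup>+k. F (fst k) \<partial>distr N ?p (\<lambda>\<omega>. \<omega> []))" by simp
  also have "\<dots> = (\<integral>\<^sup>+\<omega>. F (fst (\<omega> [])) \<partial>N)"
    by (rule nn_integral_distr) auto
  finally have "(\<integral>\<^sup>+\<omega>. F (fst (\<omega> [])) \<partial>N) = (\<integral>\<^sup>+k. F (fst k) \<partial>?p)" by simp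
  also have "\<dots> = (\<integral>\<^sup>+k. F k \<partial>map_pmf fst (pair_pmf \<mu> q))" by simp
  finally show ?thesis by (simp add: map_fst_pair_pmf)
qed

lemma sum_tailp: "(\<Sum>i. tailp i) = ennreal m"
proof -
  have "(\<Sum>i. tailp i) = (\<Sum>i. \<integral>\<^sup>+k. indicator {k. i < k} k \<partial>measure_pmf \<mu>)"
    by (simp add: tailp_def)
  also have "\<dots> = (\<integral>\<^sup>+k. (\<Sum>i. indicator {k. i < k} k) \<partial>measure_pmf \<mu>)"
    by (rule nn_integral_suminf[symmetric]) simp
  also have "(\<lambda>k. \<Sum>i. indicator {k. i < k} k :: ennreal) = (\<lambda>k. ennreal (real k))"
  proof
    fix k
    have "(\<Sum>i. indicator {k. i < k} k :: ennreal) = (\<Sum>i<k. 1)"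
      unfolding sum_less_suminf by (intro arg_cong[where f = suminf] ext) (auto simp: indicator_def)
    then show "(\<Sum>i. indicator {k. i < k} k :: ennreal) = ennreal (real k)"
      by (simp add: ennreal_of_nat_eq_real_of_nat)
  qed
  finally show ?thesis using mean by (simp add: offspring_mean_def)
qed

text \<open>By \<open>up\<close>, \<open>g s\<close> ignores the root increment and is therefore
  independent of it.\<close>

lemma nn_integral_inc:
  assumes g: "\<And>s. s \<in> T \<Longrightarrow> g s \<in> borel_measurable N"
    and up: "\<And>s t \<eta>. g s (set_inc t \<eta>) = g s \<eta>"
  shows "(\<integral>\<^sup>+\<eta>. g (inc \<eta>) \<eta> \<partial>N) = (\<Sum>s\<in>T. ennreal (pmf q s) * (\<integral>\<^sup>+\<eta>. g s \<eta> \<partial>N))"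
proof -
  have "(\<integral>\<^sup>+\<eta>. g (inc \<eta>) \<eta> \<partial>N) = (\<integral>\<^sup>+\<eta>. \<integral>\<^sup>+s. g (inc (set_inc s \<eta>)) (set_inc s \<eta>) \<partial>measure_pmf q \<partial>N)"
    by (rule nn_integral_set_inc[OF measurable_fun_step_root[OF g]]) simp_all
  also have "\<dots> = (\<integral>\<^sup>+\<eta>. (\<Sum>s\<in>T. ennreal (pmf q s) * g s \<eta>) \<partial>N)"
    by (simp add: nn_integral_q up)
  also have "\<dots> = (\<Sum>s\<in>T. ennreal (pmf q s) * (\<integral>\<^sup>+\<eta>. g s \<eta> \<partial>N))"
    using g by (subst nn_integral_sum) (auto simp: nn_integral_cmult)
  finally show ?thesis .
qed

lemma nn_integral_child:
  assumes g: "\<And>s. s \<in> T \<Longrightarrow> g s \<in> borel_measurable N"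
    and up: "\<And>s t \<eta>. g s (set_inc t \<eta>) = g s \<eta>"
  shows "(\<integral>\<^sup>+\<omega>. indicator {\<omega>. i < fst (\<omega> [])} \<omega> * g (inc (child i \<omega>)) (child i \<omega>) \<partial>N)
    = tailp i * (\<Sum>s\<in>T. ennreal (pmf q s) * (\<integral>\<^sup>+\<eta>. g s \<eta> \<partial>N))"
proof -
  have gm [measurable]: "(\<lambda>\<eta>. g (inc \<eta>) \<eta>) \<in> borel_measurable N"
    by (rule measurable_fun_step_root[OF g])
  have gi [measurable]: "(\<lambda>\<omega>. g (inc (child i \<omega>)) (child i \<omega>)) \<in> borel_measurable N"
    using measurable_compose[OF measurable_child[OF measurable_ident_sets[OF refl]] gm] by simp
  have "(\<integral>\<^sup>+\<omega>. indicator {\<omega>. i < fst (\<omega> [])} \<omega> * g (inc (child i \<omega>)) (child i \<omega>) \<partial>N)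
     = (\<integral>\<^sup>+\<omega>. \<integral>\<^sup>+\<eta>. indicator {\<omega>. i < fst (\<omega> [])} \<omega> * g (inc \<eta>) \<eta> \<partial>N \<partial>N)"
    by (subst nn_integral_plug[where i = i]) (auto simp: indicator_def)
  also have "\<dots> = (\<integral>\<^sup>+\<omega>. indicator {\<omega>. i < fst (\<omega> [])} \<omega> \<partial>N) * (\<integral>\<^sup>+\<eta>. g (inc \<eta>) \<eta> \<partial>N)"
    by (subst nn_integral_cmult) (auto simp: nn_integral_multc)
  also have "(\<integral>\<^sup>+\<omega>. indicator {\<omega>. i < fst (\<omega> [])} \<omega> \<partial>N) = (\<integral>\<^sup>+\<omega>. indicator {k. i < k} (fst (\<omega> [])) \<partial>N)"
    by (intro nn_integral_cong) (auto simp: indicator_def)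
  also have "\<dots> = tailp i"
    by (subst nn_integral_root) (simp add: tailp_def)
  also have "(\<integral>\<^sup>+\<eta>. g (inc \<eta>) \<eta> \<partial>N) = (\<Sum>s\<in>T. ennreal (pmf q s) * (\<integral>\<^sup>+\<eta>. g s \<eta> \<partial>N))"
    using g up by (rule nn_integral_inc)
  finally show ?thesis .
qed

text \<open>One-generation many-to-one formula: the birth of child \<open>i\<close> is decided at
  the root, independently of the subtree of that child, and the birth probabilities sum to
  \<open>m\<close>.\<close>

lemma nn_integral_children:
  assumes g: "\<And>s. s \<in> T \<Longrightarrow> g s \<in> borel_measurable N"
    and up: "\<And>s t \<eta>. g s (set_inc t \<eta>) = g s \<eta>"
  shows "(\<integral>\<^sup>+\<omega>. (\<Sum>i<fst (\<omega> []). g (inc (child i \<omega>)) (child i \<omega>)) \<partial>N)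
    = ennreal m * (\<Sum>s\<in>T. ennreal (pmf q s) * (\<integral>\<^sup>+\<eta>. g s \<eta> \<partial>N))"
proof -
  have gm [measurable]: "(\<lambda>\<eta>. g (inc \<eta>) \<eta>) \<in> borel_measurable N"
    by (rule measurable_fun_step_root[OF g])
  have gi [measurable]: "(\<lambda>\<omega>. g (inc (child i \<omega>)) (child i \<omega>)) \<in> borel_measurable N" for i
    using measurable_compose[OF measurable_child[OF measurable_ident_sets[OF refl]] gm] by simp
  have "(\<Sum>i<fst (\<omega> []). g (inc (child i \<omega>)) (child i \<omega>))
     = (\<Sum>i. indicator {\<omega>. i < fst (\<omega> [])} \<omega> * g (inc (child i \<omega>)) (child i \<omega>))" for \<omega>
    unfolding sum_less_suminf by (intro arg_cong[where f = suminf] ext) (auto simp: indicator_def)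
  then have "(\<integral>\<^sup>+\<omega>. (\<Sum>i<fst (\<omega> []). g (inc (child i \<omega>)) (child i \<omega>)) \<partial>N)
     = (\<Sum>i. \<integral>\<^sup>+\<omega>. indicator {\<omega>. i < fst (\<omega> [])} \<omega> * g (inc (child i \<omega>)) (child i \<omega>) \<partial>N)"
    by (simp add: nn_integral_suminf)
  also have "\<dots> = (\<Sum>i. tailp i * (\<Sum>s\<in>T. ennreal (pmf q s) * (\<integral>\<^sup>+\<eta>. g s \<eta> \<partial>N)))"
    using nn_integral_child[of g, OF g up] by (intro arg_cong[where f = suminf] ext)
  also have "\<dots> = ennreal m * (\<Sum>s\<in>T. ennreal (pmf q s) * (\<integral>\<^sup>+\<eta>. g s \<eta> \<partial>N))"
    by (simp add: sum_tailp)
  finally show ?thesis .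
qed

lemma nn_integral_two_children:
  assumes g: "\<And>s. s \<in> T \<Longrightarrow> g s \<in> borel_measurable N"
    and up: "\<And>s t \<eta>. g s (set_inc t \<eta>) = g s \<eta>"
  shows "(\<integral>\<^sup>+\<omega>. indicator {\<omega>. 1 < fst (\<omega> [])} \<omega> * (g (inc (child 0 \<omega>)) (child 0 \<omega>) * g (inc (child 1 \<omega>)) (child 1 \<omega>)) \<partial>N)
    = tailp 1 * (\<Sum>s\<in>T. ennreal (pmf q s) * (\<integral>\<^sup>+\<eta>. g s \<eta> \<partial>N))\<^sup>2"
proof -
  have gm [measurable]: "(\<lambda>\<eta>. g (inc \<eta>) \<eta>) \<in> borel_measurable N"
    by (rule measurable_fun_step_root[OF g])
  have gi [measurable]: "(\<lambda>\<omega>. g (inc (child i \<omega>)) (child i \<omega>)) \<in> borel_measurable N" for i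
    using measurable_compose[OF measurable_child[OF measurable_ident_sets[OF refl]] gm] by simp
  have "(\<integral>\<^sup>+\<omega>. indicator {\<omega>. 1 < fst (\<omega> [])} \<omega> * (g (inc (child 0 \<omega>)) (child 0 \<omega>) * g (inc (child 1 \<omega>)) (child 1 \<omega>)) \<partial>N)
     = (\<integral>\<^sup>+\<omega>. \<integral>\<^sup>+\<eta>. (indicator {\<omega>. 1 < fst (\<omega> [])} \<omega> * g (inc (child 1 \<omega>)) (child 1 \<omega>)) * g (inc \<eta>) \<eta> \<partial>N \<partial>N)"
    by (subst nn_integral_plug[where i = 0]) (auto simp: indicator_def mult_ac)
  also have "\<dots> = (\<integral>\<^sup>+\<omega>. indicator {\<omega>. 1 < fst (\<omega> [])} \<omega> * g (inc (child 1 \<omega>)) (child 1 \<omega>) \<partial>N) * (\<integral>\<^sup>+\<eta>. g (inc \<eta>) \<eta> \<partial>N)"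
    by (subst nn_integral_cmult) (auto simp: nn_integral_multc)
  also have "(\<integral>\<^sup>+\<omega>. indicator {\<omega>. 1 < fst (\<omega> [])} \<omega> * g (inc (child 1 \<omega>)) (child 1 \<omega>) \<partial>N)
      = tailp 1 * (\<Sum>s\<in>T. ennreal (pmf q s) * (\<integral>\<^sup>+\<eta>. g s \<eta> \<partial>N))"
    using g up by (rule nn_integral_child)
  also have "(\<integral>\<^sup>+\<eta>. g (inc \<eta>) \<eta> \<partial>N) = (\<Sum>s\<in>T. ennreal (pmf q s) * (\<integral>\<^sup>+\<eta>. g s \<eta> \<partial>N))"
    using g up by (rule nn_integral_inc)
  finally show ?thesis by (simp only: power2_eq_square mult.assoc)
qed

definition visits :: "nat list \<Rightarrow> ('a \<Rightarrow> ennreal) \<Rightarrow> ennreal" where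
  "visits l g = (\<integral>\<^sup>+\<omega>. indicator {\<omega>. tree l \<omega>} \<omega> * g (site l \<omega>) \<partial>N)"

lemma visits_Nil: "visits [] g = g \<one>"
  by (simp add: visits_def N.emeasure_space_1[simplified])

lemma visits_Cons: "visits (i # l) g = tailp i * (\<Sum>s\<in>T. ennreal (pmf q s) * visits l (\<lambda>y. g (s \<otimes> y)))"
proof -
  have "visits (i # l) g = (\<integral>\<^sup>+\<omega>. indicator {\<omega>. i < fst (\<omega> [])} \<omega> *
      (\<lambda>s \<eta>. indicator {\<eta>. tree l \<eta>} \<eta> * g (s \<otimes> site l \<eta>)) (inc (child i \<omega>)) (child i \<omega>) \<partial>N)"
    unfolding visits_def by (intro nn_integral_cong) (auto simp: indicator_def)
  also have "\<dots> = tailp i * (\<Sum>s\<in>T. ennreal (pmf q s) * (\<integral>\<^sup>+\<eta>. indicator {\<eta>. tree l \<eta>} \<eta> * g (s \<otimes> site l \<eta>) \<partial>N))"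
    by (rule nn_integral_child) (auto simp: indicator_def)
  finally show ?thesis by (simp add: visits_def)
qed

text \<open>Whether \<open>l\<close> has a child \<open>i\<close> is decided by the offspring number
  at \<open>l\<close>, on which neither the presence nor the position of \<open>l\<close>
  depends.\<close>

lemma visits_edge: "(\<integral>\<^sup>+\<omega>. indicator {\<omega>. tree (l @ [i]) \<omega>} \<omega> * g (site l \<omega>) \<partial>N) = tailp i * visits l g"
proof (induction l arbitrary: g)
  case Nil
  have "(\<integral>\<^sup>+\<omega>. indicator {\<omega>. i < fst (\<omega> [])} \<omega> * (\<lambda>s \<eta>. g \<one>) (inc (child i \<omega>)) (child i \<omega>) \<partial>N)
    = tailp i * (\<Sum>s\<in>T. ennreal (pmf q s) * (\<integral>\<^sup>+\<eta>. g \<one> \<partial>N))"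
    by (rule nn_integral_child) auto
  then show ?case
    by (simp add: visits_Nil N.emeasure_space_1[simplified] sum_T_one flip: sum_distrib_right)
next
  case (Cons j l)
  have "(\<integral>\<^sup>+\<omega>. indicator {\<omega>. tree ((j # l) @ [i]) \<omega>} \<omega> * g (site (j # l) \<omega>) \<partial>N)
      = (\<integral>\<^sup>+\<omega>. indicator {\<omega>. j < fst (\<omega> [])} \<omega> *
      (\<lambda>s \<eta>. indicator {\<eta>. tree (l @ [i]) \<eta>} \<eta> * g (s \<otimes> site l \<eta>)) (inc (child j \<omega>)) (child j \<omega>) \<partial>N)"
    by (intro nn_integral_cong) (auto simp: indicator_def)
  also have "\<dots> = tailp j * (\<Sum>s\<in>T. ennreal (pmf q s) * (\<integral>\<^sup>+\<eta>. indicator {\<eta>. tree (l @ [i]) \<eta>} \<eta> * g (s \<otimes> site l \<eta>) \<partial>N))"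
    by (rule nn_integral_child) (auto simp: indicator_def)
  also have "\<dots> = tailp i * visits (j # l) g"
    by (simp add: Cons.IH[of "\<lambda>y. g (_ \<otimes> y)"] visits_Cons sum_distrib_left mult_ac)
  finally show ?case .
qed

lemma visits_length:
  "(\<integral>\<^sup>+l. visits l g \<partial>count_space {l. length l = n}) = ennreal m ^ n * (avg ^^ n) g \<one>"
proof (induction n arbitrary: g)
  case 0
  have "{l :: nat list. length l = 0} = {[]}" by auto
  then show ?case by (simp add: nn_integral_count_space_finite visits_Nil)
next
  case (Suc n)
  have "(\<integral>\<^sup>+l. visits l g \<partial>count_space {l. length l = Suc n})
     = (\<Sum>i. \<integral>\<^sup>+l. tailp i * (\<Sum>s\<in>T. ennreal (pmf q s) * visits l (\<lambda>y. g (s \<otimes> y))) \<partial>count_space {l. length l = n})"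
    by (simp add: nn_integral_lists_length_Suc visits_Cons)
  also have "\<dots> = (\<Sum>i. tailp i * (\<Sum>s\<in>T. ennreal (pmf q s) * (\<integral>\<^sup>+l. visits l (\<lambda>y. g (s \<otimes> y)) \<partial>count_space {l. length l = n})))"
    by (simp add: nn_integral_cmult nn_integral_sum)
  also have "\<dots> = ennreal m * (\<Sum>s\<in>T. ennreal (pmf q s) * (ennreal m ^ n * (avg ^^ n) (\<lambda>y. g (s \<otimes> y)) \<one>))"
    by (simp add: Suc sum_tailp)
  also have "\<dots> = ennreal m ^ Suc n * (\<Sum>s\<in>T. ennreal (pmf q s) * (avg ^^ n) g s)"
    by (simp add: stpn_translate sum_distrib_left mult_ac)
  also have "(\<Sum>s\<in>T. ennreal (pmf q s) * (avg ^^ n) g s) = (avg ^^ Suc n) g \<one>"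
    by (simp add: avg_def)
  finally show ?case .
qed

text \<open>
  Every vertex is counted once for each edge at it, and the root once more, for the edge that will
  join it to a second tree.
\<close>

definition edges :: "(nat list \<Rightarrow> nat \<times> 'a) \<Rightarrow> ('a \<Rightarrow> ennreal) \<Rightarrow> ennreal" where
  "edges \<omega> g = g \<one> + (\<integral>\<^sup>+l. indicator {\<omega>. tree l \<omega>} \<omega> * (g (site (butlast l) \<omega>) + g (site l \<omega>)) \<partial>count_space {l. l \<noteq> []})"

lemma edges_set_inc [simp]: "edges (set_inc s \<omega>) g = edges \<omega> g"
  by (simp add: edges_def indicator_def)

text \<open>The edge to child \<open>i\<close> contributes its parent end as \<open>g\<close> at the
  identity; its child end is the extra root term in \<open>edges\<close> of that child. So the extra
  term is consistent under recursion.\<close>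

lemma edges_rec: "edges \<omega> g = g \<one> + (\<Sum>i<fst (\<omega> []). g \<one> + edges (child i \<omega>) (\<lambda>y. g (inc (child i \<omega>) \<otimes> y)))"
proof -
  have eq: "(\<integral>\<^sup>+l. indicator {\<omega>. tree (i # l) \<omega>} \<omega> * (g (site (butlast (i # l)) \<omega>) + g (site (i # l) \<omega>)) \<partial>count_space UNIV)
    = (if i < fst (\<omega> []) then g \<one> + edges (child i \<omega>) (\<lambda>y. g (inc (child i \<omega>) \<otimes> y)) else 0)" for i
  proof (cases "i < fst (\<omega> [])")
    case True
    then show ?thesis
      unfolding edges_def by (subst nn_integral_lists_split)
        (auto simp: indicator_def add.assoc intro!: arg_cong2[where f = "(+)"] nn_integral_cong)
  qed (simp add: indicator_def)
  show ?thesis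
    unfolding sum_less_suminf by (subst edges_def, subst nn_integral_lists_Cons) (simp only: eq)
qed

lemma measurable_edges [measurable (raw)]:
  assumes "f \<in> measurable M N" shows "(\<lambda>x. edges (f x) g) \<in> borel_measurable M"
  unfolding edges_def
proof (intro borel_measurable_add measurable_const borel_measurable_count_space_integral)
  fix l
  have "indicator {\<omega>. tree l \<omega>} (f x) = (if tree l (f x) then 1 else 0 :: ennreal)" for x by simp
  then show "(\<lambda>x. indicator {\<omega>. tree l \<omega>} (f x) * (g (site (butlast l) (f x)) + g (site l (f x)))) \<in> borel_measurable M"
    using assms by simp
qed auto

text \<open>A particle is counted once for the edge above it, or by the extra root term, and on
  average \<open>m\<close> times for the edges to its children.\<close>

lemma edges_expect: "(\<integral>\<^sup>+\<omega>. edges \<omega> g \<partial>N) = ennreal (1 + m) * (\<Sum>n. ennreal m ^ n * (avg ^^ n) g \<one>)"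
proof -
  let ?a = "\<lambda>l \<omega>. indicator {\<omega>. tree l \<omega>} \<omega> * g (site (butlast l) \<omega>)"
  let ?b = "\<lambda>l \<omega>. indicator {\<omega>. tree l \<omega>} \<omega> * g (site l \<omega>)"
  have all: "(\<integral>\<^sup>+l. visits l g \<partial>count_space UNIV) = (\<Sum>n. ennreal m ^ n * (avg ^^ n) g \<one>)"
    by (simp add: nn_integral_lists_length visits_length)
  have "(\<integral>\<^sup>+\<omega>. edges \<omega> g \<partial>N) = (\<integral>\<^sup>+\<omega>. g \<one> + (\<integral>\<^sup>+l. ?a l \<omega> + ?b l \<omega> \<partial>count_space {l. l \<noteq> []}) \<partial>N)"
    unfolding edges_def distrib_left ..
  also have "\<dots> = g \<one> + (\<integral>\<^sup>+\<omega>. (\<integral>\<^sup>+l. ?a l \<omega> + ?b l \<omega> \<partial>count_space {l. l \<noteq> []}) \<partial>N)"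
    by (subst nn_integral_add) (auto intro!: borel_measurable_count_space_integral simp: N.emeasure_space_1[simplified])
  also have "(\<integral>\<^sup>+\<omega>. (\<integral>\<^sup>+l. ?a l \<omega> + ?b l \<omega> \<partial>count_space {l. l \<noteq> []}) \<partial>N)
     = (\<integral>\<^sup>+l. (\<integral>\<^sup>+\<omega>. ?a l \<omega> + ?b l \<omega> \<partial>N) \<partial>count_space {l. l \<noteq> []})"
    by (rule nn_integral_count_space_nn_integral) auto
  also have "\<dots> = (\<integral>\<^sup>+l. (\<integral>\<^sup>+\<omega>. ?a l \<omega> \<partial>N) + visits l g \<partial>count_space {l. l \<noteq> []})"
    by (simp add: nn_integral_add visits_def)
  also have "\<dots> = (\<integral>\<^sup>+l. (\<integral>\<^sup>+\<omega>. ?a l \<omega> \<partial>N) \<partial>count_space {l. l \<noteq> []}) + (\<integral>\<^sup>+l. visits l g \<partial>count_space {l. l \<noteq> []})"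
    by (rule nn_integral_add) auto
  also have "(\<integral>\<^sup>+l. (\<integral>\<^sup>+\<omega>. ?a l \<omega> \<partial>N) \<partial>count_space {l. l \<noteq> []}) = (\<integral>\<^sup>+l. (\<Sum>i. tailp i * visits l g) \<partial>count_space UNIV)"
    by (subst nn_integral_lists_snoc) (simp add: visits_edge)
  also have "\<dots> = ennreal m * (\<integral>\<^sup>+l. visits l g \<partial>count_space UNIV)"
    by (simp add: sum_tailp nn_integral_cmult)
  also have "g \<one> + (ennreal m * (\<integral>\<^sup>+l. visits l g \<partial>count_space UNIV) + (\<integral>\<^sup>+l. visits l g \<partial>count_space {l. l \<noteq> []}))
     = ennreal m * (\<integral>\<^sup>+l. visits l g \<partial>count_space UNIV) + (\<integral>\<^sup>+l. visits l g \<partial>count_space UNIV)"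
    by (subst (3) nn_integral_lists_split) (simp add: visits_Nil add_ac)
  also have "\<dots> = ennreal (1 + m) * (\<integral>\<^sup>+l. visits l g \<partial>count_space UNIV)"
    using m_gt by (simp add: distrib_right add.commute)
  finally show ?thesis unfolding all .
qed

end

section \<open>Returns of a branching random walk to a set\<close>

lemma nat_sum_pos_iff: "0 < (\<Sum>i<k. f i) \<longleftrightarrow> (\<exists>i<k. 0 < f i)" for f :: "nat \<Rightarrow> nat"
  by (induction k) (auto simp: less_Suc_eq)

lemma measurable_sum_upto:
  fixes h :: "nat \<Rightarrow> 'x \<Rightarrow> nat"
  assumes K: "K \<in> measurable M (count_space UNIV)" and h: "\<And>i. h i \<in> measurable M (count_space UNIV)"
  shows "(\<lambda>w. \<Sum>i<K w. h i w) \<in> measurable M (count_space UNIV)"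
proof (rule measurable_compose_countable[OF _ K])
  have add: "(\<lambda>w. f w + g w) \<in> measurable M (count_space UNIV)"
    if f: "f \<in> measurable M (count_space UNIV)" and g: "g \<in> measurable M (count_space UNIV)" for f g :: "'x \<Rightarrow> nat"
  proof (rule measurable_compose_countable[OF _ f])
    show "(\<lambda>w. i + g w) \<in> measurable M (count_space UNIV)" for i
      by (rule measurable_compose[OF g]) auto
  qed
  show "(\<lambda>w. \<Sum>i<k. h i w) \<in> measurable M (count_space UNIV)" for k
    by (induction k) (auto intro!: add h)
qed

context brw begin

text \<open>
  The number of labels of length at most \<open>t\<close> whose line of descent, started at \<open>x\<close>, is in \<open>A\<close> for the
  \<open>n\<close>-th time at its last label. The start is not counted as a visit.
\<close>

primrec returns :: "nat \<Rightarrow> ('a \<Rightarrow> bool) \<Rightarrow> nat \<Rightarrow> 'a \<Rightarrow> (nat list \<Rightarrow> nat \<times> 'a) \<Rightarrow> nat" where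
  "returns 0 A n x \<omega> = (if n = 0 then 1 else 0)"
| "returns (Suc t) A n x \<omega> = (if n = 0 then 1 else
     \<Sum>i<fst (\<omega> []). returns t A (if A (x \<otimes> inc (child i \<omega>)) then n - 1 else n)
       (x \<otimes> inc (child i \<omega>)) (child i \<omega>))"

lemma returns_set_inc [simp]: "returns t A n x (set_inc s \<omega>) = returns t A n x \<omega>"
  by (cases t) auto

lemma returns_mono_t: "returns t A n x \<omega> \<le> returns (Suc t) A n x \<omega>"
proof (induction t arbitrary: n x \<omega>)
  case (Suc t)
  show ?case by (subst (1 2) returns.simps(2)) (auto intro!: sum_mono Suc simp del: returns.simps)
qed simp

lemma returns_depth: "0 < returns t A (Suc n) x \<omega> \<Longrightarrow> 0 < returns t A n x \<omega>"
proof (induction t arbitrary: n x \<omega>)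
  case (Suc t)
  show ?case
  proof (cases n)
    case (Suc k)
    from Suc.prems obtain i where i: "i < fst (\<omega> [])"
      "0 < returns t A (if A (x \<otimes> inc (child i \<omega>)) then n else Suc n) (x \<otimes> inc (child i \<omega>)) (child i \<omega>)"
      by (auto simp: nat_sum_pos_iff cong: if_cong)
    then have "0 < returns t A (if A (x \<otimes> inc (child i \<omega>)) then n - 1 else n) (x \<otimes> inc (child i \<omega>)) (child i \<omega>)"
      using Suc.IH Suc by (auto split: if_splits)
    then show ?thesis using i Suc by (auto simp: nat_sum_pos_iff)
  qed simp
qed simp

lemma measurable_returns:
  assumes a: "\<And>y. y \<in> C \<Longrightarrow> Measurable.pred M (\<lambda>w. a w y)"
  shows "f \<in> measurable M N \<Longrightarrow> x \<in> C \<Longrightarrow> (\<lambda>w. returns t (a w) n x (f w)) \<in> measurable M (count_space UNIV)"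
proof (induction t arbitrary: n x f)
  case (Suc t)
  have 1: "(\<lambda>w. returns t (a w) (if a w (x \<otimes> s) then n - 1 else n) (x \<otimes> s) (child i (f w))) \<in> measurable M (count_space UNIV)"
    if "s \<in> T" for s i
  proof -
    have "(\<lambda>w. if a w (x \<otimes> s) then returns t (a w) (n - 1) (x \<otimes> s) (child i (f w)) else returns t (a w) n (x \<otimes> s) (child i (f w)))
        \<in> measurable M (count_space UNIV)"
      using that Suc.prems a[of "x \<otimes> s"] by (intro measurable_If Suc.IH measurable_child) (auto simp: pred_def)
    then show ?thesis by (simp add: if_distrib[where f = "\<lambda>n. returns t _ n _ _"] cong: if_cong)
  qed
  have 2: "(\<lambda>w. returns t (a w) (if a w (x \<otimes> inc (child i (f w))) then n - 1 else n) (x \<otimes> inc (child i (f w))) (child i (f w)))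
      \<in> measurable M (count_space UNIV)" for i
    using measurable_fun_inc[where f = "\<lambda>w. child i (f w)" and
        g = "\<lambda>s w. returns t (a w) (if a w (x \<otimes> s) then n - 1 else n) (x \<otimes> s) (child i (f w))",
        OF measurable_child[OF Suc.prems(1)] 1] by simp
  show ?case
    by (cases "n = 0") (auto intro!: measurable_sum_upto measurable_offspring Suc.prems 2)
qed simp

lemma measurable_returns_tree:
  "x \<in> C \<Longrightarrow> (\<lambda>\<omega>. returns t A n x \<omega>) \<in> measurable N (count_space UNIV)"
  by (rule measurable_returns[where f = "\<lambda>\<omega>. \<omega>"]) auto

definition returns_mean :: "nat \<Rightarrow> ('a \<Rightarrow> bool) \<Rightarrow> nat \<Rightarrow> 'a \<Rightarrow> ennreal" where
  "returns_mean t A n x = (\<integral>\<^sup>+\<omega>. of_nat (returns t A n x \<omega>) \<partial>N)"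

definition returns_prob :: "nat \<Rightarrow> ('a \<Rightarrow> bool) \<Rightarrow> nat \<Rightarrow> 'a \<Rightarrow> ennreal" where
  "returns_prob t A n x = (\<integral>\<^sup>+\<omega>. indicator {0<..} (returns t A n x \<omega>) \<partial>N)"

lemma measurable_fun_returns:
  "x \<in> C \<Longrightarrow> (\<lambda>\<omega>. \<phi> (returns t A n x \<omega>)) \<in> borel_measurable N" for \<phi> :: "nat \<Rightarrow> ennreal"
  by (rule measurable_compose[OF measurable_returns_tree]) auto

lemmas measurable_of_nat_returns = measurable_fun_returns[where \<phi> = of_nat]
lemmas measurable_indicator_returns = measurable_fun_returns[where \<phi> = "indicator {0<..}"]

lemma returns_mean_0 [simp]: "returns_mean t A 0 x = 1"
  by (cases t) (simp_all add: returns_mean_def N.emeasure_space_1[simplified])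

lemma returns_prob_0 [simp]: "returns_prob t A 0 x = 1"
  by (cases t) (simp_all add: returns_prob_def N.emeasure_space_1[simplified])

lemma returns_prob_le_1: "returns_prob t A n x \<le> 1"
proof -
  have "returns_prob t A n x \<le> (\<integral>\<^sup>+\<omega>. 1 \<partial>N)"
    unfolding returns_prob_def by (intro nn_integral_mono) (auto simp: indicator_def)
  then show ?thesis by (simp add: N.emeasure_space_1[simplified])
qed

lemma returns_prob_mono_t: "returns_prob t A n x \<le> returns_prob (Suc t) A n x"
  unfolding returns_prob_def using returns_mono_t
  by (intro nn_integral_mono) (auto simp: indicator_def simp del: returns.simps intro: less_le_trans)

lemma returns_prob_depth: "returns_prob t A (Suc n) x \<le> returns_prob t A n x"
  unfolding returns_prob_def using returns_depth
  by (intro nn_integral_mono) (auto simp: indicator_def simp del: returns.simps)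

lemma returns_mean_mono_t: "returns_mean t A n x \<le> returns_mean (Suc t) A n x"
  unfolding returns_mean_def using returns_mono_t
  by (intro nn_integral_mono) (auto simp del: returns.simps)

lemma returns_mean_step:
  assumes x: "x \<in> C"
  shows "returns_mean (Suc t) A (Suc k) x = ennreal m * avg (\<lambda>y. if A y then returns_mean t A k y else returns_mean t A (Suc k) y) x"
proof -
  let ?g = "\<lambda>s \<eta>. of_nat (returns t A (if A (x \<otimes> s) then k else Suc k) (x \<otimes> s) \<eta>) :: ennreal"
  have "returns_mean (Suc t) A (Suc k) x = (\<integral>\<^sup>+\<omega>. (\<Sum>i<fst (\<omega> []). ?g (inc (child i \<omega>)) (child i \<omega>)) \<partial>N)"
    by (simp add: returns_mean_def cong: if_cong)
  also have "\<dots> = ennreal m * (\<Sum>s\<in>T. ennreal (pmf q s) * (\<integral>\<^sup>+\<eta>. ?g s \<eta> \<partial>N))"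
    by (rule nn_integral_children[where g = ?g], rule measurable_of_nat_returns) (use x in simp_all)
  also have "(\<Sum>s\<in>T. ennreal (pmf q s) * (\<integral>\<^sup>+\<eta>. ?g s \<eta> \<partial>N)) = avg (\<lambda>y. if A y then returns_mean t A k y else returns_mean t A (Suc k) y) x"
    unfolding avg_def by (intro sum.cong) (auto simp: returns_mean_def)
  finally show ?thesis .
qed

text \<open>The quadratic term comes from the event that the first two children both succeed, which the union
  bound counts twice.\<close>

lemma returns_prob_gain:
  assumes x: "x \<in> C"
  shows "returns_prob (Suc t) A (Suc n) x + tailp 1 * (avg (\<lambda>y. if A y then returns_prob t A n y else returns_prob t A (Suc n) y) x)\<^sup>2
    \<le> ennreal m * avg (\<lambda>y. if A y then returns_prob t A n y else returns_prob t A (Suc n) y) x"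
proof -
  let ?g = "\<lambda>s \<eta>. indicator {0<..} (returns t A (if A (x \<otimes> s) then n else Suc n) (x \<otimes> s) \<eta>) :: ennreal"
  have meas: "?g s \<in> borel_measurable N" if "s \<in> T" for s
    by (rule measurable_indicator_returns) (use that x in simp)
  have up: "?g s (set_inc t' \<eta>) = ?g s \<eta>" for s t' \<eta> by simp
  have st: "(\<Sum>s\<in>T. ennreal (pmf q s) * (\<integral>\<^sup>+\<eta>. ?g s \<eta> \<partial>N)) = avg (\<lambda>y. if A y then returns_prob t A n y else returns_prob t A (Suc n) y) x"
    unfolding avg_def by (intro sum.cong) (auto simp: returns_prob_def)
  let ?two = "\<lambda>\<omega>. indicator {\<omega>. 1 < fst (\<omega> [])} \<omega> * (?g (inc (child 0 \<omega>)) (child 0 \<omega>) * ?g (inc (child 1 \<omega>)) (child 1 \<omega>))"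
  have gm: "(\<lambda>\<omega>. ?g (inc (child i \<omega>)) (child i \<omega>)) \<in> borel_measurable N" for i
    using measurable_compose[OF measurable_child[OF measurable_ident_sets[OF refl]] measurable_fun_step_root[of ?g, OF meas]]
    by simp
  have pw: "indicator {0<..} (returns (Suc t) A (Suc n) x \<omega>) + ?two \<omega>
      \<le> (\<Sum>i<fst (\<omega> []). ?g (inc (child i \<omega>)) (child i \<omega>))" for \<omega>
  proof -
    define e where "e i = ?g (inc (child i \<omega>)) (child i \<omega>)" for i
    have "indicator B z = 0 \<or> indicator B z = (1::ennreal)" for B and z :: nat by (simp add: indicator_def)
    then have e01: "e i = 0 \<or> e i = 1" for i by (simp only: e_def)
    have returns: "0 < returns (Suc t) A (Suc n) x \<omega> \<longleftrightarrow> (\<exists>i<fst (\<omega> []). e i = 1)"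
      by (simp add: nat_sum_pos_iff e_def indicator_def cong: if_cong)
    have "indicator {0<..} (returns (Suc t) A (Suc n) x \<omega>) + indicator {\<omega>. 1 < fst (\<omega> [])} \<omega> * (e 0 * e 1) \<le> (\<Sum>i<fst (\<omega> []). e i)"
    proof (cases "1 < fst (\<omega> []) \<and> e 0 = 1 \<and> e 1 = 1")
      case True
      have "indicator {0<..} (returns (Suc t) A (Suc n) x \<omega>) + indicator {\<omega>. 1 < fst (\<omega> [])} \<omega> * (e 0 * e 1) \<le> 1 + (1::ennreal)"
        using True by (intro add_mono) (auto simp: indicator_def)
      also have "\<dots> = (\<Sum>i\<in>{0, 1}. e i)" using True by simp
      also have "\<dots> \<le> (\<Sum>i<fst (\<omega> []). e i)" using True by (intro sum_mono2) auto
      finally show ?thesis .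
    next
      case False
      then have "indicator {\<omega>. 1 < fst (\<omega> [])} \<omega> * (e 0 * e 1) = 0"
        using e01[of 0] e01[of 1] by (auto simp: indicator_def simp del: One_nat_def)
      moreover have "indicator {0<..} (returns (Suc t) A (Suc n) x \<omega>) \<le> (\<Sum>i<fst (\<omega> []). e i)"
      proof (cases "0 < returns (Suc t) A (Suc n) x \<omega>")
        case True
        then obtain i where "i < fst (\<omega> [])" "e i = 1" using returns by auto
        then have "1 \<le> (\<Sum>i<fst (\<omega> []). e i)" using member_le_sum[of i "{..<fst (\<omega> [])}" e] by auto
        then show ?thesis using True by (simp del: returns.simps)
      qed (simp del: returns.simps)
      ultimately show ?thesis by (simp only: add_0_right)
    qed
    then show ?thesis by (simp only: e_def)
  qed
  have "returns_prob (Suc t) A (Suc n) x + (\<integral>\<^sup>+\<omega>. ?two \<omega> \<partial>N)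
      = (\<integral>\<^sup>+\<omega>. indicator {0<..} (returns (Suc t) A (Suc n) x \<omega>) + ?two \<omega> \<partial>N)"
    unfolding returns_prob_def using x gm[of 0] gm[of 1]
    by (intro nn_integral_add[symmetric] measurable_indicator_returns borel_measurable_times) (simp_all del: returns.simps)
  also have "\<dots> \<le> (\<integral>\<^sup>+\<omega>. (\<Sum>i<fst (\<omega> []). ?g (inc (child i \<omega>)) (child i \<omega>)) \<partial>N)"
    by (intro nn_integral_mono pw)
  also have "\<dots> = ennreal m * (\<Sum>s\<in>T. ennreal (pmf q s) * (\<integral>\<^sup>+\<eta>. ?g s \<eta> \<partial>N))"
    by (rule nn_integral_children[where g = ?g, OF meas up])
  also have "(\<integral>\<^sup>+\<omega>. ?two \<omega> \<partial>N) = tailp 1 * (\<Sum>s\<in>T. ennreal (pmf q s) * (\<integral>\<^sup>+\<eta>. ?g s \<eta> \<partial>N))\<^sup>2"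
    by (rule nn_integral_two_children[where g = ?g, OF meas up])
  finally show ?thesis unfolding st .
qed

text \<open>Drops the quadratic gain: this is the plain union bound over the children, iterated
  until the first return.\<close>

lemma returns_prob_hit:
  assumes "\<And>t y. y \<in> C \<Longrightarrow> returns_prob t A n y \<le> \<psi> y"
  shows "x \<in> C \<Longrightarrow> returns_prob t A (Suc n) x \<le> hit (ennreal m) A \<psi> t x"
proof (induction t arbitrary: x)
  case 0 then show ?case by (simp add: returns_prob_def)
next
  case (Suc t)
  have "returns_prob (Suc t) A (Suc n) x \<le> ennreal m * avg (\<lambda>y. if A y then returns_prob t A n y else returns_prob t A (Suc n) y) x"
    using returns_prob_gain[OF Suc.prems, of t A n] add_increasing2[OF zero_le order_refl] order_trans by blast
  also have "\<dots> \<le> ennreal m * avg (\<lambda>y. if A y then \<psi> y else hit (ennreal m) A \<psi> t y) x"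
    using Suc assms by (intro mult_left_mono avg_mono) auto
  finally show ?case by simp
qed

definition survive :: "('a \<Rightarrow> bool) \<Rightarrow> nat \<Rightarrow> 'a \<Rightarrow> ennreal" where "survive A n x = (SUP t. returns_prob t A n x)"
text \<open>The constant \<open>c\<close> of the overview: there are at least two children, and the
  first two both stay put.\<close>

definition gain :: ennreal where "gain = tailp 1 * (ennreal (pmf q \<one>))\<^sup>2"

lemma survive_0 [simp]: "survive A 0 x = 1" by (simp add: survive_def)
lemma survive_le_1: "survive A n x \<le> 1" unfolding survive_def by (intro SUP_least returns_prob_le_1)
lemma survive_depth: "survive A (Suc n) x \<le> survive A n x" unfolding survive_def by (intro SUP_mono') (rule returns_prob_depth)

lemma survive_gain:
  assumes x: "x \<in> C" and A: "A x"
  shows "survive A (Suc n) x + gain * (survive A n x)\<^sup>2 \<le> (SUP t. hit (ennreal m) A (survive A n) t x)"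
proof -
  have le: "returns_prob t A n y \<le> survive A n y" for t y unfolding survive_def by (rule SUP_upper) simp
  have "returns_prob (Suc t) A (Suc n) x + gain * (returns_prob t A n x)\<^sup>2 \<le> (SUP t. hit (ennreal m) A (survive A n) t x)" for t
  proof -
    let ?h = "\<lambda>y. if A y then returns_prob t A n y else returns_prob t A (Suc n) y"
    \<comment> \<open>The summand of the trivial step: as \<open>x\<close> lies in \<open>A\<close>,
      staying put is already a return.\<close>
    have "ennreal (pmf q \<one>) * returns_prob t A n x \<le> avg ?h x"
      using x A member_le_sum[of "\<one>" T "\<lambda>s. ennreal (pmf q s) * ?h (x \<otimes> s)"] by (simp add: avg_def)
    then have "gain * (returns_prob t A n x)\<^sup>2 \<le> tailp 1 * (avg ?h x)\<^sup>2"
      unfolding gain_def mult.assoc power_mult_distrib[symmetric] by (intro mult_left_mono power_mono) auto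
    then have "returns_prob (Suc t) A (Suc n) x + gain * (returns_prob t A n x)\<^sup>2 \<le> ennreal m * avg ?h x"
      by (intro order_trans[OF add_left_mono returns_prob_gain[OF x]])
    also have "\<dots> \<le> hit (ennreal m) A (survive A n) (Suc t) x"
      using x le by (auto intro!: mult_left_mono avg_mono returns_prob_hit)
    also have "\<dots> \<le> (SUP t. hit (ennreal m) A (survive A n) t x)" by (rule SUP_upper) simp
    finally show ?thesis .
  qed
  moreover have "(\<lambda>t. returns_prob (Suc t) A (Suc n) x + gain * (returns_prob t A n x)\<^sup>2) \<longlonglongrightarrow> survive A (Suc n) x + gain * (survive A n x)\<^sup>2"
  proof -
    have lim: "(\<lambda>t. returns_prob t A k x) \<longlonglongrightarrow> survive A k x" for k
      unfolding survive_def by (rule LIMSEQ_SUP) (simp add: incseq_Suc_iff returns_prob_mono_t)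
    have "gain \<le> 1" unfolding gain_def tailp_def
      by (intro mult_le_one power_le_one) (auto simp: pmf_le_1 measure_pmf.emeasure_eq_measure)
    then have "gain \<noteq> \<infinity>" "survive A n x \<noteq> \<infinity>" using survive_le_1[of A n x] by (auto simp: top_unique)
    then show ?thesis
      unfolding power2_eq_square
      by (intro tendsto_add tendsto_mult_ennreal tendsto_const lim LIMSEQ_Suc[OF lim])
         (auto simp: ennreal_mult_eq_top_iff)
  qed
  ultimately show ?thesis by (rule_tac LIMSEQ_le_const2) auto
qed

lemma survive_eq_emeasure:
  assumes x: "x \<in> C" shows "survive A n x = emeasure N {\<omega>. \<exists>t. 0 < returns t A n x \<omega>}"
proof -
  have m: "{\<omega>. 0 < returns t A n x \<omega>} \<in> sets N" for t
    using measurable_sets[OF measurable_returns_tree[OF x], of "{0<..}"] by (simp add: vimage_def)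
  have "returns_prob t A n x = (\<integral>\<^sup>+\<omega>. indicator {\<omega>. 0 < returns t A n x \<omega>} \<omega> \<partial>N)" for t
    unfolding returns_prob_def by (intro nn_integral_cong) (simp add: indicator_def)
  then have "survive A n x = (SUP t. emeasure N {\<omega>. 0 < returns t A n x \<omega>})"
    using m by (simp add: survive_def)
  also have "\<dots> = emeasure N (\<Union>t. {\<omega>. 0 < returns t A n x \<omega>})"
    using m returns_mono_t[THEN less_le_trans[rotated]]
    by (intro SUP_emeasure_incseq) (auto simp: incseq_Suc_iff simp del: returns.simps)
  also have "(\<Union>t. {\<omega>. 0 < returns t A n x \<omega>}) = {\<omega>. \<exists>t. 0 < returns t A n x \<omega>}" by auto
  finally show ?thesis .
qed

section \<open>From extinction of the return process to finitely many visits\<close>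

primrec return_labels :: "nat \<Rightarrow> ('a \<Rightarrow> bool) \<Rightarrow> nat \<Rightarrow> 'a \<Rightarrow> (nat list \<Rightarrow> nat \<times> 'a) \<Rightarrow> nat list set" where
  "return_labels 0 A n x \<omega> = (if n = 0 then {[]} else {})"
| "return_labels (Suc t) A n x \<omega> = (if n = 0 then {[]} else
     \<Union>i<fst (\<omega> []). (#) i ` return_labels t A (if A (x \<otimes> inc (child i \<omega>)) then n - 1 else n)
       (x \<otimes> inc (child i \<omega>)) (child i \<omega>))"

lemma return_labels_card: "finite (return_labels t A n x \<omega>) \<and> card (return_labels t A n x \<omega>) = returns t A n x \<omega>"
proof (induction t arbitrary: n x \<omega>)
  case (Suc t)
  show ?case
  proof (cases n)
    case (Suc k)
    have "card (return_labels (Suc t) A n x \<omega>) = (\<Sum>i<fst (\<omega> []). card ((#) i ` return_labels t A (if A (x \<otimes> inc (child i \<omega>)) then n - 1 else n)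
       (x \<otimes> inc (child i \<omega>)) (child i \<omega>)))"
      using Suc Suc.IH by (simp, subst card_UN_disjoint) auto
    also have "\<dots> = returns (Suc t) A n x \<omega>"
      using Suc Suc.IH by (simp add: card_image cong: if_cong)
    finally show ?thesis using Suc Suc.IH by simp
  qed simp
qed simp

lemma return_labels_mono: "return_labels t A n x \<omega> \<subseteq> return_labels (Suc t) A n x \<omega>"
proof (induction t arbitrary: n x \<omega>)
  case (Suc t)
  show ?case by (subst (1 2) return_labels.simps(2)) (use Suc in \<open>fastforce simp del: return_labels.simps\<close>)
qed simp

text \<open>Take for \<open>n\<close> the number of visits to \<open>A\<close> along the line of
  descent of \<open>l\<close>, its last label included.\<close>

lemma return_labels_cover:
  assumes "tree l \<omega>" "l = [] \<or> A (x \<otimes> site l \<omega>)" "x \<in> C"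
  shows "\<exists>n. l \<in> return_labels (length l) A n x \<omega>"
  using assms
proof (induction l arbitrary: x \<omega>)
  case Nil show ?case by (intro exI[of _ 0]) simp
next
  case (Cons i l)
  let ?y = "x \<otimes> inc (child i \<omega>)"
  have y: "?y \<otimes> site l (child i \<omega>) = x \<otimes> site (i # l) \<omega>" using Cons.prems by (simp add: m_assoc)
  have yC: "?y \<in> C" using Cons.prems by simp
  have "A (?y \<otimes> site l (child i \<omega>))" using Cons.prems y by auto
  then obtain n where n: "l \<in> return_labels (length l) A n ?y (child i \<omega>)"
    using Cons.IH[of "child i \<omega>" ?y] Cons.prems yC by auto
  show ?case
  proof (cases "A ?y")
    case True
    then show ?thesis using n Cons.prems by (intro exI[of _ "Suc n"]) auto
  next
    case False
    have "n \<noteq> 0"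
    proof
      assume "n = 0"
      then have "l = []" using n by (cases "length l") auto
      then show False using Cons.prems False by simp
    qed
    then show ?thesis using n Cons.prems False by (intro exI[of _ n]) auto
  qed
qed

text \<open>Every visit has a number below \<open>n0\<close>, because a line with more returns also
  makes the \<open>n0\<close>-th; and for each number the increasing sets
  \<open>return_labels\<close> have bounded cardinality.\<close>

lemma finite_hits:
  assumes x: "x \<in> C" and 0: "\<And>t. returns t A n0 x \<omega> = 0" and bd: "\<And>n. \<exists>B. \<forall>t. returns t A n x \<omega> \<le> B"
  shows "finite {l. tree l \<omega> \<and> A (x \<otimes> site l \<omega>)}"
proof -
  have fin: "finite (\<Union>t. return_labels t A n x \<omega>)" for n
  proof (rule ccontr)
    assume inf: "infinite (\<Union>t. return_labels t A n x \<omega>)"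
    obtain B where B: "\<And>t. returns t A n x \<omega> \<le> B" using bd by blast
    obtain F where F: "F \<subseteq> (\<Union>t. return_labels t A n x \<omega>)" "finite F" "card F = Suc B"
      using infinite_arbitrarily_large[OF inf] by metis
    have mono: "mono (\<lambda>t. return_labels t A n x \<omega>)" by (rule mono_iff_le_Suc[THEN iffD2]) (simp only: return_labels_mono simp_thms)
    have "\<exists>t. F \<subseteq> return_labels t A n x \<omega>" using F(2,1)
    proof (induction F)
      case (insert a F)
      then obtain t t' where "F \<subseteq> return_labels t A n x \<omega>" "a \<in> return_labels t' A n x \<omega>" by auto
      then show ?case using monoD[OF mono, of t "max t t'"] monoD[OF mono, of t' "max t t'"]
        by (intro exI[of _ "max t t'"]) auto
    qed simp
    then obtain t where "F \<subseteq> return_labels t A n x \<omega>" by blast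
    then have "Suc B \<le> returns t A n x \<omega>" using F return_labels_card[of t A n x \<omega>] card_mono by metis
    then show False using B[of t] by simp
  qed
  have z: "returns t A (n0 + k) x \<omega> = 0" for t k
    by (induction k) (use 0 returns_depth in \<open>force simp del: returns.simps\<close>)+
  have "{l. tree l \<omega> \<and> A (x \<otimes> site l \<omega>)} \<subseteq> (\<Union>n<n0. \<Union>t. return_labels t A n x \<omega>)"
  proof safe
    fix l assume "tree l \<omega>" "A (x \<otimes> site l \<omega>)"
    then obtain n where n: "l \<in> return_labels (length l) A n x \<omega>" using return_labels_cover x by blast
    then have "0 < returns (length l) A n x \<omega>" using return_labels_card[of "length l" A n x \<omega>] by (metis card_gt_0_iff empty_iff)
    then have "n < n0" using z[of "length l" "n - n0"] by (cases "n < n0") auto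
    then show "l \<in> (\<Union>n<n0. \<Union>t. return_labels t A n x \<omega>)" using n by blast
  qed
  then show ?thesis by (rule finite_subset) (use fin in auto)
qed

text \<open>Extinction bounds the number of returns along all lines of descent; finite means make
  each generation of the return process finite.\<close>

lemma AE_finite_hits:
  assumes x: "x \<in> C" and 0: "(INF n. survive A n x) = 0" and fin: "\<And>n. (SUP t. returns_mean t A n x) < \<infinity>"
  shows "AE \<omega> in N. finite {l. tree l \<omega> \<and> A (x \<otimes> site l \<omega>)}"
proof -
  let ?E = "\<lambda>n. {\<omega>. \<exists>t. 0 < returns t A n x \<omega>}"
  have [measurable]: "(\<lambda>\<omega>. returns t A n x \<omega>) \<in> measurable N (count_space UNIV)" for t n
    by (rule measurable_returns_tree[OF x])
  have m: "?E n \<in> sets N" for n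
  proof -
    have "{\<omega> \<in> space N. \<exists>t. 0 < returns t A n x \<omega>} \<in> sets N" by measurable
    then show ?thesis by simp
  qed
  have "emeasure N (\<Inter>n. ?E n) \<le> (INF n. survive A n x)"
    unfolding survive_eq_emeasure[OF x] using m by (intro INF_greatest emeasure_mono) auto
  then have "(\<Inter>n. ?E n) \<in> null_sets N" using 0 m by (auto simp: null_sets_def)
  then have 1: "AE \<omega> in N. \<not> (\<forall>n. \<exists>t. 0 < returns t A n x \<omega>)"
    by (rule AE_I') auto
  have 2: "AE \<omega> in N. \<forall>n. (SUP t. of_nat (returns t A n x \<omega>) :: ennreal) \<noteq> \<infinity>"
    unfolding AE_all_countable
  proof
    fix n
    have "(\<integral>\<^sup>+\<omega>. (SUP t. of_nat (returns t A n x \<omega>)) \<partial>N) = (SUP t. returns_mean t A n x)"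
      unfolding returns_mean_def using returns_mono_t
      by (intro nn_integral_monotone_convergence_SUP)
         (auto simp: incseq_Suc_iff le_fun_def simp del: returns.simps intro!: measurable_of_nat_returns[OF x])
    then have "(\<integral>\<^sup>+\<omega>. (SUP t. of_nat (returns t A n x \<omega>)) \<partial>N) \<noteq> \<infinity>" using fin[of n] by (metis less_irrefl)
    then show "AE \<omega> in N. (SUP t. of_nat (returns t A n x \<omega>) :: ennreal) \<noteq> \<infinity>"
      by (intro nn_integral_PInf_AE) (auto intro!: measurable_of_nat_returns[OF x] borel_measurable_SUP)
  qed
  show ?thesis using 1 2
  proof eventually_elim
    case (elim \<omega>)
    then obtain n0 where n0: "\<And>t. returns t A n0 x \<omega> = 0" by auto
    have "\<exists>B. \<forall>t. returns t A n x \<omega> \<le> B" for n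
    proof -
      obtain B :: nat where B: "(SUP t. of_nat (returns t A n x \<omega>) :: ennreal) \<le> of_nat B"
        using elim(2)[rule_format, of n] by (metis ennreal_Ex_less_of_nat infinity_ennreal_def less_imp_le less_top)
      have "returns t A n x \<omega> \<le> B" for t
      proof -
        have "(of_nat (returns t A n x \<omega>) :: ennreal) \<le> of_nat B"
          by (rule order_trans[OF SUP_upper B]) simp
        then show ?thesis by simp
      qed
      then show ?thesis by blast
    qed
    then show ?case by (intro finite_hits[OF x n0])
  qed
qed

end

section \<open>Mass transport on the two-sided tree\<close>

lemma measurable_set_inc_var:
  assumes f: "f \<in> measurable M (brw_space \<mu> q)" and s: "s \<in> measurable M (count_space UNIV)"
  shows "(\<lambda>x. set_inc (s x) (f x)) \<in> measurable M (brw_space \<mu> q)"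
proof (rule measurable_into_brw)
  have k: "(\<lambda>x. fst (f x [])) \<in> measurable M (count_space UNIV)"
    by (rule measurable_compose[OF measurable_brw_coord'[OF f]]) auto
  have "(\<lambda>x. (fst (f x []), s x)) \<in> measurable M (count_space UNIV)"
    by (rule measurable_compose_countable[OF measurable_compose[OF s] k]) auto
  then show "(\<lambda>x. set_inc (s x) (f x) u) \<in> measurable M (count_space UNIV)" for u
    using measurable_brw_coord'[OF f, of u] by (auto simp: set_inc_def)
qed

lemma sets_Collect_plain: "Measurable.pred M P \<Longrightarrow> space M = UNIV \<Longrightarrow> {x. P x} \<in> sets M"
  by (simp add: pred_def)

context brw begin

abbreviation "M2 \<equiv> N \<Otimes>\<^sub>M N"

sublocale NN: pair_prob_space N N ..

lemma space_M2 [simp]: "space M2 = UNIV"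
  by (simp add: space_pair_measure)

text \<open>Inversion on the support only, so that the map is an involution of the whole type and is
  compatible with clamping.\<close>

definition inv_inc :: "'a \<Rightarrow> 'a" where "inv_inc s = (if s \<in> T then inv s else s)"

lemma inv_inc_inv_inc [simp]: "inv_inc (inv_inc s) = s" by (simp add: inv_inc_def)
lemma clamp_inv_inc [simp]: "clamp (inv_inc s) = inv (clamp s)" by (simp add: inv_inc_def clamp_def)

lemma sum_T_inv_inc: "(\<Sum>s\<in>T. ennreal (pmf q s) * f (inv_inc s)) = (\<Sum>s\<in>T. ennreal (pmf q s) * f s)"
  by (subst (2) sum_T_inv) (auto simp: inv_inc_def p_sym intro!: sum.cong)

text \<open>
  A pair \<open>(a, b)\<close> stands for the tree obtained from \<open>a\<close> and \<open>b\<close> by an edge from the root of \<open>b\<close> to the root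
  of \<open>a\<close>, with increment \<open>inc a\<close>; positions are relative to the root of \<open>b\<close>. The first map below reverses
  this root edge, the second replaces it by the edge to the \<open>i\<close>-th child of the root of \<open>b\<close>. Both are
  involutions that preserve the law of two independent trees.
\<close>

fun rev_edge :: "(nat list \<Rightarrow> nat \<times> 'a) \<times> (nat list \<Rightarrow> nat \<times> 'a) \<Rightarrow> (nat list \<Rightarrow> nat \<times> 'a) \<times> (nat list \<Rightarrow> nat \<times> 'a)" where
  "rev_edge (a, b) = (set_inc (inv_inc (snd (a []))) b, set_inc (snd (b [])) a)"

fun turn :: "nat \<Rightarrow> (nat list \<Rightarrow> nat \<times> 'a) \<times> (nat list \<Rightarrow> nat \<times> 'a) \<Rightarrow> (nat list \<Rightarrow> nat \<times> 'a) \<times> (nat list \<Rightarrow> nat \<times> 'a)" where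
  "turn i (a, b) = (child i b, plug i a b)"

definition move where "move c x = (case c of None \<Rightarrow> rev_edge x | Some i \<Rightarrow> turn i x)"
text \<open>\<open>turn i\<close> preserves the law for every \<open>i\<close>, but follows an
  actual edge only if child \<open>i\<close> exists. As for \<open>hop\<close>: a reversal carries
  the origin across the root edge, a turn leaves it in place.\<close>

definition legal where "legal c x \<longleftrightarrow> (case c of None \<Rightarrow> True | Some i \<Rightarrow> i < fst (snd x []))"
definition hop where "hop c x = (case c of None \<Rightarrow> inc (fst x) | Some i \<Rightarrow> \<one>)"

lemma move_move [simp]: "move c (move c x) = x"
  by (cases x; cases c) (simp_all add: move_def)

lemma legal_move [simp]: "legal c (move c x) = legal c x"
  by (cases x; cases c) (simp_all add: move_def legal_def)

lemma hop_move [simp]: "hop c (move c x) = inv (hop c x)"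
  by (cases x; cases c) (simp_all add: move_def hop_def inc_def)

lemma hop_C [simp]: "hop c x \<in> C" by (cases c) (simp_all add: hop_def)

lemma measurable_rev_edge: "rev_edge \<in> measurable M2 M2"
proof -
  have 1: "(\<lambda>x. snd (f x [])) \<in> measurable M2 (count_space UNIV)" if "f \<in> measurable M2 N" for f :: "_ \<Rightarrow> nat list \<Rightarrow> nat \<times> 'a"
    by (rule measurable_compose[OF measurable_brw_coord'[OF that]]) auto
  have 2: "(\<lambda>x. inv_inc (snd (f x []))) \<in> measurable M2 (count_space UNIV)" if "f \<in> measurable M2 N" for f :: "_ \<Rightarrow> nat list \<Rightarrow> nat \<times> 'a"
    by (rule measurable_compose[OF measurable_brw_coord'[OF that]]) auto
  have "(\<lambda>x. (set_inc (inv_inc (snd (fst x []))) (snd x), set_inc (snd (snd x [])) (fst x))) \<in> measurable M2 M2"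
    by (intro measurable_Pair measurable_set_inc_var 1 2) auto
  moreover have "rev_edge = (\<lambda>x. (set_inc (inv_inc (snd (fst x []))) (snd x), set_inc (snd (snd x [])) (fst x)))" by (auto simp: fun_eq_iff)
  ultimately show ?thesis by simp
qed

lemma measurable_turn: "turn i \<in> measurable M2 M2"
proof -
  have "turn i = (\<lambda>x. (child i (snd x), plug i (fst x) (snd x)))" by (auto simp: fun_eq_iff)
  then show ?thesis by simp
qed

lemma measurable_move: "move c \<in> measurable M2 M2"
  using measurable_rev_edge measurable_turn by (cases c) (auto simp: move_def[abs_def])

text \<open>The increment of the root edge is inverted, which the symmetry of \<open>q\<close>
  permits, and becomes the root increment of \<open>b\<close>; the spare root increment of
  \<open>b\<close> goes to \<open>a\<close>. Both are independent of the rest of the trees.\<close>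

lemma nn_integral_rev_edge:
  assumes F [measurable]: "F \<in> borel_measurable M2"
  shows "(\<integral>\<^sup>+x. F (rev_edge x) \<partial>M2) = (\<integral>\<^sup>+x. F x \<partial>M2)"
proof -
  have [measurable]: "rev_edge \<in> measurable M2 M2" by (rule measurable_rev_edge)
  have 1: "(\<integral>\<^sup>+x. F (rev_edge x) \<partial>M2) = (\<integral>\<^sup>+b. \<integral>\<^sup>+a. F (rev_edge (a, b)) \<partial>N \<partial>N)"
    by (subst NN.nn_integral_snd) auto
  have 2: "(\<integral>\<^sup>+a. F (rev_edge (a, b)) \<partial>N) = (\<Sum>s\<in>T. ennreal (pmf q s) * (\<integral>\<^sup>+a. F (set_inc s b, set_inc (snd (b [])) a) \<partial>N))" for b
  proof -
    have "(\<integral>\<^sup>+a. F (rev_edge (a, b)) \<partial>N) = (\<integral>\<^sup>+a. \<integral>\<^sup>+s. F (rev_edge (set_inc s a, b)) \<partial>measure_pmf q \<partial>N)"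
    proof (rule nn_integral_set_inc)
      have "(\<lambda>a. (a, b)) \<in> measurable N M2" by simp
      from measurable_compose[OF this measurable_compose[OF measurable_rev_edge F]]
      show "(\<lambda>a. F (rev_edge (a, b))) \<in> borel_measurable N" .
    qed simp
    also have "\<dots> = (\<integral>\<^sup>+a. (\<Sum>s\<in>T. ennreal (pmf q s) * F (set_inc s b, set_inc (snd (b [])) a)) \<partial>N)"
      by (simp add: nn_integral_q sum_T_inv_inc[where f = "\<lambda>s. F (set_inc s b, _)"])
    also have "\<dots> = (\<Sum>s\<in>T. ennreal (pmf q s) * (\<integral>\<^sup>+a. F (set_inc s b, set_inc (snd (b [])) a) \<partial>N))"
      by (subst nn_integral_sum) (auto simp: nn_integral_cmult)
    finally show ?thesis .
  qed
  have m2: "(\<lambda>b. \<integral>\<^sup>+a. F (set_inc s b, set_inc (snd (b [])) a) \<partial>N) \<in> borel_measurable N" for s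
  proof -
    have 1: "(\<lambda>x. snd (fst x [])) \<in> measurable M2 (count_space UNIV)"
      by (rule measurable_compose[OF measurable_brw_coord']) auto
    have "(\<lambda>x. (set_inc s (fst x), set_inc (snd (fst x [])) (snd x))) \<in> measurable M2 M2"
      by (intro measurable_Pair measurable_set_inc_var 1) auto
    from measurable_compose[OF this F]
    have [measurable]: "(\<lambda>x. F (set_inc s (fst x), set_inc (snd (fst x [])) (snd x))) \<in> borel_measurable M2" .
    show ?thesis by (intro N.borel_measurable_nn_integral) (simp add: case_prod_beta')
  qed
  have "(\<integral>\<^sup>+x. F (rev_edge x) \<partial>M2) = (\<Sum>s\<in>T. ennreal (pmf q s) * (\<integral>\<^sup>+b. \<integral>\<^sup>+a. F (set_inc s b, set_inc (snd (b [])) a) \<partial>N \<partial>N))"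
    unfolding 1 2 using m2 by (subst nn_integral_sum) (auto simp: nn_integral_cmult)
  \<comment> \<open>With \<open>s\<close> fixed, \<open>F\<close> sees the old root increment of
    \<open>b\<close> only as the new one of \<open>a\<close>; redrawing it gives \<open>a\<close> a
    fresh root increment, that is, \<open>a\<close> itself in law.\<close>
  also have "\<dots> = (\<Sum>s\<in>T. ennreal (pmf q s) * (\<integral>\<^sup>+b. \<integral>\<^sup>+a. F (set_inc s b, a) \<partial>N \<partial>N))"
  proof (intro sum.cong refl arg_cong2[where f = "(*)"])
    fix s
    have "(\<integral>\<^sup>+b. \<integral>\<^sup>+a. F (set_inc s b, set_inc (snd (b [])) a) \<partial>N \<partial>N)
       = (\<integral>\<^sup>+b. \<integral>\<^sup>+t. \<integral>\<^sup>+a. F (set_inc s (set_inc t b), set_inc (snd (set_inc t b [])) a) \<partial>N \<partial>measure_pmf q \<partial>N)"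
      by (rule nn_integral_set_inc[OF m2]) simp
    also have "\<dots> = (\<integral>\<^sup>+b. \<integral>\<^sup>+t. \<integral>\<^sup>+a. F (set_inc s b, set_inc t a) \<partial>N \<partial>measure_pmf q \<partial>N)" by simp
    also have "(\<lambda>b. \<integral>\<^sup>+t. \<integral>\<^sup>+a. F (set_inc s b, set_inc t a) \<partial>N \<partial>measure_pmf q) = (\<lambda>b. \<integral>\<^sup>+a. \<integral>\<^sup>+t. F (set_inc s b, set_inc t a) \<partial>measure_pmf q \<partial>N)"
      by (subst nn_integral_q, rule ext, subst nn_integral_q) (simp add: nn_integral_sum nn_integral_cmult)
    also have "\<dots> = (\<lambda>b. \<integral>\<^sup>+a. F (set_inc s b, a) \<partial>N)"
      by (rule ext, rule nn_integral_set_inc[symmetric]) auto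
    finally show "(\<integral>\<^sup>+b. \<integral>\<^sup>+a. F (set_inc s b, set_inc (snd (b [])) a) \<partial>N \<partial>N) = (\<integral>\<^sup>+b. \<integral>\<^sup>+a. F (set_inc s b, a) \<partial>N \<partial>N)" .
  qed
  also have "\<dots> = (\<integral>\<^sup>+b. \<integral>\<^sup>+s. \<integral>\<^sup>+a. F (set_inc s b, a) \<partial>N \<partial>measure_pmf q \<partial>N)"
    by (subst nn_integral_q) (simp add: nn_integral_sum nn_integral_cmult)
  also have "\<dots> = (\<integral>\<^sup>+b. \<integral>\<^sup>+a. F (b, a) \<partial>N \<partial>N)"
    by (rule nn_integral_set_inc[symmetric]) auto
  also have "\<dots> = (\<integral>\<^sup>+x. F x \<partial>M2)" by (rule N.nn_integral_fst) simp
  finally show ?thesis .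
qed

text \<open>Redraw the subtree of \<open>b\<close> at child \<open>i\<close>: it and
  \<open>a\<close> are then two independent trees with the same law, and turning exchanges
  them.\<close>

lemma nn_integral_turn:
  assumes F [measurable]: "F \<in> borel_measurable M2"
  shows "(\<integral>\<^sup>+x. F (turn i x) \<partial>M2) = (\<integral>\<^sup>+x. F x \<partial>M2)"
proof -
  have [measurable]: "turn i \<in> measurable M2 M2" by (rule measurable_turn)
  have "(\<integral>\<^sup>+x. F (turn i x) \<partial>M2) = (\<integral>\<^sup>+a. \<integral>\<^sup>+b. F (turn i (a, b)) \<partial>N \<partial>N)"
    by (subst N.nn_integral_fst) auto
  also have "\<dots> = (\<integral>\<^sup>+a. \<integral>\<^sup>+b. \<integral>\<^sup>+\<eta>. F (turn i (a, plug i \<eta> b)) \<partial>N \<partial>N \<partial>N)"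
    by (intro nn_integral_cong nn_integral_plug) auto
  also have "\<dots> = (\<integral>\<^sup>+a. \<integral>\<^sup>+b. \<integral>\<^sup>+\<eta>. F (\<eta>, plug i a b) \<partial>N \<partial>N \<partial>N)" by simp
  also have "\<dots> = (\<integral>\<^sup>+a. \<integral>\<^sup>+\<eta>. \<integral>\<^sup>+b. F (\<eta>, plug i a b) \<partial>N \<partial>N \<partial>N)"
    by (intro nn_integral_cong NN.Fubini') auto
  also have "\<dots> = (\<integral>\<^sup>+\<eta>. \<integral>\<^sup>+a. \<integral>\<^sup>+b. F (\<eta>, plug i a b) \<partial>N \<partial>N \<partial>N)"
    by (intro NN.Fubini') auto
  also have "\<dots> = (\<integral>\<^sup>+\<eta>. \<integral>\<^sup>+b. \<integral>\<^sup>+a. F (\<eta>, plug i a b) \<partial>N \<partial>N \<partial>N)"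
    by (intro nn_integral_cong NN.Fubini') auto
  also have "\<dots> = (\<integral>\<^sup>+\<eta>. \<integral>\<^sup>+b. F (\<eta>, b) \<partial>N \<partial>N)"
    by (intro nn_integral_cong nn_integral_plug[symmetric]) auto
  also have "\<dots> = (\<integral>\<^sup>+x. F x \<partial>M2)" by (rule N.nn_integral_fst) simp
  finally show ?thesis .
qed

lemma nn_integral_move: "F \<in> borel_measurable M2 \<Longrightarrow> (\<integral>\<^sup>+x. F (move c x) \<partial>M2) = (\<integral>\<^sup>+x. F x \<partial>M2)"
  by (cases c) (simp_all add: move_def nn_integral_rev_edge nn_integral_turn)

section \<open>Words of moves and the mass of a two-sided tree\<close>

primrec moves where
  "moves [] x = x" | "moves (c # w) x = moves w (move c x)"
primrec legals where
  "legals [] x \<longleftrightarrow> True" | "legals (c # w) x \<longleftrightarrow> legal c x \<and> legals w (move c x)"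
primrec hops where
  "hops [] x = \<one>" | "hops (c # w) x = hop c x \<otimes> hops w (move c x)"

lemma hops_C [simp]: "hops w x \<in> C" by (induction w arbitrary: x) auto

lemma moves_append: "moves (w @ w') x = moves w' (moves w x)" by (induction w arbitrary: x) auto
lemma legals_append: "legals (w @ w') x \<longleftrightarrow> legals w x \<and> legals w' (moves w x)" by (induction w arbitrary: x) auto
lemma hops_append: "hops (w @ w') x = hops w x \<otimes> hops w' (moves w x)"
  by (induction w arbitrary: x) (auto simp: m_assoc)

lemma moves_rev [simp]: "moves (rev w) (moves w x) = x"
  by (induction w arbitrary: x) (auto simp: moves_append)
lemma legals_rev: "legals (rev w) (moves w x) = legals w x"
  by (induction w arbitrary: x) (auto simp: legals_append)
lemma hops_rev: "hops (rev w) (moves w x) = inv (hops w x)"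
  by (induction w arbitrary: x) (auto simp: hops_append inv_mult_group)

lemma measurable_moves: "moves w \<in> measurable M2 M2"
  by (induction w) (auto simp: measurable_compose[OF measurable_move] id_def[symmetric] moves.simps[abs_def])

lemma measurable_legals: "Measurable.pred M2 (legals w)"
proof (induction w)
  case (Cons c w)
  have [measurable]: "Measurable.pred M2 (legal c)" by (cases c) (simp_all add: legal_def[abs_def])
  have "Measurable.pred M2 (\<lambda>x. legals w (move c x))" by (rule measurable_compose[OF measurable_move Cons])
  then show ?case by simp
qed simp

lemma measurable_hops: "hops w \<in> measurable M2 (count_space C)"
proof (induction w)
  case (Cons c w)
  have IH: "(\<lambda>x. hops w (move c x)) \<in> measurable M2 (count_space C)" by (rule measurable_compose[OF measurable_move Cons])
  have hop: "hop c \<in> measurable M2 (count_space C)"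
  proof (cases c)
    case None
    have "(\<lambda>x. inc (fst x)) \<in> measurable M2 (count_space T)" by simp
    then have "(\<lambda>x. inc (fst x)) \<in> measurable M2 (count_space C)"
      by (rule measurable_compose) auto
    then show ?thesis using None by (simp add: hop_def[abs_def])
  qed (simp add: hop_def[abs_def])
  show ?case
    unfolding hops.simps
    by (rule measurable_compose_countable'[where f = "\<lambda>g x. g \<otimes> hops w (move c x)" and g = "hop c" and I = C,
          OF measurable_compose[OF IH] hop countable_C]) auto
qed simp

lemma nn_integral_moves: "F \<in> borel_measurable M2 \<Longrightarrow> (\<integral>\<^sup>+x. F (moves w x) \<partial>M2) = (\<integral>\<^sup>+x. F x \<partial>M2)"
proof (induction w)
  case (Cons c w)
  have "(\<integral>\<^sup>+x. F (moves w (move c x)) \<partial>M2) = (\<integral>\<^sup>+x. F (moves w x) \<partial>M2)"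
    by (rule nn_integral_move) (rule measurable_compose[OF measurable_moves Cons.prems])
  then show ?case using Cons by simp
qed simp

lemma edges_cong: "(\<And>y. y \<in> C \<Longrightarrow> g y = h y) \<Longrightarrow> edges \<omega> g = edges \<omega> h"
  by (simp add: edges_def)

text \<open>The two extra root terms in \<open>edges\<close> now count the ends of the root edge, so
  every edge of the two-sided tree is counted at both ends and none is distinguished.\<close>

definition mass where "mass x g = edges (snd x) g + edges (fst x) (\<lambda>y. g (inc (fst x) \<otimes> y))"

lemma mass_cong: "(\<And>y. y \<in> C \<Longrightarrow> g y = h y) \<Longrightarrow> mass x g = mass x h"
  unfolding mass_def by (intro arg_cong2[where f = "(+)"] edges_cong) auto

text \<open>Moving the root edge changes the origin, but not the set of edges with their ends. For a
  turn, the term of child \<open>i\<close> in \<open>edges_rec\<close> trades places with that of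
  \<open>a\<close>.\<close>

lemma mass_move: "legal c x \<Longrightarrow> mass (move c x) g = mass x (\<lambda>y. g (inv (hop c x) \<otimes> y))"
proof (cases c; cases x)
  fix a b assume c: "c = None" and x: "x = (a, b)"
  have "edges a g = edges a (\<lambda>y. g (inv (inc a) \<otimes> (inc a \<otimes> y)))"
    by (rule edges_cong) (simp add: m_assoc[symmetric])
  then show ?thesis using c x
    by (simp add: move_def hop_def mass_def add.commute) (simp add: inc_def)
next
  fix i a b assume v: "legal c x" and c: "c = Some i" and x: "x = (a, b)"
  let ?z = "\<lambda>\<omega>. g \<one> + edges \<omega> (\<lambda>y. g (inc \<omega> \<otimes> y))"
  have i: "i < fst (b [])" using v c x by (simp add: legal_def)
  have rec: "edges b g = g \<one> + (\<Sum>j<fst (b []). ?z (child j b))" for b :: "nat list \<Rightarrow> nat \<times> 'a"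
    by (rule edges_rec)
  have "mass (move c x) g = edges (plug i a b) g + edges (child i b) (\<lambda>y. g (inc (child i b) \<otimes> y))"
    using c x by (simp add: mass_def move_def)
  also have "edges (plug i a b) g = g \<one> + (\<Sum>j<fst (b []). ?z (if j = i then a else child j b))"
    by (subst rec) simp
  also have "(\<Sum>j<fst (b []). ?z (if j = i then a else child j b)) = ?z a + (\<Sum>j\<in>{..<fst (b [])} - {i}. ?z (child j b))"
    using i by (subst sum.remove[of _ i]) auto
  also have "g \<one> + (?z a + (\<Sum>j\<in>{..<fst (b [])} - {i}. ?z (child j b))) + edges (child i b) (\<lambda>y. g (inc (child i b) \<otimes> y))
     = g \<one> + (?z (child i b) + (\<Sum>j\<in>{..<fst (b [])} - {i}. ?z (child j b))) + edges a (\<lambda>y. g (inc a \<otimes> y))"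
    by (simp add: add_ac)
  also have "?z (child i b) + (\<Sum>j\<in>{..<fst (b [])} - {i}. ?z (child j b)) = (\<Sum>j<fst (b []). ?z (child j b))"
    using i by (subst (2) sum.remove[of _ i]) auto
  also have "g \<one> + (\<Sum>j<fst (b []). ?z (child j b)) = edges b g" by (rule rec[symmetric])
  also have "edges b g + edges a (\<lambda>y. g (inc a \<otimes> y)) = mass x g" using x by (simp add: mass_def)
  also have "mass x g = mass x (\<lambda>y. g (inv (hop c x) \<otimes> y))" using c by (intro mass_cong) (simp add: hop_def)
  finally show ?thesis .
qed

lemma mass_moves: "legals w x \<Longrightarrow> mass (moves w x) g = mass x (\<lambda>y. g (inv (hops w x) \<otimes> y))"
proof (induction w arbitrary: x g)
  case Nil then show ?case by (auto intro: mass_cong)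
next
  case (Cons c w)
  then have "mass (moves (c # w) x) g = mass x (\<lambda>y. g (inv (hops w (move c x)) \<otimes> (inv (hop c x) \<otimes> y)))"
    by (simp add: mass_move)
  also have "\<dots> = mass x (\<lambda>y. g (inv (hops (c # w) x) \<otimes> y))"
    by (rule mass_cong) (simp add: inv_mult_group m_assoc)
  finally show ?case .
qed

definition occ where "occ x y = mass x (indicator {y})"
text \<open>The field as seen from \<open>p\<close>. The value 0 off the carrier agrees with
  \<open>occ\<close>, so that \<open>occ_moves\<close> is an equation between functions.\<close>

definition shift :: "'a \<Rightarrow> ('a \<Rightarrow> ennreal) \<Rightarrow> 'a \<Rightarrow> ennreal" where
  "shift p f = (\<lambda>y. if y \<in> C then f (p \<otimes> y) else 0)"

lemma occ_moves: "legals w x \<Longrightarrow> occ (moves w x) = shift (hops w x) (occ x)"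
proof
  fix y assume v: "legals w x"
  show "occ (moves w x) y = shift (hops w x) (occ x) y"
  proof (cases "y \<in> C")
    case True
    have "mass x (\<lambda>z. indicator {y} (inv (hops w x) \<otimes> z)) = mass x (indicator {hops w x \<otimes> y})"
    proof (rule mass_cong)
      fix z assume z: "z \<in> C"
      have "inv (hops w x) \<otimes> z = y \<longleftrightarrow> z = hops w x \<otimes> y"
        using z True by (metis inv_closed inv_solve_left' hops_C inv_inv)
      then show "indicator {y} (inv (hops w x) \<otimes> z) = (indicator {hops w x \<otimes> y} z :: ennreal)"
        by (simp add: indicator_def)
    qed
    then show ?thesis using True v by (simp add: occ_def mass_moves shift_def)
  next
    case False
    then have "mass (moves w x) (indicator {y}) = mass (moves w x) (\<lambda>_. 0)"
      by (intro mass_cong) (auto simp: indicator_def)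
    also have "\<dots> = 0" by (simp add: mass_def edges_def)
    finally show ?thesis using False by (simp add: occ_def shift_def)
  qed
qed

lemma measurable_mass: "(\<lambda>x. mass x g) \<in> borel_measurable M2"
proof -
  have "(\<lambda>x. edges (fst x) (\<lambda>y. g (inc (fst x) \<otimes> y))) \<in> borel_measurable M2"
    by (rule measurable_fun_inc[where f = fst and g = "\<lambda>s x. edges (fst x) (\<lambda>y. g (s \<otimes> y))"]) auto
  then show ?thesis unfolding mass_def by simp
qed

lemma measurable_occ [measurable]: "(\<lambda>x. occ x y) \<in> borel_measurable M2"
  unfolding occ_def by (rule measurable_mass)

text \<open>
  The words \<open>core l\<close>, with or without a reversal \<open>None\<close> added at either end, lead from the root edge to
  every other edge in either orientation, each exactly once; reversing the word leads back.
\<close>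

primrec core :: "nat list \<Rightarrow> nat option list" where
  "core [] = []" | "core (i # l) = (if l = [] then [Some i] else Some i # None # core l)"

lemma core_snoc: "core (l @ [i]) = (if l = [] then [Some i] else core l @ [None, Some i])"
  by (induction l) auto

lemma rev_core: "rev (core l) = core (rev l)"
  by (induction l) (auto simp: core_snoc)

text \<open>After \<open>core l\<close> the root edge is the one above \<open>l\<close>, with the
  origin at the parent of \<open>l\<close>; a final reversal carries the origin to
  \<open>l\<close>.\<close>

lemma core_legals_hops:
  assumes "l \<noteq> []"
  shows "legals (core l) (a, b) = tree l b \<and> hops (core l) (a, b) = site (butlast l) b \<and>
    legals (core l @ [None]) (a, b) = tree l b \<and> hops (core l @ [None]) (a, b) = site l b"
  using assms
proof (induction l arbitrary: a b)
  case (Cons i l)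
  show ?case
  proof (cases "l = []")
    case True then show ?thesis by (simp add: move_def legal_def hop_def)
  next
    case False
    show ?thesis using Cons.IH[OF False] False by (simp add: move_def legal_def hop_def)
  qed
qed simp

text \<open>The words \<open>[]\<close> and \<open>[None]\<close> stand for the two ends of the root
  edge; the families without an initial reversal give the ends of the edges of \<open>b\<close>,
  those with one the ends of the edges of \<open>a\<close>.\<close>

lemma mass_words:
  "mass x g = g \<one> + g (hops [None] x) + (\<integral>\<^sup>+l. 
     (indicator {x. legals (core l) x} x * g (hops (core l) x) +
      indicator {x. legals (core l @ [None]) x} x * g (hops (core l @ [None]) x)) +
     (indicator {x. legals (None # core l) x} x * g (hops (None # core l) x) +
      indicator {x. legals (None # core l @ [None]) x} x * g (hops (None # core l @ [None]) x)) \<partial>count_space {l. l \<noteq> []})"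
proof -
  obtain a b where x: "x = (a, b)" by (cases x)
  have "(\<integral>\<^sup>+l. (indicator {x. legals (core l) x} x * g (hops (core l) x) +
      indicator {x. legals (core l @ [None]) x} x * g (hops (core l @ [None]) x)) +
     (indicator {x. legals (None # core l) x} x * g (hops (None # core l) x) +
      indicator {x. legals (None # core l @ [None]) x} x * g (hops (None # core l @ [None]) x)) \<partial>count_space {l. l \<noteq> []})
    = (\<integral>\<^sup>+l. indicator {\<omega>. tree l \<omega>} b * (g (site (butlast l) b) + g (site l b)) +
         indicator {\<omega>. tree l \<omega>} a * (g (inc a \<otimes> site (butlast l) a) + g (inc a \<otimes> site l a)) \<partial>count_space {l. l \<noteq> []})"
    using core_legals_hops by (intro nn_integral_cong) (auto simp: x legal_def hop_def move_def indicator_def)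
  also have "\<dots> = (\<integral>\<^sup>+l. indicator {\<omega>. tree l \<omega>} b * (g (site (butlast l) b) + g (site l b)) \<partial>count_space {l. l \<noteq> []})
     + (\<integral>\<^sup>+l. indicator {\<omega>. tree l \<omega>} a * (g (inc a \<otimes> site (butlast l) a) + g (inc a \<otimes> site l a)) \<partial>count_space {l. l \<noteq> []})"
    by (rule nn_integral_add) auto
  finally show ?thesis by (simp add: mass_def edges_def x hop_def add_ac)
qed

lemma measurable_fun_hops:
  fixes h :: "_ \<Rightarrow> _ \<Rightarrow> ennreal"
  assumes "\<And>y. y \<in> C \<Longrightarrow> (\<lambda>x. h x y) \<in> borel_measurable M2"
  shows "(\<lambda>x. h x (hops w x)) \<in> borel_measurable M2"
  by (rule measurable_compose_countable'[where f = "\<lambda>y x. h x y" and g = "hops w" and I = C, OF assms measurable_hops countable_C])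

lemma measurable_legals_fun_hops:
  fixes h :: "_ \<Rightarrow> _ \<Rightarrow> ennreal"
  assumes "\<And>y. y \<in> C \<Longrightarrow> (\<lambda>x. h x y) \<in> borel_measurable M2"
  shows "(\<lambda>x. indicator {x. legals w x} x * h x (hops w x)) \<in> borel_measurable M2"
  by (rule borel_measurable_times_ennreal[OF borel_measurable_indicator measurable_fun_hops])
     (use assms sets_Collect_plain[OF measurable_legals] in auto)

text \<open>Substitute \<open>moves w x\<close> for \<open>x\<close>: the law is unchanged, the
  field is re-centred at the other end, and the reversed word leads back.\<close>

lemma word_transport:
  assumes H1: "\<And>y. y \<in> C \<Longrightarrow> (\<lambda>x. H (occ x) y) \<in> borel_measurable M2"
    and H2: "\<And>y. y \<in> C \<Longrightarrow> (\<lambda>x. H (shift y (occ x)) (inv y)) \<in> borel_measurable M2"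
  shows "(\<integral>\<^sup>+x. indicator {x. legals w x} x * H (occ x) (hops w x) \<partial>M2)
    = (\<integral>\<^sup>+x. indicator {x. legals (rev w) x} x * H (shift (hops (rev w) x) (occ x)) (inv (hops (rev w) x)) \<partial>M2)"
proof -
  let ?F = "\<lambda>x. indicator {x. legals (rev w) x} x * H (shift (hops (rev w) x) (occ x)) (inv (hops (rev w) x))"
  have F: "?F \<in> borel_measurable M2"
    by (rule measurable_legals_fun_hops[where h = "\<lambda>x y. H (shift y (occ x)) (inv y)", OF H2])
  have "(\<integral>\<^sup>+x. ?F x \<partial>M2) = (\<integral>\<^sup>+x. ?F (moves w x) \<partial>M2)" by (rule nn_integral_moves[OF F, symmetric])
  also have "\<dots> = (\<integral>\<^sup>+x. indicator {x. legals w x} x * H (occ x) (hops w x) \<partial>M2)"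
  proof (intro nn_integral_cong)
    fix x
    have "shift (hops (rev w) (moves w x)) (occ (moves w x)) = occ x" if "legals w x"
      using occ_moves[of "rev w" "moves w x"] that by (simp add: legals_rev)
    then show "?F (moves w x) = indicator {x. legals w x} x * H (occ x) (hops w x)"
      by (auto simp: indicator_def legals_rev hops_rev)
  qed
  finally show ?thesis by simp
qed

text \<open>Reversing words permutes the families: \<open>core l @ [None]\<close> is exchanged with
  \<open>None # core (rev l)\<close>, while the other two families are kept with \<open>l\<close>
  replaced by \<open>rev l\<close>. The sum over all words is therefore unchanged.\<close>

theorem mass_transport:
  assumes H1: "\<And>y. y \<in> C \<Longrightarrow> (\<lambda>x. H (occ x) y) \<in> borel_measurable M2"
    and H2: "\<And>y. y \<in> C \<Longrightarrow> (\<lambda>x. H (shift y (occ x)) (inv y)) \<in> borel_measurable M2"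
  shows "(\<integral>\<^sup>+x. mass x (H (occ x)) \<partial>M2) = (\<integral>\<^sup>+x. mass x (\<lambda>y. H (shift y (occ x)) (inv y)) \<partial>M2)"
proof -
  define t where "t K w x = indicator {x. legals w x} x * (K x (hops w x) :: ennreal)" for K w x
  let ?J = "\<lambda>x y. H (shift y (occ x)) (inv y)"
  have ex: "(\<integral>\<^sup>+x. mass x (K x) \<partial>M2) = integral\<^sup>N M2 (t K []) + integral\<^sup>N M2 (t K [None])
     + (\<integral>\<^sup>+l. (integral\<^sup>N M2 (t K (core l)) + integral\<^sup>N M2 (t K (core l @ [None]))) +
         (integral\<^sup>N M2 (t K (None # core l)) + integral\<^sup>N M2 (t K (None # core l @ [None]))) \<partial>count_space {l. l \<noteq> []})"
    if K: "\<And>y. y \<in> C \<Longrightarrow> (\<lambda>x. K x y) \<in> borel_measurable M2" for K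
  proof -
    have m [measurable]: "t K w \<in> borel_measurable M2" for w
      unfolding t_def by (rule measurable_legals_fun_hops[where h = K, OF K])
    have "mass x (K x) = t K [] x + t K [None] x + (\<integral>\<^sup>+l. (t K (core l) x + t K (core l @ [None]) x) +
        (t K (None # core l) x + t K (None # core l @ [None]) x) \<partial>count_space {l. l \<noteq> []})" for x
    proof -
      have "t K [] x = K x \<one>" "t K [None] x = K x (hops [None] x)" by (simp_all add: t_def legal_def)
      then show ?thesis unfolding t_def by (simp only: mass_words)
    qed
    then have "(\<integral>\<^sup>+x. mass x (K x) \<partial>M2) = (\<integral>\<^sup>+x. t K [] x + t K [None] x + (\<integral>\<^sup>+l. (t K (core l) x + t K (core l @ [None]) x) +
        (t K (None # core l) x + t K (None # core l @ [None]) x) \<partial>count_space {l. l \<noteq> []}) \<partial>M2)"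
      by simp
    also have "\<dots> = integral\<^sup>N M2 (t K []) + integral\<^sup>N M2 (t K [None]) + (\<integral>\<^sup>+x. (\<integral>\<^sup>+l. (t K (core l) x + t K (core l @ [None]) x) +
        (t K (None # core l) x + t K (None # core l @ [None]) x) \<partial>count_space {l. l \<noteq> []}) \<partial>M2)"
      by (subst nn_integral_add, simp, rule borel_measurable_count_space_integral) (simp_all add: nn_integral_add)
    also have "(\<integral>\<^sup>+x. (\<integral>\<^sup>+l. (t K (core l) x + t K (core l @ [None]) x) +
        (t K (None # core l) x + t K (None # core l @ [None]) x) \<partial>count_space {l. l \<noteq> []}) \<partial>M2)
      = (\<integral>\<^sup>+l. (\<integral>\<^sup>+x. (t K (core l) x + t K (core l @ [None]) x) +
        (t K (None # core l) x + t K (None # core l @ [None]) x) \<partial>M2) \<partial>count_space {l. l \<noteq> []})"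
      by (rule nn_integral_count_space_nn_integral) auto
    also have "(\<lambda>l. \<integral>\<^sup>+x. (t K (core l) x + t K (core l @ [None]) x) +
        (t K (None # core l) x + t K (None # core l @ [None]) x) \<partial>M2) =
      (\<lambda>l. (integral\<^sup>N M2 (t K (core l)) + integral\<^sup>N M2 (t K (core l @ [None]))) +
         (integral\<^sup>N M2 (t K (None # core l)) + integral\<^sup>N M2 (t K (None # core l @ [None]))))"
      by (simp add: nn_integral_add)
    finally show ?thesis .
  qed
  have wt: "integral\<^sup>N M2 (t (\<lambda>x. H (occ x)) w) = integral\<^sup>N M2 (t ?J (rev w))" for w
    unfolding t_def by (rule word_transport[OF H1 H2])
  have bij: "bij_betw rev {l :: nat list. l \<noteq> []} {l. l \<noteq> []}"
    by (rule bij_betw_byWitness[where f' = rev]) auto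
  have "(\<integral>\<^sup>+x. mass x (H (occ x)) \<partial>M2) = integral\<^sup>N M2 (t ?J []) + integral\<^sup>N M2 (t ?J [None])
     + (\<integral>\<^sup>+l. (integral\<^sup>N M2 (t ?J (core (rev l))) + integral\<^sup>N M2 (t ?J (None # core (rev l)))) +
         (integral\<^sup>N M2 (t ?J (core (rev l) @ [None])) + integral\<^sup>N M2 (t ?J (None # core (rev l) @ [None]))) \<partial>count_space {l. l \<noteq> []})"
    using ex[of "\<lambda>x. H (occ x)", OF H1] by (simp add: wt rev_core)
  also have "\<dots> = integral\<^sup>N M2 (t ?J []) + integral\<^sup>N M2 (t ?J [None])
     + (\<integral>\<^sup>+l. (integral\<^sup>N M2 (t ?J (core l)) + integral\<^sup>N M2 (t ?J (None # core l))) +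
         (integral\<^sup>N M2 (t ?J (core l @ [None])) + integral\<^sup>N M2 (t ?J (None # core l @ [None]))) \<partial>count_space {l. l \<noteq> []})"
    by (subst nn_integral_bij_count_space[OF bij, symmetric]) simp
  also have "\<dots> = (\<integral>\<^sup>+x. mass x (?J x) \<partial>M2)"
    using ex[of ?J, OF H2] by (simp add: add_ac)
  finally show ?thesis .
qed

end

section \<open>The return operator\<close>

context brw begin

lemma C_induct [consumes 1, case_names one step]:
  assumes y: "y \<in> C" and one: "P \<one>" and step: "\<And>x s. x \<in> C \<Longrightarrow> s \<in> S \<Longrightarrow> P x \<Longrightarrow> P (x \<otimes> s)"
  shows "P y"
proof -
  have "\<forall>x\<in>C. P x \<longrightarrow> P (x \<otimes> h)" if "h \<in> generate G S" for h
    using that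
  proof (induction h rule: generate.induct)
    case (eng h1 h2)
    have "h1 \<in> C" "h2 \<in> C" using eng S_gen by auto
    then show ?case using eng by (auto simp: m_assoc[symmetric])
  qed (use step S_inv S_carrier in auto)
  then have "P (\<one> \<otimes> y)" using y one S_gen by blast
  then show ?thesis using y by simp
qed

text \<open>The probability of being at \<open>y\<close> at time \<open>n + 1\<close> with no visit
  to \<open>A\<close> at times 1 to \<open>n\<close>. The end points may lie anywhere, which makes
  the kernel symmetric without conditions.\<close>

primrec ret_kernel :: "nat \<Rightarrow> ('a \<Rightarrow> bool) \<Rightarrow> 'a \<Rightarrow> 'a \<Rightarrow> ennreal" where
  "ret_kernel 0 A x y = avg (indicator {y}) x"
| "ret_kernel (Suc n) A x y = avg (\<lambda>u. if A u then 0 else ret_kernel n A u y) x"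

text \<open>Splits returns by time \<open>n + 1\<close> and place, the form in which the symmetry of
  the walk can be applied to \<open>hit\<close>.\<close>

lemma hit_ret_kernel:
  "x \<in> C \<Longrightarrow> hit z A \<psi> t x = (\<Sum>n<t. z ^ Suc n * (\<integral>\<^sup>+y. ret_kernel n A x y * (if A y then \<psi> y else 0) \<partial>count_space C))"
proof (induction t arbitrary: x)
  case (Suc t)
  let ?\<phi> = "\<lambda>y. if A y then \<psi> y else 0"
  define I where "I n x = (\<integral>\<^sup>+y. ret_kernel n A x y * ?\<phi> y \<partial>count_space C)" for n x
  have I0: "I 0 x = avg ?\<phi> x" if "x \<in> C" for x
  proof -
    have "I 0 x = (\<integral>\<^sup>+y. (\<Sum>s\<in>T. ennreal (pmf q s) * (?\<phi> y * indicator {x \<otimes> s} y)) \<partial>count_space C)"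
      unfolding I_def ret_kernel.simps avg_def
      by (intro nn_integral_cong, simp only: sum_distrib_right, intro sum.cong refl) (auto simp: indicator_def)
    also have "\<dots> = (\<Sum>s\<in>T. ennreal (pmf q s) * (\<integral>\<^sup>+y. ?\<phi> y * indicator {x \<otimes> s} y \<partial>count_space C))"
      by (subst nn_integral_sum) (auto simp: nn_integral_cmult)
    also have "\<dots> = avg ?\<phi> x"
      unfolding avg_def using that by (intro sum.cong refl arg_cong2[where f = "(*)"])
        (subst nn_integral_indicator_singleton, auto simp: one_ennreal_def[symmetric])
    finally show ?thesis .
  qed
  have IS: "I (Suc n) x = avg (\<lambda>u. if A u then 0 else I n u) x" for n x
  proof -
    have "I (Suc n) x = (\<integral>\<^sup>+y. (\<Sum>s\<in>T. ennreal (pmf q s) * ((if A (x \<otimes> s) then 0 else ret_kernel n A (x \<otimes> s) y) * ?\<phi> y)) \<partial>count_space C)"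
      unfolding I_def ret_kernel.simps avg_def by (intro nn_integral_cong) (simp add: sum_distrib_right mult.assoc)
    also have "\<dots> = (\<Sum>s\<in>T. ennreal (pmf q s) * (\<integral>\<^sup>+y. (if A (x \<otimes> s) then 0 else ret_kernel n A (x \<otimes> s) y) * ?\<phi> y \<partial>count_space C))"
      by (subst nn_integral_sum) (auto simp: nn_integral_cmult)
    also have "\<dots> = avg (\<lambda>u. if A u then 0 else I n u) x"
      unfolding avg_def I_def by (intro sum.cong refl) auto
    finally show ?thesis .
  qed
  have "hit z A \<psi> (Suc t) x = z * avg (\<lambda>y. ?\<phi> y + (\<Sum>n<t. z ^ Suc n * (if A y then 0 else I n y))) x"
    unfolding hit.simps using Suc by (intro arg_cong2[where f = "(*)"] refl avg_cong) (auto simp: I_def)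
  also have "\<dots> = z * (avg ?\<phi> x + (\<Sum>n<t. z ^ Suc n * avg (\<lambda>y. if A y then 0 else I n y) x))"
  proof -
    have "avg (\<lambda>y. \<Sum>n<k. f n y) x = (\<Sum>n<k. avg (f n) x)" for f and k :: nat
      by (induction k) (simp_all add: avg_add)
    then show ?thesis by (simp add: avg_add avg_cmult)
  qed
  also have "\<dots> = z ^ Suc 0 * I 0 x + (\<Sum>n<t. z ^ Suc (Suc n) * I (Suc n) x)"
    using Suc.prems by (simp add: I0 IS distrib_left sum_distrib_left mult_ac)
  also have "\<dots> = (\<Sum>n<Suc t. z ^ Suc n * I n x)"
    by (simp only: sum.lessThan_Suc_shift)
  finally show ?case by (simp only: I_def)
qed simp

text \<open>The definition peels off the first step; peeling off the last one instead, by the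
  symmetry of \<open>q\<close>, is what the reversal of paths in \<open>ret_kernel_sym\<close>
  needs.\<close>

lemma ret_kernel_back:
  "x \<in> C \<Longrightarrow> y \<in> C \<Longrightarrow> ret_kernel (Suc n) A x y = (\<Sum>s\<in>T. ennreal (pmf q s) * (if A (y \<otimes> s) then 0 else ret_kernel n A x (y \<otimes> s)))"
proof (induction n arbitrary: x)
  case 0
  have e: "x \<otimes> s \<otimes> t = y \<longleftrightarrow> x \<otimes> s = y \<otimes> inv t" if "s \<in> T" "t \<in> T" for s t
    using 0 that by (metis T_C inv_solve_right m_closed)
  have "ret_kernel (Suc 0) A x y = (\<Sum>s\<in>T. \<Sum>t\<in>T. ennreal (pmf q s) * (ennreal (pmf q t) * (if x \<otimes> s \<otimes> t = y \<and> \<not> A (x \<otimes> s) then 1 else 0)))"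
    unfolding ret_kernel.simps avg_def
  proof (intro sum.cong refl)
    fix s
    show "ennreal (pmf q s) * (if A (x \<otimes> s) then 0 else \<Sum>t\<in>T. ennreal (pmf q t) * indicator {y} (x \<otimes> s \<otimes> t)) =
        (\<Sum>t\<in>T. ennreal (pmf q s) * (ennreal (pmf q t) * (if x \<otimes> s \<otimes> t = y \<and> \<not> A (x \<otimes> s) then 1 else 0)))"
      by (cases "A (x \<otimes> s)", simp, simp only: if_False sum_distrib_left, intro sum.cong) auto
  qed
  also have "\<dots> = (\<Sum>t\<in>T. \<Sum>s\<in>T. ennreal (pmf q s) * (ennreal (pmf q t) * (if x \<otimes> s = y \<otimes> inv t \<and> \<not> A (y \<otimes> inv t) then 1 else 0)))"
    by (subst sum.swap) (intro sum.cong refl, use e in auto)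
  also have "\<dots> = (\<Sum>t\<in>T. ennreal (pmf q (inv t)) * (if A (y \<otimes> inv t) then 0 else ret_kernel 0 A x (y \<otimes> inv t)))"
    unfolding ret_kernel.simps avg_def
  proof (intro sum.cong refl)
    fix t assume "t \<in> T"
    then show "(\<Sum>s\<in>T. ennreal (pmf q s) * (ennreal (pmf q t) * (if x \<otimes> s = y \<otimes> inv t \<and> \<not> A (y \<otimes> inv t) then 1 else 0))) =
        ennreal (pmf q (inv t)) * (if A (y \<otimes> inv t) then 0 else \<Sum>s\<in>T. ennreal (pmf q s) * indicator {y \<otimes> inv t} (x \<otimes> s))"
      by (cases "A (y \<otimes> inv t)", simp, simp only: if_False sum_distrib_left, intro sum.cong) (auto simp: p_sym mult_ac)
  qed
  also have "\<dots> = (\<Sum>t\<in>T. ennreal (pmf q t) * (if A (y \<otimes> t) then 0 else ret_kernel 0 A x (y \<otimes> t)))"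
    by (rule sum_T_inv[symmetric])
  finally show ?case .
next
  case (Suc n)
  have "ret_kernel (Suc (Suc n)) A x y = (\<Sum>s\<in>T. ennreal (pmf q s) * (if A (x \<otimes> s) then 0 else ret_kernel (Suc n) A (x \<otimes> s) y))"
    by (subst ret_kernel.simps(2)) (simp only: avg_def)
  also have "\<dots> = (\<Sum>s\<in>T. \<Sum>t\<in>T. ennreal (pmf q s) * (if A (x \<otimes> s) then 0 else ennreal (pmf q t) * (if A (y \<otimes> t) then 0 else ret_kernel n A (x \<otimes> s) (y \<otimes> t))))"
    using Suc by (intro sum.cong refl) (auto simp: sum_distrib_left simp del: ret_kernel.simps)
  also have "\<dots> = (\<Sum>t\<in>T. ennreal (pmf q t) * (if A (y \<otimes> t) then 0 else (\<Sum>s\<in>T. ennreal (pmf q s) * (if A (x \<otimes> s) then 0 else ret_kernel n A (x \<otimes> s) (y \<otimes> t)))))"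
    by (subst sum.swap) (intro sum.cong refl, auto simp: sum_distrib_left mult_ac intro!: sum.cong sum.neutral)
  also have "\<dots> = (\<Sum>t\<in>T. ennreal (pmf q t) * (if A (y \<otimes> t) then 0 else ret_kernel (Suc n) A x (y \<otimes> t)))"
    by (simp only: ret_kernel.simps avg_def)
  finally show ?case .
qed

lemma ret_kernel_sym: "x \<in> C \<Longrightarrow> y \<in> C \<Longrightarrow> ret_kernel n A x y = ret_kernel n A y x"
proof (induction n arbitrary: x y)
  case 0
  have "x \<otimes> s = y \<longleftrightarrow> x = y \<otimes> inv s" if "s \<in> T" for s
    using 0 that by (metis T_C inv_solve_right)
  then have "ret_kernel 0 A x y = (\<Sum>s\<in>T. ennreal (pmf q (inv s)) * indicator {x} (y \<otimes> inv s))"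
    unfolding ret_kernel.simps avg_def by (intro sum.cong refl) (auto simp: p_sym indicator_def)
  also have "\<dots> = ret_kernel 0 A y x"
    unfolding ret_kernel.simps avg_def by (rule sum_T_inv[symmetric])
  finally show ?case .
next
  case (Suc n)
  have "ret_kernel (Suc n) A x y = (\<Sum>s\<in>T. ennreal (pmf q s) * (if A (y \<otimes> s) then 0 else ret_kernel n A (y \<otimes> s) x))"
    using Suc by (subst ret_kernel_back) (auto intro!: sum.cong)
  then show ?case by (simp add: avg_def)
qed

lemma ret_kernel_translate:
  assumes "\<And>u. u \<in> C \<Longrightarrow> B u = A (g \<otimes> u)" "g \<in> C"
  shows "x \<in> C \<Longrightarrow> y \<in> C \<Longrightarrow> ret_kernel n B x y = ret_kernel n A (g \<otimes> x) (g \<otimes> y)"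
proof (induction n arbitrary: x)
  case 0
  then show ?case using assms
    by (auto simp: avg_def indicator_def m_assoc intro!: sum.cong)
next
  case (Suc n)
  then show ?case using assms by (auto simp: avg_def m_assoc intro!: sum.cong)
qed

definition visited :: "('a \<Rightarrow> ennreal) \<Rightarrow> 'a \<Rightarrow> bool" where "visited f y \<longleftrightarrow> f y \<noteq> 0"

lemma shift_shift: "y \<in> C \<Longrightarrow> z \<in> C \<Longrightarrow> shift z (shift y f) = shift (y \<otimes> z) f"
  by (auto simp: shift_def m_assoc)

lemma occ_off: "y \<notin> C \<Longrightarrow> occ x y = 0"
proof -
  assume "y \<notin> C"
  then have "mass x (indicator {y}) = mass x (\<lambda>_. 0)" by (intro mass_cong) (auto simp: indicator_def)
  also have "\<dots> = 0" by (simp add: mass_def edges_def)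
  finally show ?thesis by (simp add: occ_def)
qed

lemma shift_one_occ [simp]: "shift \<one> (occ x) = occ x"
  by (auto simp: shift_def occ_off)

lemma shift_inv_occ: "y \<in> C \<Longrightarrow> shift (inv y) (shift y (occ x)) = occ x"
  by (simp add: shift_shift)

lemma edges_count:
  "edges \<omega> g = (\<integral>\<^sup>+y. edges \<omega> (indicator {y}) * g y \<partial>count_space C)"
proof -
  have pt: "g p = (\<integral>\<^sup>+y. indicator {y} p * g y \<partial>count_space C)" if "p \<in> C" for p
  proof -
    have "(\<integral>\<^sup>+y. indicator {y} p * g y \<partial>count_space C) = (\<integral>\<^sup>+y. g y * indicator {p} y \<partial>count_space C)"
      by (intro nn_integral_cong) (auto simp: indicator_def)
    also have "\<dots> = g p * emeasure (count_space C) {p}"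
      using that by (subst nn_integral_indicator_singleton) auto
    finally show ?thesis using that by (simp add: one_ennreal_def[symmetric])
  qed
  let ?i = "\<lambda>l. indicator {\<omega>. tree l \<omega>} \<omega> :: ennreal"
  have "edges \<omega> g = (\<integral>\<^sup>+y. indicator {y} \<one> * g y \<partial>count_space C) +
     (\<integral>\<^sup>+l. (\<integral>\<^sup>+y. ?i l * (indicator {y} (site (butlast l) \<omega>) + indicator {y} (site l \<omega>)) * g y \<partial>count_space C) \<partial>count_space {l. l \<noteq> []})"
  proof -
    have "?i l * (g (site (butlast l) \<omega>) + g (site l \<omega>)) = (\<integral>\<^sup>+y. ?i l * (indicator {y} (site (butlast l) \<omega>) + indicator {y} (site l \<omega>)) * g y \<partial>count_space C)" for l
      by (subst (1 2) pt) (simp_all add: nn_integral_add[symmetric] nn_integral_cmult[symmetric] distrib_left distrib_right mult_ac)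
    then show ?thesis unfolding edges_def using pt[of "\<one>"] by simp
  qed
  also have "\<dots> = (\<integral>\<^sup>+y. indicator {y} \<one> * g y \<partial>count_space C) +
     (\<integral>\<^sup>+y. (\<integral>\<^sup>+l. ?i l * (indicator {y} (site (butlast l) \<omega>) + indicator {y} (site l \<omega>)) * g y \<partial>count_space {l. l \<noteq> []}) \<partial>count_space C)"
    by (subst nn_integral_count_space_nn_integral) (auto simp: countable_C)
  also have "\<dots> = (\<integral>\<^sup>+y. edges \<omega> (indicator {y}) * g y \<partial>count_space C)"
    unfolding edges_def by (subst nn_integral_add[symmetric]) (auto simp: distrib_right nn_integral_multc intro!: nn_integral_cong)
  finally show ?thesis .
qed

text \<open>\<open>mass\<close> depends on the two-sided tree only through \<open>occ\<close>, so
  mass transport becomes a statement about the field.\<close>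

lemma mass_occ: "mass x g = (\<integral>\<^sup>+y. occ x y * g y \<partial>count_space C)"
proof -
  let ?s = "inc (fst x)"
  have "edges (fst x) (\<lambda>y. g (?s \<otimes> y)) = (\<integral>\<^sup>+y. edges (fst x) (indicator {y}) * g (?s \<otimes> y) \<partial>count_space C)"
    by (rule edges_count)
  also have "\<dots> = (\<integral>\<^sup>+y. edges (fst x) (indicator {inv ?s \<otimes> (?s \<otimes> y)}) * g (?s \<otimes> y) \<partial>count_space C)"
    by (intro nn_integral_cong) (simp add: m_assoc[symmetric])
  also have "\<dots> = (\<integral>\<^sup>+y. edges (fst x) (indicator {inv ?s \<otimes> y}) * g y \<partial>count_space C)"
  proof (rule nn_integral_bij_count_space)
    show "bij_betw ((\<otimes>) ?s) C C"
      by (rule bij_betw_byWitness[where f' = "(\<otimes>) (inv ?s)"]) (auto simp: m_assoc[symmetric])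
  qed
  also have "\<dots> = (\<integral>\<^sup>+y. edges (fst x) (\<lambda>z. indicator {y} (?s \<otimes> z)) * g y \<partial>count_space C)"
  proof (intro nn_integral_cong arg_cong2[where f = "(*)"] edges_cong refl)
    fix y z assume "y \<in> space (count_space C)" "z \<in> C"
    then have "z = inv ?s \<otimes> y \<longleftrightarrow> ?s \<otimes> z = y" by (auto simp: inv_solve_left)
    then show "indicator {inv ?s \<otimes> y} z = (indicator {y} (?s \<otimes> z) :: ennreal)" by (simp add: indicator_def)
  qed
  finally have "mass x g = (\<integral>\<^sup>+y. edges (snd x) (indicator {y}) * g y \<partial>count_space C)
      + (\<integral>\<^sup>+y. edges (fst x) (\<lambda>z. indicator {y} (?s \<otimes> z)) * g y \<partial>count_space C)"
    unfolding mass_def by (subst edges_count) simp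
  then show ?thesis
    by (simp add: nn_integral_add[symmetric] distrib_right[symmetric] occ_def mass_def)
qed

lemma nn_integral_mass:
  "(\<integral>\<^sup>+x. mass x g \<partial>M2) = ennreal (1 + m) * ((\<Sum>n. ennreal m ^ n * (avg ^^ n) g \<one>) + (\<Sum>n. ennreal m ^ n * (avg ^^ Suc n) g \<one>))"
proof -
  have 1: "(\<integral>\<^sup>+x. edges (snd x) g \<partial>M2) = (\<integral>\<^sup>+\<omega>. edges \<omega> g \<partial>N)"
    by (subst N.nn_integral_fst[symmetric]) (auto simp: N.emeasure_space_1[simplified])
  have m: "(\<lambda>\<omega>. edges \<omega> (\<lambda>y. g (inc \<omega> \<otimes> y))) \<in> borel_measurable N"
    by (rule measurable_fun_step_root[where g = "\<lambda>s \<omega>. edges \<omega> (\<lambda>y. g (s \<otimes> y))"]) auto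
  have m2: "(\<lambda>x. edges (fst x) (\<lambda>y. g (inc (fst x) \<otimes> y))) \<in> borel_measurable M2"
    by (rule measurable_compose[OF measurable_fst m])
  have "(\<integral>\<^sup>+x. edges (fst x) (\<lambda>y. g (inc (fst x) \<otimes> y)) \<partial>M2) = (\<integral>\<^sup>+\<omega>. edges \<omega> (\<lambda>y. g (inc \<omega> \<otimes> y)) \<partial>N)"
    using m2 by (subst N.nn_integral_fst[symmetric]) (auto simp: N.emeasure_space_1[simplified])
  also have "\<dots> = (\<Sum>s\<in>T. ennreal (pmf q s) * (\<integral>\<^sup>+\<omega>. edges \<omega> (\<lambda>y. g (s \<otimes> y)) \<partial>N))"
    by (rule nn_integral_inc[where g = "\<lambda>s \<omega>. edges \<omega> (\<lambda>y. g (s \<otimes> y))"]) auto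
  also have "\<dots> = (\<Sum>s\<in>T. ennreal (pmf q s) * (ennreal (1 + m) * (\<Sum>n. ennreal m ^ n * (avg ^^ n) g s)))"
    by (simp add: edges_expect stpn_translate)
  also have "\<dots> = ennreal (1 + m) * (\<Sum>s\<in>T. (\<Sum>n. ennreal m ^ n * (ennreal (pmf q s) * (avg ^^ n) g s)))"
    by (simp add: sum_distrib_left mult_ac flip: ennreal_suminf_cmult)
  also have "\<dots> = ennreal (1 + m) * (\<Sum>n. ennreal m ^ n * (avg ^^ Suc n) g \<one>)"
    by (simp add: avg_def sum_distrib_left flip: suminf_sum)
  finally have 2: "(\<integral>\<^sup>+x. edges (fst x) (\<lambda>y. g (inc (fst x) \<otimes> y)) \<partial>M2) = ennreal (1 + m) * (\<Sum>n. ennreal m ^ n * (avg ^^ Suc n) g \<one>)" .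
  have "(\<integral>\<^sup>+x. mass x g \<partial>M2) = (\<integral>\<^sup>+x. edges (snd x) g \<partial>M2) + (\<integral>\<^sup>+x. edges (fst x) (\<lambda>y. g (inc (fst x) \<otimes> y)) \<partial>M2)"
    unfolding mass_def using m2 by (intro nn_integral_add) auto
  then show ?thesis unfolding 1 2 edges_expect by (simp add: distrib_left)
qed

lemma stpn_indicator: "y \<in> C \<Longrightarrow> (avg ^^ n) (indicator {y}) \<one> = heat n y"
proof -
  assume y: "y \<in> C"
  have "(avg ^^ n) (indicator {y}) \<one> = (avg ^^ n) (\<lambda>u. indicator {\<one>} (inv y \<otimes> u)) \<one>"
  proof (rule stpn_cong)
    fix u assume "u \<in> C"
    then have "u = y \<longleftrightarrow> inv y \<otimes> u = \<one>" using y by (metis inv_solve_left' one_closed r_one)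
    then show "indicator {y} u = (indicator {\<one>} (inv y \<otimes> u) :: ennreal)" by (simp add: indicator_def)
  qed simp
  also have "\<dots> = heat n (inv y)" using y by (simp add: stpn_translate heat_def)
  finally show ?thesis using y by (simp add: heat_inv)
qed

lemma occ_expect:
  "y \<in> C \<Longrightarrow> (\<integral>\<^sup>+x. occ x y \<partial>M2) = ennreal (1 + m) * ((\<Sum>n. ennreal m ^ n * heat n y) + (\<Sum>n. ennreal m ^ n * heat (Suc n) y))"
  unfolding occ_def nn_integral_mass by (simp add: stpn_indicator del: funpow.simps)

lemma m_ge1: "1 \<le> ennreal m" using m_gt by (simp add: ennreal_1[symmetric] del: ennreal_1)

lemma suminf_heat_Suc_le: "(\<Sum>n. ennreal m ^ n * heat (Suc n) y) \<le> green (ennreal m) y"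
proof -
  have "(\<Sum>n. ennreal m ^ n * heat (Suc n) y) \<le> (\<Sum>n. ennreal m ^ Suc n * heat (Suc n) y)"
    using m_ge1 by (intro suminf_le mult_right_mono) (auto intro: mult_right_mono[of 1 "ennreal m", simplified])
  also have "\<dots> \<le> green (ennreal m) y"
    unfolding green_def by (subst (2) suminf_head_ennreal) simp
  finally show ?thesis .
qed

text \<open>Finiteness spreads along generators: the Green equation at \<open>x\<close> bounds
  \<open>q(s) G(x s)\<close> by \<open>G(x)\<close>.\<close>

lemma green_m_finite: "y \<in> C \<Longrightarrow> green (ennreal m) y < \<infinity>"
proof (induction y rule: C_induct)
  case one show ?case using Gm_finite by (simp add: Gm_def)
next
  case (step x s)
  have sT: "s \<in> T" using step by (simp add: q_supp)
  have "ennreal (pmf q s) * green (ennreal m) (x \<otimes> s) \<le> avg (green (ennreal m)) x"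
    using sT member_le_sum[of s T "\<lambda>s. ennreal (pmf q s) * green (ennreal m) (x \<otimes> s)"] by (simp add: avg_def)
  also have "\<dots> \<le> ennreal m * avg (green (ennreal m)) x" using mult_right_mono[OF m_ge1] by fastforce
  also have "\<dots> \<le> green (ennreal m) x" by (subst green_unfold) simp
  finally have "ennreal (pmf q s) * green (ennreal m) (x \<otimes> s) < \<infinity>" using step by (simp add: le_less_trans)
  then show ?case using pmf_T_pos[OF sT] by (auto simp: ennreal_mult_less_top)
qed

text \<open>Needed wherever the weight \<open>occ\<close> is cancelled against its inverse.\<close>

lemma AE_occ_finite: "AE x in M2. \<forall>y\<in>C. occ x y < \<infinity>"
proof (subst AE_ball_countable[OF countable_C], intro ballI)
  fix y assume y: "y \<in> C"
  have "(\<integral>\<^sup>+x. occ x y \<partial>M2) \<le> ennreal (1 + m) * (green (ennreal m) y + green (ennreal m) y)"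
    unfolding occ_expect[OF y] using suminf_heat_Suc_le[of y]
    by (intro mult_left_mono add_mono) (auto simp: green_def)
  also have "\<dots> < \<infinity>" using green_m_finite[OF y] by (simp add: ennreal_mult_less_top)
  finally have "AE x in M2. occ x y \<noteq> \<infinity>" by (intro nn_integral_PInf_AE) auto
  then show "AE x in M2. occ x y < \<infinity>" by (simp add: less_top)
qed

end

text \<open>A ratio \<open>\<rho> = b 1 / b 0 > 1\<close> would be squared at each doubling, so that
  \<open>b (2^j)\<close>, at least \<open>b 0\<close> times \<open>\<rho>^(2^j)\<close>, would
  exceed any bound. Applied to squared norms of iterates, this stands in for the spectral theorem,
  for an operator not yet known to be bounded.\<close>

lemma doubling_bound:
  fixes b :: "nat \<Rightarrow> real"
  assumes nn: "\<And>k. 0 \<le> b k" and cs: "\<And>k. (b k)\<^sup>2 \<le> b 0 * b (2 * k)" and bd: "\<And>k. b k \<le> K"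
  shows "b 1 \<le> b 0"
proof (rule ccontr)
  assume "\<not> b 1 \<le> b 0"
  then have gt: "b 0 < b 1" by simp
  have b0: "0 < b 0"
  proof (rule ccontr)
    assume "\<not> 0 < b 0"
    then have "b 0 = 0" using nn[of 0] by simp
    then have "(b 1)\<^sup>2 \<le> 0" using cs[of 1] by simp
    then show False using gt nn[of 0] by simp
  qed
  define \<rho> where "\<rho> = b 1 / b 0"
  have \<rho>: "1 < \<rho>" using gt b0 by (simp add: \<rho>_def)
  have ge: "b 0 * \<rho> ^ (2 ^ j) \<le> b (2 ^ j)" for j
  proof (induction j)
    case 0 show ?case using b0 by (simp add: \<rho>_def)
  next
    case (Suc j)
    have "(b 0 * \<rho> ^ (2 ^ j))\<^sup>2 \<le> (b (2 ^ j))\<^sup>2" using Suc b0 \<rho> by (intro power_mono) auto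
    also have "\<dots> \<le> b 0 * b (2 ^ Suc j)" using cs[of "2 ^ j"] by simp
    finally have "b 0 * (b 0 * \<rho> ^ (2 ^ Suc j)) \<le> b 0 * b (2 ^ Suc j)"
      by (simp add: power2_eq_square mult_ac power_add[symmetric] mult_2)
    then show ?case using b0 by simp
  qed
  obtain n where n: "K / b 0 < \<rho> ^ n" using real_arch_pow[OF \<rho>] by blast
  have "\<rho> ^ n \<le> \<rho> ^ (2 ^ n)" using \<rho> by (intro power_increasing) (auto simp: less_imp_le)
  then have "K / b 0 < \<rho> ^ (2 ^ n)" using n by linarith
  then have "K < b 0 * \<rho> ^ (2 ^ n)" using b0 by (simp add: pos_divide_less_eq mult.commute)
  then show False using ge[of n] bd[of "2 ^ n"] by linarith
qed

context brw begin

section \<open>Linearity, scaling and measurability of truncated return sums\<close>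

lemma hit_mono: "x \<in> C \<Longrightarrow> (\<And>y. y \<in> C \<Longrightarrow> \<psi> y \<le> \<phi> y) \<Longrightarrow> hit z A \<psi> t x \<le> hit z A \<phi> t x"
proof (induction t arbitrary: x)
  case (Suc t)
  then show ?case by (auto intro!: mult_left_mono avg_mono)
qed simp

lemma hit_cong:
  assumes "\<And>y. y \<in> C \<Longrightarrow> \<psi> y = \<phi> y" "\<And>y. y \<in> C \<Longrightarrow> A y = B y"
  shows "x \<in> C \<Longrightarrow> hit z A \<psi> t x = hit z B \<phi> t x"
proof (induction t arbitrary: x)
  case (Suc t)
  then show ?case using assms by (auto intro!: arg_cong2[where f = "(*)"] avg_cong)
qed simp

lemma hit_add: "x \<in> C \<Longrightarrow> hit z A (\<lambda>y. \<psi> y + \<phi> y) t x = hit z A \<psi> t x + hit z A \<phi> t x"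
proof (induction t arbitrary: x)
  case (Suc t)
  have "avg (\<lambda>y. if A y then \<psi> y + \<phi> y else hit z A (\<lambda>y. \<psi> y + \<phi> y) t y) x
    = avg (\<lambda>y. (if A y then \<psi> y else hit z A \<psi> t y) + (if A y then \<phi> y else hit z A \<phi> t y)) x"
    using Suc by (intro avg_cong) auto
  then show ?case by (simp add: avg_add distrib_left)
qed simp

lemma hit_mono_t: "x \<in> C \<Longrightarrow> hit z A \<psi> t x \<le> hit z A \<psi> (Suc t) x"
proof (induction t arbitrary: x)
  case (Suc t)
  show ?case by (subst (1 2) hit.simps(2)) (intro mult_left_mono avg_mono, use Suc in \<open>auto simp del: hit.simps\<close>)
qed simp

text \<open>A return within \<open>t\<close> steps carries a power of \<open>z\<close> with exponent
  at most \<open>t\<close>, so lowering the weight by \<open>r\<close> costs at most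
  \<open>r^t\<close>. This is the reason for keeping the cut-off \<open>t\<close>.\<close>

lemma hit_scale:
  fixes r :: ennreal
  assumes r: "0 \<le> r" "r \<le> 1"
  shows "x \<in> C \<Longrightarrow> r ^ t * hit z A \<psi> t x \<le> hit (r * z) A \<psi> t x"
proof (induction t arbitrary: x)
  case (Suc t)
  have "r ^ t * (if A y then \<psi> y else hit z A \<psi> t y) \<le> (if A y then \<psi> y else hit (r * z) A \<psi> t y)" if "y \<in> C" for y
    using Suc.IH[OF that] r mult_right_mono[of "r ^ t" 1 "\<psi> y"] by (auto simp: power_le_one)
  then have "r * z * avg (\<lambda>y. r ^ t * (if A y then \<psi> y else hit z A \<psi> t y)) x
      \<le> r * z * avg (\<lambda>y. if A y then \<psi> y else hit (r * z) A \<psi> t y) x"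
    using Suc.prems by (intro mult_left_mono avg_mono) auto
  then show ?case by (simp add: avg_cmult mult_ac)
qed simp

lemma measurable_avg:
  assumes "\<And>u. u \<in> C \<Longrightarrow> (\<lambda>w. h w u) \<in> borel_measurable M" "x \<in> C"
  shows "(\<lambda>w. avg (h w) x) \<in> borel_measurable M"
  unfolding avg_def using assms by (intro borel_measurable_sum borel_measurable_times_ennreal) auto

lemma measurable_stpn:
  assumes "\<And>u. u \<in> C \<Longrightarrow> (\<lambda>w. h w u) \<in> borel_measurable M"
  shows "x \<in> C \<Longrightarrow> (\<lambda>w. (avg ^^ n) (h w) x) \<in> borel_measurable M"
  by (induction n arbitrary: x) (auto intro!: measurable_avg assms)

lemma nn_integral_avg:
  assumes "\<And>u. u \<in> C \<Longrightarrow> (\<lambda>w. h w u) \<in> borel_measurable M" "x \<in> C"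
  shows "(\<integral>\<^sup>+w. avg (h w) x \<partial>M) = avg (\<lambda>u. \<integral>\<^sup>+w. h w u \<partial>M) x"
proof -
  have m: "(\<lambda>w. h w (x \<otimes> s)) \<in> borel_measurable M" if "s \<in> T" for s
    using that assms by auto
  show ?thesis unfolding avg_def using m by (subst nn_integral_sum) (auto simp: nn_integral_cmult)
qed

lemma nn_integral_stpn:
  assumes "\<And>u. u \<in> C \<Longrightarrow> (\<lambda>w. h w u) \<in> borel_measurable M"
  shows "x \<in> C \<Longrightarrow> (\<integral>\<^sup>+w. (avg ^^ n) (h w) x \<partial>M) = (avg ^^ n) (\<lambda>u. \<integral>\<^sup>+w. h w u \<partial>M) x"
proof (induction n arbitrary: x)
  case (Suc n)
  have "(\<integral>\<^sup>+w. (avg ^^ Suc n) (h w) x \<partial>M) = avg (\<lambda>u. \<integral>\<^sup>+w. (avg ^^ n) (h w) u \<partial>M) x"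
    using Suc.prems by (simp, intro nn_integral_avg measurable_stpn assms)
  also have "\<dots> = avg ((avg ^^ n) (\<lambda>u. \<integral>\<^sup>+w. h w u \<partial>M)) x"
    using Suc by (intro avg_cong) auto
  finally show ?case by simp
qed simp

lemma measurable_hit:
  assumes a: "\<And>u. u \<in> C \<Longrightarrow> Measurable.pred M (\<lambda>w. a w u)" and p: "\<And>u. u \<in> C \<Longrightarrow> (\<lambda>w. \<psi> w u) \<in> borel_measurable M"
  shows "x \<in> C \<Longrightarrow> (\<lambda>w. hit z (a w) (\<psi> w) t x) \<in> borel_measurable M"
proof (induction t arbitrary: x)
  case (Suc t)
  have "(\<lambda>w. if a w u then \<psi> w u else hit z (a w) (\<psi> w) t u) \<in> borel_measurable M" if "u \<in> C" for u
    using a[OF that] p[OF that] Suc.IH[OF that] by (intro measurable_If) (auto simp: pred_def)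
  then show ?case unfolding hit.simps using Suc.prems
    by (intro borel_measurable_times_ennreal borel_measurable_const measurable_avg)
qed simp

lemma measurable_ret_kernel:
  assumes a: "\<And>u. u \<in> C \<Longrightarrow> Measurable.pred M (\<lambda>w. a w u)"
  shows "x \<in> C \<Longrightarrow> (\<lambda>w. ret_kernel n (a w) x y) \<in> borel_measurable M"
proof (induction n arbitrary: x)
  case (Suc n)
  have "(\<lambda>w. if a w u then 0 else ret_kernel n (a w) u y) \<in> borel_measurable M" if "u \<in> C" for u
    using a[OF that] Suc.IH[OF that] by (intro measurable_If) (auto simp: pred_def)
  then show ?case unfolding ret_kernel.simps using Suc.prems by (intro measurable_avg)
qed simp

text \<open>The return operator \<open>Q\<close> with return times cut off at \<open>t\<close>,
  acting on functions of the field seen from the current vertex: upon a return to \<open>y\<close>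
  the field is re-centred there.\<close>

definition Ret where "Ret z t \<psi> f = hit z (visited f) (\<lambda>y. \<psi> (shift y f)) t \<one>"
text \<open>Measurability is asked only along translates of \<open>occ\<close>, since the space of
  fields on which \<open>\<psi>\<close> is defined carries no sigma-algebra.\<close>

definition meas_field :: "(('a \<Rightarrow> ennreal) \<Rightarrow> ennreal) \<Rightarrow> bool" where
  "meas_field \<psi> \<longleftrightarrow> (\<forall>y\<in>C. (\<lambda>x. \<psi> (shift y (occ x))) \<in> borel_measurable M2)"
definition Mw where "Mw = density M2 (\<lambda>x. inverse (occ x \<one>))"
definition ip where "ip \<phi> \<psi> = (\<integral>\<^sup>+x. \<phi> (occ x) * \<psi> (occ x) \<partial>Mw)"

lemma sets_Mw [simp, measurable_cong]: "sets Mw = sets M2" by (simp add: Mw_def)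
lemma meas_field_occ: "meas_field \<psi> \<Longrightarrow> (\<lambda>x. \<psi> (occ x)) \<in> borel_measurable M2"
  unfolding meas_field_def by (drule bspec[of _ _ "\<one>"]) auto
lemma meas_field_one [simp]: "meas_field (\<lambda>_. 1)" by (simp add: meas_field_def)

lemma measurable_visited: "y \<in> C \<Longrightarrow> u \<in> C \<Longrightarrow> Measurable.pred M2 (\<lambda>x. visited (shift y (occ x)) u)"
  by (simp add: visited_def shift_def)

lemma meas_field_Ret: assumes "meas_field \<psi>" shows "meas_field (Ret z t \<psi>)"
  unfolding meas_field_def Ret_def
proof (intro ballI measurable_hit measurable_visited)
  fix y u assume "y \<in> C" "u \<in> C"
  then show "(\<lambda>x. \<psi> (shift u (shift y (occ x)))) \<in> borel_measurable M2"
    using assms by (simp add: shift_shift meas_field_def)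
qed auto

lemma occ_one_ge: "1 \<le> occ x \<one>"
  unfolding occ_def mass_def edges_def by (simp add: add_increasing2)

lemma nn_integral_Mw:
  "h \<in> borel_measurable M2 \<Longrightarrow> (\<integral>\<^sup>+x. h x \<partial>Mw) = (\<integral>\<^sup>+x. inverse (occ x \<one>) * h x \<partial>M2)"
  unfolding Mw_def by (rule nn_integral_density) auto

lemma nn_integral_Mw_le: "h \<in> borel_measurable M2 \<Longrightarrow> (\<integral>\<^sup>+x. h x \<partial>Mw) \<le> (\<integral>\<^sup>+x. h x \<partial>M2)"
proof -
  assume h: "h \<in> borel_measurable M2"
  have "inverse (occ x \<one>) * h x \<le> h x" for x
  proof -
    have "inverse (occ x \<one>) \<le> 1" using occ_one_ge[of x]
      by (cases "occ x \<one>") (auto simp: inverse_ennreal inverse_le_1_iff)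
    then show ?thesis using mult_right_mono[of "inverse (occ x \<one>)" 1 "h x"] by simp
  qed
  then show ?thesis unfolding nn_integral_Mw[OF h] by (intro nn_integral_mono)
qed

lemma ip_commute: "ip \<phi> \<psi> = ip \<psi> \<phi>" by (simp add: ip_def mult.commute)

lemma ip_mono: "(\<And>x. \<phi> (occ x) \<le> \<phi>' (occ x)) \<Longrightarrow> (\<And>x. \<psi> (occ x) \<le> \<psi>' (occ x)) \<Longrightarrow> ip \<phi> \<psi> \<le> ip \<phi>' \<psi>'"
  unfolding ip_def by (intro nn_integral_mono mult_mono) auto

lemma ip_cs: "meas_field \<phi> \<Longrightarrow> meas_field \<psi> \<Longrightarrow> (ip \<phi> \<psi>)\<^sup>2 \<le> ip \<phi> \<phi> * ip \<psi> \<psi>"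
  unfolding ip_def using Cauchy_Schwarz_nn_integral[of "\<lambda>x. \<phi> (occ x)" Mw "\<lambda>x. \<psi> (occ x)"] meas_field_occ
  by (simp add: power2_eq_square cong: measurable_cong_sets)

text \<open>The mass sent from the origin to \<open>y\<close> by a return of \<open>n + 1\<close>
  steps. The inverse of \<open>f\<close> at the origin is the weight of \<open>Mw\<close>; the
  inverse at \<open>y\<close> cancels the multiplicity with which \<open>mass\<close> counts
  \<open>y\<close>, and makes the expression symmetric.\<close>

definition flow where
  "flow n \<phi> \<psi> f y = \<phi> f * inverse (f \<one>) * ret_kernel n (visited f) \<one> y * \<psi> (shift y f) * inverse (f y)"

lemma flow_swap: "y \<in> C \<Longrightarrow> flow n \<phi> \<psi> (shift y (occ x)) (inv y) = flow n \<psi> \<phi> (occ x) y"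
proof -
  assume y: "y \<in> C"
  have "ret_kernel n (visited (shift y (occ x))) \<one> (inv y) = ret_kernel n (visited (occ x)) (y \<otimes> \<one>) (y \<otimes> inv y)"
    by (rule ret_kernel_translate) (use y in \<open>auto simp: visited_def shift_def\<close>)
  also have "\<dots> = ret_kernel n (visited (occ x)) \<one> y" using y by (simp add: ret_kernel_sym)
  finally have k: "ret_kernel n (visited (shift y (occ x))) \<one> (inv y) = ret_kernel n (visited (occ x)) \<one> y" .
  have "shift y (occ x) \<one> = occ x y" "shift y (occ x) (inv y) = occ x \<one>" using y by (simp_all add: shift_def)
  then show ?thesis unfolding flow_def k using y by (simp add: shift_inv_occ mult_ac)
qed

lemma measurable_flow:
  assumes "meas_field \<phi>" "meas_field \<psi>" "y \<in> C" shows "(\<lambda>x. flow n \<phi> \<psi> (occ x) y) \<in> borel_measurable M2"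
proof -
  have "(\<lambda>x. ret_kernel n (visited (occ x)) \<one> y) \<in> borel_measurable M2"
    using measurable_visited[of "\<one>"] by (intro measurable_ret_kernel) auto
  moreover have "(\<lambda>x. \<psi> (shift y (occ x))) \<in> borel_measurable M2" using assms by (simp add: meas_field_def)
  ultimately show ?thesis unfolding flow_def using meas_field_occ[OF assms(1)] by measurable
qed

lemma ip_Ret_mass:
  assumes "meas_field \<phi>" "meas_field \<psi>"
  shows "ip \<phi> (Ret z t \<psi>) = (\<Sum>n<t. z ^ Suc n * (\<integral>\<^sup>+x. mass x (flow n \<phi> \<psi> (occ x)) \<partial>M2))"
proof -
  have m: "(\<lambda>x. mass x (flow n \<phi> \<psi> (occ x))) \<in> borel_measurable M2" for n
    unfolding mass_occ
    by (intro borel_measurable_count_space_integral countable_C borel_measurable_times_ennreal measurable_occ measurable_flow assms)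
  have pt: "inverse (occ x \<one>) * (\<phi> (occ x) * Ret z t \<psi> (occ x)) = (\<Sum>n<t. z ^ Suc n * mass x (flow n \<phi> \<psi> (occ x)))"
    if fin: "\<forall>y\<in>C. occ x y < \<infinity>" for x
  proof -
    let ?f = "occ x"
    have one: "ret_kernel n (visited ?f) \<one> y * (if visited ?f y then \<psi> (shift y ?f) else 0)
        = ?f y * (ret_kernel n (visited ?f) \<one> y * \<psi> (shift y ?f) * inverse (?f y))" if y: "y \<in> C" for n y
    \<comment> \<open>At a vertex that is not visited both sides vanish, the right one because 0
      times infinity is 0 in \<open>ennreal\<close>; elsewhere the field is positive and finite and
      cancels.\<close>
    proof (cases "?f y = 0")
      case False
      then have "?f y * inverse (?f y) = 1" using fin y ennreal_divide_self[of "?f y"]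
        by (auto simp: divide_ennreal_def)
      then show ?thesis using False by (simp add: visited_def mult_ac) (simp add: mult.assoc[symmetric])
    qed (simp add: visited_def)
    have "inverse (?f \<one>) * (\<phi> ?f * Ret z t \<psi> ?f) = (\<Sum>n<t. z ^ Suc n * (\<phi> ?f * inverse (?f \<one>) *
        (\<integral>\<^sup>+y. ret_kernel n (visited ?f) \<one> y * (if visited ?f y then \<psi> (shift y ?f) else 0) \<partial>count_space C)))"
      unfolding Ret_def by (subst hit_ret_kernel) (auto simp: sum_distrib_left mult_ac intro!: sum.cong)
    also have "\<dots> = (\<Sum>n<t. z ^ Suc n * mass x (flow n \<phi> \<psi> ?f))"
    proof (intro sum.cong refl arg_cong2[where f = "(*)"])
      fix n
      have "(\<integral>\<^sup>+y. ret_kernel n (visited ?f) \<one> y * (if visited ?f y then \<psi> (shift y ?f) else 0) \<partial>count_space C)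
         = (\<integral>\<^sup>+y. ?f y * (ret_kernel n (visited ?f) \<one> y * \<psi> (shift y ?f) * inverse (?f y)) \<partial>count_space C)"
        by (intro nn_integral_cong) (use one in auto)
      then show "\<phi> ?f * inverse (?f \<one>) * (\<integral>\<^sup>+y. ret_kernel n (visited ?f) \<one> y * (if visited ?f y then \<psi> (shift y ?f) else 0) \<partial>count_space C) = mass x (flow n \<phi> \<psi> ?f)"
        unfolding mass_occ flow_def
        by (simp only:) (subst nn_integral_cmult[symmetric], simp, intro nn_integral_cong, simp add: mult_ac)
    qed
    finally show ?thesis .
  qed
  have "ip \<phi> (Ret z t \<psi>) = (\<integral>\<^sup>+x. inverse (occ x \<one>) * (\<phi> (occ x) * Ret z t \<psi> (occ x)) \<partial>M2)"
    unfolding ip_def using meas_field_occ[OF assms(1)] meas_field_occ[OF meas_field_Ret[OF assms(2)]] by (intro nn_integral_Mw) auto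
  also have "\<dots> = (\<integral>\<^sup>+x. (\<Sum>n<t. z ^ Suc n * mass x (flow n \<phi> \<psi> (occ x))) \<partial>M2)"
  proof (rule nn_integral_cong_AE)
    show "AE x in M2. inverse (occ x \<one>) * (\<phi> (occ x) * Ret z t \<psi> (occ x)) = (\<Sum>n<t. z ^ Suc n * mass x (flow n \<phi> \<psi> (occ x)))"
      using AE_occ_finite by (rule AE_mp) (rule AE_I2, rule impI, rule pt)
  qed
  also have "\<dots> = (\<Sum>n<t. z ^ Suc n * (\<integral>\<^sup>+x. mass x (flow n \<phi> \<psi> (occ x)) \<partial>M2))"
    using m by (subst nn_integral_sum) (auto simp: nn_integral_cmult)
  finally show ?thesis .
qed

text \<open>By \<open>flow_swap\<close>, the mass sent to the origin is, seen from the origin, the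
  mass sent from it with \<open>\<phi>\<close> and \<open>\<psi>\<close> exchanged; mass transport
  equates the expectations.\<close>

theorem ip_Ret_sym:
  assumes "meas_field \<phi>" "meas_field \<psi>" shows "ip \<phi> (Ret z t \<psi>) = ip (Ret z t \<phi>) \<psi>"
proof -
  have "(\<integral>\<^sup>+x. mass x (flow n \<phi> \<psi> (occ x)) \<partial>M2) = (\<integral>\<^sup>+x. mass x (flow n \<psi> \<phi> (occ x)) \<partial>M2)" for n
  proof -
    have "(\<integral>\<^sup>+x. mass x (flow n \<phi> \<psi> (occ x)) \<partial>M2) = (\<integral>\<^sup>+x. mass x (\<lambda>y. flow n \<phi> \<psi> (shift y (occ x)) (inv y)) \<partial>M2)"
      by (rule mass_transport) (use assms in \<open>auto simp: flow_swap intro!: measurable_flow\<close>)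
    also have "\<dots> = (\<integral>\<^sup>+x. mass x (flow n \<psi> \<phi> (occ x)) \<partial>M2)"
      by (intro nn_integral_cong mass_cong) (simp add: flow_swap)
    finally show ?thesis .
  qed
  then show ?thesis by (simp only: ip_Ret_mass[OF assms] ip_commute[of "Ret z t \<phi>"] ip_Ret_mass[OF assms(2,1)])
qed

lemma meas_field_Qpow: "meas_field \<phi> \<Longrightarrow> meas_field ((Ret z t ^^ k) \<phi>)"
  by (induction k) (auto intro: meas_field_Ret)

lemma ip_Qpow: "meas_field \<phi> \<Longrightarrow> meas_field \<psi> \<Longrightarrow> ip ((Ret z t ^^ k) \<phi>) \<psi> = ip \<phi> ((Ret z t ^^ k) \<psi>)"
proof (induction k arbitrary: \<psi>)
  case (Suc k)
  have "ip ((Ret z t ^^ Suc k) \<phi>) \<psi> = ip ((Ret z t ^^ k) \<phi>) (Ret z t \<psi>)"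
    using Suc.prems by (simp add: ip_Ret_sym meas_field_Qpow)
  also have "\<dots> = ip \<phi> ((Ret z t ^^ k) (Ret z t \<psi>))" using Suc by (simp add: meas_field_Ret)
  finally show ?case by (simp add: funpow_swap1)
qed simp

lemma Ret_mono: "(\<And>f. \<psi> f \<le> \<phi> f) \<Longrightarrow> Ret z t \<psi> f \<le> Ret z t \<phi> f"
  unfolding Ret_def by (intro hit_mono) auto

lemma Qpow_mono: "(\<And>f. \<psi> f \<le> \<phi> f) \<Longrightarrow> (Ret z t ^^ k) \<psi> f \<le> (Ret z t ^^ k) \<phi> f"
  by (induction k arbitrary: f) (auto intro: Ret_mono)

text \<open>The weighted expected number of times that the walk from \<open>y\<close> spends in the
  visited set, time 0 included.\<close>

definition hit_total where "hit_total z f y = (\<Sum>k. z ^ k * (avg ^^ k) (\<lambda>u. if visited f u then 1 else 0) y)"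

lemma hit_total_unfold: "hit_total z f y = (if visited f y then 1 else 0) + z * avg (hit_total z f) y"
proof -
  have "hit_total z f y = (if visited f y then 1 else 0) + (\<Sum>k. z * (z ^ k * avg ((avg ^^ k) (\<lambda>u. if visited f u then 1 else 0)) y))"
    unfolding hit_total_def by (subst suminf_head_ennreal) (simp add: mult.assoc)
  also have "(\<Sum>k. z * (z ^ k * avg ((avg ^^ k) (\<lambda>u. if visited f u then 1 else 0)) y)) = z * avg (hit_total z f) y"
    unfolding hit_total_def avg_suminf avg_cmult by simp
  finally show ?thesis .
qed

lemma hit_total_shift: "y \<in> C \<Longrightarrow> hit_total z (shift y f) \<one> = hit_total z f y"
proof -
  assume y: "y \<in> C"
  have "(avg ^^ k) (\<lambda>u. if visited (shift y f) u then 1 else 0) \<one> = (avg ^^ k) (\<lambda>u. if visited f u then 1 else 0) y" for k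
  proof -
    have "(avg ^^ k) (\<lambda>u. if visited (shift y f) u then 1 else 0) \<one> = (avg ^^ k) (\<lambda>u. (\<lambda>u. if visited f u then 1 else 0) (y \<otimes> u)) \<one>"
      by (rule stpn_cong) (auto simp: visited_def shift_def)
    also have "\<dots> = (avg ^^ k) (\<lambda>u. if visited f u then 1 else 0) y" using y by (subst stpn_translate) auto
    finally show ?thesis .
  qed
  then show ?thesis by (simp add: hit_total_def)
qed

text \<open>The \<open>n\<close>-th power counts \<open>n\<close>-th returns, and each visit is the
  \<open>n\<close>-th for exactly one \<open>n\<close>; the cut-off can only lose some. In the
  induction, \<open>hit_total\<close> serves as the supersolution.\<close>

lemma Qpow_le_hit_total: "f \<one> \<noteq> 0 \<Longrightarrow> (\<Sum>n<k. (Ret z t ^^ n) (\<lambda>_. 1) f) \<le> hit_total z f \<one>"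
proof (induction k arbitrary: f)
  case (Suc k)
  let ?u = "\<lambda>f. \<Sum>n<k. (Ret z t ^^ n) (\<lambda>_. 1) f"
  have lin: "(\<Sum>n<j. Ret z t (h n) f) = Ret z t (\<lambda>f. \<Sum>n<j. h n f) f" for h and j :: nat
  proof (induction j)
    case 0
    have "hit z A (\<lambda>_. 0) t x = 0" for A x by (induction t arbitrary: x) (simp_all add: if_distrib cong: if_cong)
    then show ?case by (simp add: Ret_def)
  qed (simp add: Ret_def hit_add)
  have "(\<Sum>n<Suc k. (Ret z t ^^ n) (\<lambda>_. 1) f) = 1 + Ret z t ?u f"
    by (subst sum.lessThan_Suc_shift) (simp add: lin)
  also have "Ret z t ?u f \<le> z * avg (hit_total z f) \<one>"
    unfolding Ret_def[of z t ?u f]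
  proof (rule hit_le_super)
    fix y assume y: "y \<in> C" "visited f y"
    then have "shift y f \<one> \<noteq> 0" by (simp add: shift_def visited_def)
    from Suc.IH[of "shift y f", OF this] show "?u (shift y f) \<le> hit_total z f y" using y by (simp add: hit_total_shift)
  next
    fix y assume "y \<in> C" "\<not> visited f y"
    then show "z * avg (hit_total z f) y \<le> hit_total z f y" by (subst hit_total_unfold) simp
  qed simp
  also have "1 + z * avg (hit_total z f) \<one> = hit_total z f \<one>" using Suc.prems by (subst hit_total_unfold) (simp add: visited_def)
  finally show ?case by (simp add: add_left_mono)
qed simp

text \<open>In a sum of indicators a nonzero term is at least 1. Through \<open>occ_ge\<close>, this
  lets \<open>occ\<close> dominate the indicator of the visited set.\<close>

lemma edges_indicator_ge: "edges \<omega> (\<lambda>z. indicator {y} (f z)) \<noteq> 0 \<Longrightarrow> 1 \<le> edges \<omega> (\<lambda>z. indicator {y} (f z))"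
proof -
  let ?g = "\<lambda>z. indicator {y} (f z) :: ennreal"
  let ?h = "\<lambda>l. indicator {\<omega>. tree l \<omega>} \<omega> * (?g (site (butlast l) \<omega>) + ?g (site l \<omega>))"
  assume nz: "edges \<omega> ?g \<noteq> 0"
  show ?thesis
  proof (cases "?g \<one> = 0")
    case True
    then have "(\<integral>\<^sup>+l. ?h l \<partial>count_space {l. l \<noteq> []}) \<noteq> 0" using nz by (simp add: edges_def)
    then obtain l where l: "l \<noteq> []" "?h l \<noteq> 0" by (auto simp: nn_integral_0_iff_AE AE_count_space)
    then have "1 \<le> ?h l" by (auto simp: indicator_def split: if_splits)
    also have "\<dots> \<le> (\<integral>\<^sup>+l. ?h l \<partial>count_space {l. l \<noteq> []})" using l by (intro nn_integral_ge_point) auto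
    finally show ?thesis by (simp add: edges_def add_increasing)
  next
    case False
    then have "?g \<one> = 1" by (auto simp: indicator_def split: if_splits)
    then show ?thesis by (simp add: edges_def add_increasing2)
  qed
qed

lemma occ_ge: "visited (occ x) y \<Longrightarrow> 1 \<le> occ x y"
  using edges_indicator_ge[of "snd x" y "\<lambda>z. z"] edges_indicator_ge[of "fst x" y "\<lambda>z. inc (fst x) \<otimes> z"]
  unfolding visited_def occ_def mass_def by (auto simp: add_increasing add_increasing2)

text \<open>Replace the visited set by \<open>occ\<close>, whose mean is given by the Green series
  at \<open>m\<close>. The power \<open>m^k\<close> is absorbed into a tail of that series at the
  identity, so the \<open>k\<close>-th term is at most a constant times \<open>r^k\<close>.\<close>

lemma hit_total_expect:
  assumes r: "0 < r" "r < 1"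
  shows "(\<integral>\<^sup>+x. hit_total (ennreal (r * m)) (occ x) \<one> \<partial>M2) < \<infinity>"
proof -
  let ?z = "ennreal (r * m)" and ?m = "ennreal m"
  have z: "?z = ennreal r * ?m" using r m_gt by (simp add: ennreal_mult)
  have "(\<integral>\<^sup>+x. hit_total ?z (occ x) \<one> \<partial>M2) \<le> (\<integral>\<^sup>+x. (\<Sum>k. ?z ^ k * (avg ^^ k) (occ x) \<one>) \<partial>M2)"
    unfolding hit_total_def using occ_ge by (intro nn_integral_mono suminf_le mult_left_mono stpn_mono) auto
  also have "\<dots> = (\<Sum>k. ?z ^ k * (avg ^^ k) (\<lambda>y. \<integral>\<^sup>+x. occ x y \<partial>M2) \<one>)"
  proof -
    have "(\<lambda>x. (avg ^^ k) (occ x) \<one>) \<in> borel_measurable M2" for k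
      by (rule measurable_stpn) auto
    then show ?thesis
      by (subst nn_integral_suminf) (simp_all add: nn_integral_cmult nn_integral_stpn[where h = occ])
  qed
  also have "\<dots> = (\<Sum>k. ?z ^ k * (ennreal (1 + m) * ((\<Sum>n. ?m ^ n * heat (k + n) \<one>) + (\<Sum>n. ?m ^ n * heat (k + Suc n) \<one>))))"
  proof -
    have "(avg ^^ k) (\<lambda>y. \<integral>\<^sup>+x. occ x y \<partial>M2) \<one> = (avg ^^ k) (\<lambda>y. ennreal (1 + m) * ((\<Sum>n. ?m ^ n * heat n y) + (\<Sum>n. ?m ^ n * heat (Suc n) y))) \<one>" for k
      by (rule stpn_cong) (simp_all add: occ_expect)
    then show ?thesis by (simp add: stpn_cmult stpn_add stpn_suminf stpn_heat)
  qed
  also have "\<dots> \<le> (\<Sum>k. ennreal r ^ k * (ennreal (1 + m) * (Gm + Gm)))"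
  proof (intro suminf_le)
    fix k
    have "?m ^ k * (\<Sum>n. ?m ^ n * heat (k + n + j) \<one>) \<le> Gm" for j
    proof -
      have "?m ^ k * (\<Sum>n. ?m ^ n * heat (k + n + j) \<one>) = (\<Sum>n. ?m ^ (k + n) * heat (k + n + j) \<one>)"
        by (simp add: power_add mult.assoc flip: ennreal_suminf_cmult)
      also have "\<dots> \<le> (\<Sum>n. ?m ^ (k + n + j) * heat (k + n + j) \<one>)"
        using m_ge1 by (intro suminf_le mult_right_mono power_increasing) auto
      also have "\<dots> \<le> Gm"
      proof -
        have "(\<Sum>n. f (k + n + j)) \<le> (\<Sum>n. f n)" for f :: "nat \<Rightarrow> ennreal"
        proof -
          have "inj (\<lambda>n. k + n + j)" by (auto simp: inj_on_def)
          then have "(\<integral>\<^sup>+n. f (k + n + j) \<partial>count_space UNIV) = (\<integral>\<^sup>+n. f n \<partial>count_space (range (\<lambda>n. k + n + j)))"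
            by (intro nn_integral_bij_count_space) (simp add: bij_betw_def)
          also have "\<dots> \<le> (\<integral>\<^sup>+n. f n \<partial>count_space UNIV)"
            by (subst nn_integral_count_space_indicator) (auto intro!: nn_integral_mono simp: indicator_def)
          finally show ?thesis by (simp add: nn_integral_count_space_nat)
        qed
        then show ?thesis by (simp add: Gm_def green_def)
      qed
      finally show ?thesis .
    qed
    from this[of 0] this[of 1]
    have "?m ^ k * ((\<Sum>n. ?m ^ n * heat (k + n) \<one>) + (\<Sum>n. ?m ^ n * heat (k + Suc n) \<one>)) \<le> Gm + Gm"
      unfolding distrib_left by (intro add_mono) simp_all
    then have "ennreal r ^ k * (ennreal (1 + m) * (?m ^ k * ((\<Sum>n. ?m ^ n * heat (k + n) \<one>) + (\<Sum>n. ?m ^ n * heat (k + Suc n) \<one>))))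
       \<le> ennreal r ^ k * (ennreal (1 + m) * (Gm + Gm))"
      by (intro mult_left_mono) auto
    then show "?z ^ k * (ennreal (1 + m) * ((\<Sum>n. ?m ^ n * heat (k + n) \<one>) + (\<Sum>n. ?m ^ n * heat (k + Suc n) \<one>)))
       \<le> ennreal r ^ k * (ennreal (1 + m) * (Gm + Gm))"
      unfolding z power_mult_distrib by (simp only: mult_ac)
  qed auto
  also have "\<dots> = (\<Sum>k. ennreal (r ^ k)) * (ennreal (1 + m) * (Gm + Gm))"
    using r by (simp add: ennreal_power)
  also have "\<dots> < \<infinity>"
  proof -
    have "(\<Sum>k. ennreal (r ^ k)) < \<infinity>"
      using r by (subst suminf_ennreal_eq[OF _ summable_sums[OF summable_geometric]]) auto
    then show ?thesis using Gm_finite by (simp add: ennreal_mult_less_top)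
  qed
  finally show ?thesis .
qed

end

lemma ennreal_square_le: "x\<^sup>2 \<le> y\<^sup>2 \<Longrightarrow> x \<le> y" for x y :: ennreal
  by (cases x; cases y) (auto simp: ennreal_power top_unique power_eq_top_ennreal intro: power2_le_imp_le)

context brw begin

lemma hit_cmult: "x \<in> C \<Longrightarrow> hit z A (\<lambda>y. c * \<psi> y) t x = c * hit z A \<psi> t x"
proof (induction t arbitrary: x)
  case (Suc t)
  have "avg (\<lambda>y. if A y then c * \<psi> y else hit z A (\<lambda>y. c * \<psi> y) t y) x
    = avg (\<lambda>y. c * (if A y then \<psi> y else hit z A \<psi> t y)) x"
    using Suc by (intro avg_cong) auto
  then show ?case by (simp add: avg_cmult mult_ac)
qed simp

lemma ip_self_Qpow: "meas_field \<phi> \<Longrightarrow> ip ((Ret z t ^^ k) \<phi>) ((Ret z t ^^ k) \<phi>) = ip \<phi> ((Ret z t ^^ (k + k)) \<phi>)"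
  by (simp add: ip_Qpow meas_field_Qpow funpow_add)

text \<open>\<open>doubling_bound\<close> for the squared norms of \<open>Q^(k j) \<phi>\<close>: by
  symmetry each is the inner product of \<open>\<phi>\<close> with \<open>Q^(2 k j) \<phi>\<close>,
  so Cauchy-Schwarz gives the doubling inequality, and the expected total weight of visits bounds
  them all.\<close>

lemma Qpow_contract_child:
  assumes r: "0 < r" "r < 1" and \<phi>: "meas_field \<phi>" "\<And>f. \<phi> f \<le> 1"
  defines "z \<equiv> ennreal (r * m)"
  shows "ip ((Ret z t ^^ k) \<phi>) ((Ret z t ^^ k) \<phi>) \<le> ip \<phi> \<phi>"
proof -
  define B where "B = (\<integral>\<^sup>+x. hit_total z (occ x) \<one> \<partial>M2)"
  have B: "B < \<infinity>" unfolding B_def z_def by (rule hit_total_expect[OF r])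
  define e where "e j = ip ((Ret z t ^^ (k * j)) \<phi>) ((Ret z t ^^ (k * j)) \<phi>)" for j
  have bd: "ip \<phi> ((Ret z t ^^ n) \<phi>) \<le> B" for n
  proof -
    have one: "(Ret z t ^^ n) (\<lambda>_. 1) (occ x) \<le> hit_total z (occ x) \<one>" for x
    proof -
      have "(Ret z t ^^ n) (\<lambda>_. 1) (occ x) \<le> (\<Sum>n<Suc n. (Ret z t ^^ n) (\<lambda>_. 1) (occ x))"
        by (simp add: add_increasing)
      also have "\<dots> \<le> hit_total z (occ x) \<one>"
      proof (rule Qpow_le_hit_total)
        show "occ x \<one> \<noteq> 0" using occ_one_ge[of x] by auto
      qed
      finally show ?thesis .
    qed
    have "ip \<phi> ((Ret z t ^^ n) \<phi>) \<le> ip (\<lambda>_. 1) ((Ret z t ^^ n) (\<lambda>_. 1))"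
      using \<phi> by (intro ip_mono Qpow_mono) auto
    also have "\<dots> \<le> (\<integral>\<^sup>+x. (Ret z t ^^ n) (\<lambda>_. 1) (occ x) \<partial>M2)"
      unfolding ip_def using nn_integral_Mw_le[OF meas_field_occ[OF meas_field_Qpow[OF meas_field_one]]] by simp
    also have "\<dots> \<le> B" unfolding B_def by (intro nn_integral_mono one)
    finally show ?thesis .
  qed
  have eB: "e j \<le> B" for j unfolding e_def ip_self_Qpow[OF \<phi>(1)] by (rule bd)
  have efin: "e j < \<infinity>" for j using eB[of j] B by (simp add: le_less_trans)
  have cs: "(e j)\<^sup>2 \<le> e 0 * e (2 * j)" for j
  proof -
    have "e j = ip \<phi> ((Ret z t ^^ (k * (2 * j))) \<phi>)"
      unfolding e_def ip_self_Qpow[OF \<phi>(1)] mult_2 distrib_left ..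
    then show ?thesis
      using ip_cs[OF \<phi>(1) meas_field_Qpow[OF \<phi>(1), where z = z and t = t and k = "k * (2 * j)"]] by (simp add: e_def)
  qed
  have "enn2real (e 1) \<le> enn2real (e 0)"
  proof (rule doubling_bound[where K = "enn2real B"])
    show "(enn2real (e j))\<^sup>2 \<le> enn2real (e 0) * enn2real (e (2 * j))" for j
    proof -
      have "enn2real ((e j)\<^sup>2) \<le> enn2real (e 0 * e (2 * j))"
        using efin[of 0] efin[of "2 * j"] by (intro enn2real_mono cs) (simp add: ennreal_mult_less_top)
      then show ?thesis by (simp add: power2_eq_square enn2real_mult)
    qed
    show "enn2real (e j) \<le> enn2real B" for j using B by (intro enn2real_mono eB) simp
  qed simp
  then have "e 1 \<le> e 0" using efin[of 0] efin[of 1] by (metis ennreal_enn2real ennreal_leI infinity_ennreal_def)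
  then show ?thesis by (simp add: e_def)
qed

text \<open>\<open>k\<close> returns of at most \<open>t\<close> steps each use at most
  \<open>t k\<close> steps.\<close>

lemma Qpow_scale:
  fixes r :: ennreal
  assumes r: "0 \<le> r" "r \<le> 1"
  shows "r ^ (t * k) * (Ret z t ^^ k) \<phi> f \<le> (Ret (r * z) t ^^ k) \<phi> f"
proof (induction k arbitrary: f)
  case (Suc k)
  have "r ^ (t * Suc k) * (Ret z t ^^ Suc k) \<phi> f = r ^ (t * k) * (r ^ t * Ret z t ((Ret z t ^^ k) \<phi>) f)"
    by (simp add: power_add mult_ac)
  also have "\<dots> \<le> r ^ (t * k) * Ret (r * z) t ((Ret z t ^^ k) \<phi>) f"
    unfolding Ret_def[of _ _ "(Ret z t ^^ k) \<phi>"] using r by (intro mult_left_mono hit_scale) auto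
  also have "\<dots> = Ret (r * z) t (\<lambda>f. r ^ (t * k) * (Ret z t ^^ k) \<phi> f) f"
    unfolding Ret_def[of "r * z"] by (rule hit_cmult[symmetric]) simp
  also have "\<dots> \<le> Ret (r * z) t ((Ret (r * z) t ^^ k) \<phi>) f"
    by (intro Ret_mono Suc.IH)
  finally show ?case by simp
qed simp

abbreviation "Qm \<equiv> Ret (ennreal m)"

text \<open>With \<open>t\<close> and \<open>k\<close> fixed, the factor \<open>r^(2 t k)\<close>
  lost in replacing \<open>m\<close> by \<open>r m\<close> tends to 1.\<close>

lemma Qpow_contract:
  assumes \<phi>: "meas_field \<phi>" "\<And>f. \<phi> f \<le> 1"
  shows "ip ((Qm t ^^ k) \<phi>) ((Qm t ^^ k) \<phi>) \<le> ip \<phi> \<phi>"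
proof -
  let ?X = "ip ((Qm t ^^ k) \<phi>) ((Qm t ^^ k) \<phi>)"
  have le: "ennreal (r ^ (2 * (t * k))) * ?X \<le> ip \<phi> \<phi>" if r: "0 < r" "r < 1" for r
  proof -
    let ?r = "ennreal r"
    have eq: "ennreal (r ^ (2 * (t * k))) = ?r ^ (t * k) * ?r ^ (t * k)"
      using r by (simp add: ennreal_power ennreal_mult[symmetric] mult_2 power_add)
    have "ennreal (r ^ (2 * (t * k))) * ?X = ip (\<lambda>f. ?r ^ (t * k) * (Qm t ^^ k) \<phi> f) (\<lambda>f. ?r ^ (t * k) * (Qm t ^^ k) \<phi> f)"
      unfolding ip_def eq using meas_field_occ[OF meas_field_Qpow[OF \<phi>(1)]]
      by (subst nn_integral_cmult[symmetric]) (simp_all add: mult_ac)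
    also have "\<dots> \<le> ip ((Ret (?r * ennreal m) t ^^ k) \<phi>) ((Ret (?r * ennreal m) t ^^ k) \<phi>)"
      using r by (intro ip_mono Qpow_scale) auto
    also have "?r * ennreal m = ennreal (r * m)" using r m_gt by (simp add: ennreal_mult)
    also have "ip ((Ret (ennreal (r * m)) t ^^ k) \<phi>) ((Ret (ennreal (r * m)) t ^^ k) \<phi>) \<le> ip \<phi> \<phi>"
      by (rule Qpow_contract_child[OF r \<phi>])
    finally show ?thesis .
  qed
  have "(\<lambda>n. 1 - 1 / (real n + 2)) \<longlonglongrightarrow> 1" by real_asymp
  then have "(\<lambda>n. ennreal ((1 - 1 / (real n + 2)) ^ (2 * (t * k)))) \<longlonglongrightarrow> ennreal (1 ^ (2 * (t * k)))"
    by (intro tendsto_ennrealI tendsto_power)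
  then have "(\<lambda>n. ennreal ((1 - 1 / (real n + 2)) ^ (2 * (t * k))) * ?X) \<longlonglongrightarrow> ennreal (1 ^ (2 * (t * k))) * ?X"
    by (intro tendsto_mult_ennreal tendsto_const) auto
  then have "ennreal (1 ^ (2 * (t * k))) * ?X \<le> ip \<phi> \<phi>"
    by (rule LIMSEQ_le_const2) (auto intro!: exI[of _ 0] le)
  then show ?thesis by simp
qed

lemma ip_one_one: "ip (\<lambda>_. 1) (\<lambda>_. 1) \<le> 1"
proof -
  have "ip (\<lambda>_. 1) (\<lambda>_. 1) \<le> (\<integral>\<^sup>+x. 1 \<partial>M2)"
    unfolding ip_def using nn_integral_Mw_le[of "\<lambda>_. 1"] by simp
  then show ?thesis by (simp add: NN.emeasure_space_1[simplified])
qed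

lemma ip_Qm_sq:
  assumes "meas_field \<phi>" "meas_field \<psi>" "\<And>f. \<psi> f \<le> 1"
  shows "(ip \<phi> (Qm t \<psi>))\<^sup>2 \<le> ip \<phi> \<phi> * ip \<psi> \<psi>"
proof -
  have "(ip \<phi> (Qm t \<psi>))\<^sup>2 \<le> ip \<phi> \<phi> * ip (Qm t \<psi>) (Qm t \<psi>)" by (intro ip_cs meas_field_Ret assms)
  also have "\<dots> \<le> ip \<phi> \<phi> * ip \<psi> \<psi>" using Qpow_contract[OF assms(2,3), where t = t and k = 1] by (intro mult_left_mono) auto
  finally show ?thesis .
qed

lemma returns_translate:
  assumes "\<And>u. u \<in> C \<Longrightarrow> B u = A (g \<otimes> u)" "g \<in> C"
  shows "x \<in> C \<Longrightarrow> returns t B n x \<omega> = returns t A n (g \<otimes> x) \<omega>"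
proof (induction t arbitrary: n x \<omega>)
  case (Suc t)
  then show ?case using assms by (auto simp: m_assoc intro!: sum.cong)
qed simp

lemma returns_prob_shift: "y \<in> C \<Longrightarrow> returns_prob t (visited (shift y f)) n \<one> = returns_prob t (visited f) n y"
  unfolding returns_prob_def by (subst returns_translate[of _ "visited f" y]) (auto simp: visited_def shift_def)

lemma returns_mean_shift: "y \<in> C \<Longrightarrow> returns_mean t (visited (shift y f)) n \<one> = returns_mean t (visited f) n y"
  unfolding returns_mean_def by (subst returns_translate[of _ "visited f" y]) (auto simp: visited_def shift_def)

lemma measurable_returns_integral:
  fixes \<phi> :: "nat \<Rightarrow> ennreal"
  assumes y: "y \<in> C"
  shows "(\<lambda>x. \<integral>\<^sup>+\<omega>. \<phi> (returns t (visited (shift y (occ x))) n \<one> \<omega>) \<partial>N) \<in> borel_measurable M2"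
proof (rule N.borel_measurable_nn_integral)
  have "(\<lambda>w. returns t (visited (shift y (occ (fst w)))) n \<one> (snd w)) \<in> measurable (M2 \<Otimes>\<^sub>M N) (count_space UNIV)"
  proof (rule measurable_returns[where a = "\<lambda>w. visited (shift y (occ (fst w)))" and f = snd])
    show "Measurable.pred (M2 \<Otimes>\<^sub>M N) (\<lambda>w. visited (shift y (occ (fst w))) u)" if "u \<in> C" for u
      by (rule measurable_compose[OF measurable_fst measurable_visited[OF y that]])
  qed simp_all
  then have "(\<lambda>w. \<phi> (returns t (visited (shift y (occ (fst w)))) n \<one> (snd w))) \<in> borel_measurable (M2 \<Otimes>\<^sub>M N)"
    by (rule measurable_compose) auto
  then show "(\<lambda>(x, \<omega>). \<phi> (returns t (visited (shift y (occ x))) n \<one> \<omega>)) \<in> borel_measurable (M2 \<Otimes>\<^sub>M N)"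
    by (simp only: case_prod_beta')
qed

section \<open>Extinction of the return process\<close>

definition survive_at where "survive_at n f = survive (visited f) n \<one>"

lemma survive_at_shift: "y \<in> C \<Longrightarrow> survive_at n (shift y f) = survive (visited f) n y"
  unfolding survive_at_def survive_def by (simp add: returns_prob_shift)

lemma meas_field_survive_at: "meas_field (survive_at n)"
  unfolding meas_field_def survive_at_def survive_def returns_prob_def
  by (intro ballI borel_measurable_SUP measurable_returns_integral) auto

lemma survive_at_le_1: "survive_at n f \<le> 1" by (simp add: survive_at_def survive_le_1)
lemma survive_at_dec: "survive_at (Suc n) f \<le> survive_at n f" by (simp add: survive_at_def survive_depth)

lemma survive_at_gain: "survive_at (Suc n) (occ x) + gain * (survive_at n (occ x))\<^sup>2 \<le> (SUP t. Qm t (survive_at n) (occ x))"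
proof -
  have "visited (occ x) \<one>" using occ_one_ge[of x] by (auto simp: visited_def)
  then have "survive_at (Suc n) (occ x) + gain * (survive_at n (occ x))\<^sup>2 \<le> (SUP t. hit (ennreal m) (visited (occ x)) (survive (visited (occ x)) n) t \<one>)"
    unfolding survive_at_def by (intro survive_gain) auto
  also have "\<dots> = (SUP t. Qm t (survive_at n) (occ x))"
    unfolding Ret_def by (intro SUP_cong refl hit_cong) (auto simp: survive_at_shift)
  finally show ?thesis .
qed

text \<open>Integrate the gain inequality against \<open>s_(n+1)\<close> and use
  \<open>s_n \<ge> s_(n+1)\<close> in the quadratic term. The inner product of
  \<open>s_(n+1)\<close> with \<open>Q s_n\<close> is at most the product of the norms of
  \<open>s_(n+1)\<close> and \<open>s_n\<close>, by contraction.\<close>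

lemma survive_at_step:
  "ip (survive_at (Suc n)) (survive_at (Suc n)) + gain * (\<integral>\<^sup>+x. (survive_at (Suc n) (occ x))^3 \<partial>Mw) \<le> ip (survive_at n) (survive_at n)"
proof -
  let ?a = "\<lambda>x. survive_at (Suc n) (occ x)" and ?b = "\<lambda>x. survive_at n (occ x)"
  have [measurable]: "?a \<in> borel_measurable M2" "?b \<in> borel_measurable M2" by (intro meas_field_occ meas_field_survive_at)+
  have mQ: "(\<lambda>x. Qm t (survive_at n) (occ x)) \<in> borel_measurable M2" for t by (intro meas_field_occ meas_field_Ret meas_field_survive_at)
  have "ip (survive_at (Suc n)) (survive_at (Suc n)) + gain * (\<integral>\<^sup>+x. (?a x)^3 \<partial>Mw) = (\<integral>\<^sup>+x. ?a x * (?a x + gain * (?a x)\<^sup>2) \<partial>Mw)"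
    unfolding ip_def by (subst nn_integral_cmult[symmetric], simp, subst nn_integral_add[symmetric])
      (auto simp: distrib_left power2_eq_square power3_eq_cube mult_ac)
  also have "\<dots> \<le> (\<integral>\<^sup>+x. ?a x * (SUP t. Qm t (survive_at n) (occ x)) \<partial>Mw)"
  proof (intro nn_integral_mono mult_left_mono)
    fix x
    have "?a x + gain * (?a x)\<^sup>2 \<le> ?a x + gain * (?b x)\<^sup>2"
      using survive_at_dec by (intro add_left_mono mult_left_mono power_mono) auto
    then show "?a x + gain * (?a x)\<^sup>2 \<le> (SUP t. Qm t (survive_at n) (occ x))" using survive_at_gain[of n x] by (rule order_trans)
  qed simp
  also have "\<dots> = (\<integral>\<^sup>+x. (SUP t. ?a x * Qm t (survive_at n) (occ x)) \<partial>Mw)"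
    by (simp add: SUP_mult_left_ennreal)
  also have "\<dots> = (SUP t. ip (survive_at (Suc n)) (Qm t (survive_at n)))"
    unfolding ip_def using mQ
    by (intro nn_integral_monotone_convergence_SUP)
       (auto simp: incseq_Suc_iff le_fun_def Ret_def simp del: hit.simps intro!: mult_left_mono hit_mono_t)
  also have "\<dots> \<le> ip (survive_at n) (survive_at n)"
  proof (rule SUP_least)
    fix t
    have "(ip (survive_at (Suc n)) (Qm t (survive_at n)))\<^sup>2 \<le> ip (survive_at (Suc n)) (survive_at (Suc n)) * ip (survive_at n) (survive_at n)"
      by (intro ip_Qm_sq meas_field_survive_at survive_at_le_1)
    also have "\<dots> \<le> (ip (survive_at n) (survive_at n))\<^sup>2"
      unfolding power2_eq_square using survive_at_dec by (intro mult_right_mono ip_mono) auto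
    finally show "ip (survive_at (Suc n)) (Qm t (survive_at n)) \<le> ip (survive_at n) (survive_at n)"
      by (rule ennreal_square_le)
  qed
  finally show ?thesis .
qed

text \<open>Without the chance of a second child the mean would be \<open>tailp 0 \<le> 1\<close>;
  and the walk may stay put.\<close>

lemma gain_pos: "0 < gain"
proof -
  have "tailp 1 \<noteq> 0"
  proof
    assume 0: "tailp 1 = 0"
    have "tailp (Suc i) = 0" for i
    proof -
      have "tailp (Suc i) \<le> tailp 1" unfolding tailp_def by (intro emeasure_mono) auto
      then show ?thesis using 0 by simp
    qed
    then have "(\<Sum>i. tailp i) = tailp 0" by (subst suminf_head_ennreal) simp
    also have "tailp 0 \<le> 1" unfolding tailp_def by (rule measure_pmf.emeasure_le_1)
    finally show False using m_gt unfolding sum_tailp by simp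
  qed
  then show ?thesis using pmf_T_pos[OF one_T] by (simp add: gain_def zero_less_iff_neq_zero)
qed

text \<open>The norms telescope: \<open>n\<close> times the gain times the integral of the cubed
  limit stays below 1 for every \<open>n\<close>, so that integral is 0. The weight in it is almost
  surely nonzero.\<close>

lemma AE_survive_at_zero: "AE x in M2. (INF n. survive_at n (occ x)) = 0"
proof -
  let ?\<pi> = "\<lambda>x. INF n. survive_at n (occ x)"
  have mS [measurable]: "(\<lambda>x. survive_at n (occ x)) \<in> borel_measurable M2" for n by (intro meas_field_occ meas_field_survive_at)
  have [measurable]: "?\<pi> \<in> borel_measurable M2" by simp
  define d where "d = (\<integral>\<^sup>+x. (?\<pi> x)^3 \<partial>Mw)"
  have "ip (survive_at n) (survive_at n) + of_nat n * (gain * d) \<le> 1" for n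
  proof (induction n)
    case 0
    have "survive_at 0 = (\<lambda>_. 1)" by (simp add: survive_at_def fun_eq_iff)
    then show ?case using ip_one_one by simp
  next
    case (Suc n)
    have "d \<le> (\<integral>\<^sup>+x. (survive_at (Suc n) (occ x))^3 \<partial>Mw)"
      unfolding d_def by (intro nn_integral_mono power_mono INF_lower) auto
    then have "ip (survive_at (Suc n)) (survive_at (Suc n)) + gain * d \<le> ip (survive_at n) (survive_at n)"
      by (intro order_trans[OF add_left_mono survive_at_step] mult_left_mono) auto
    then have "ip (survive_at (Suc n)) (survive_at (Suc n)) + gain * d + of_nat n * (gain * d) \<le> ip (survive_at n) (survive_at n) + of_nat n * (gain * d)"
      by (rule add_right_mono)
    also have "\<dots> \<le> 1" by (rule Suc)
    finally show ?case by (simp add: distrib_right add_ac)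
  qed
  then have le: "of_nat n * (gain * d) \<le> 1" for n
    by (meson add_increasing order_trans zero_le order_refl)
  have "gain * d = 0"
  proof (rule ccontr)
    assume nz: "gain * d \<noteq> 0"
    have fin: "gain * d < \<infinity>" using le[of 1] by (simp add: le_less_trans)
    then obtain c where c: "gain * d = ennreal c" "0 \<le> c" by (cases "gain * d") auto
    then have "0 < c" using nz by (cases "c = 0") auto
    then obtain n where n: "1 < real n * c" using reals_Archimedean3 by blast
    have "of_nat n * (gain * d) = ennreal (real n * c)"
      using c by (simp add: ennreal_mult ennreal_of_nat_eq_real_of_nat)
    then show False using le[of n] n by simp
  qed
  then have "d = 0" using gain_pos by auto
  then have "(\<integral>\<^sup>+x. inverse (occ x \<one>) * (?\<pi> x)^3 \<partial>M2) = 0"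
    unfolding d_def by (subst (asm) nn_integral_Mw) auto
  then have "AE x in M2. inverse (occ x \<one>) * (?\<pi> x)^3 = 0"
    by (subst (asm) nn_integral_0_iff_AE) auto
  then show ?thesis using AE_occ_finite
  proof eventually_elim
    case (elim x)
    then have "occ x \<one> < \<infinity>" by blast
    then show ?case using elim(1) by auto
  qed
qed

text \<open>On the left \<open>t\<close> bounds the total number of generations, on the right the
  length of each single return, which is a weaker restriction.\<close>

lemma returns_mean_Qpow: "returns_mean t (visited f) k \<one> \<le> (Qm t ^^ k) (\<lambda>_. 1) f"
proof (induction k arbitrary: f)
  case (Suc k)
  have mono: "returns_mean t' A k y \<le> returns_mean t A k y" if "t' \<le> t" for t' A y
    using that by (induction rule: dec_induct) (auto intro: order_trans returns_mean_mono_t)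
  have "t' \<le> t \<Longrightarrow> x \<in> C \<Longrightarrow> returns_mean t' (visited f) (Suc k) x \<le> hit (ennreal m) (visited f) (returns_mean t (visited f) k) t' x" for t' x
  proof (induction t' arbitrary: x)
    case 0 then show ?case by (simp add: returns_mean_def)
  next
    case (Suc t')
    have "returns_mean (Suc t') (visited f) (Suc k) x \<le> ennreal m * avg (\<lambda>y. if visited f y then returns_mean t (visited f) k y else hit (ennreal m) (visited f) (returns_mean t (visited f) k) t' y) x"
      unfolding returns_mean_step[OF Suc.prems(2)] using Suc by (intro mult_left_mono avg_mono) (auto intro: mono)
    then show ?case by simp
  qed
  then have "returns_mean t (visited f) (Suc k) \<one> \<le> hit (ennreal m) (visited f) (returns_mean t (visited f) k) t \<one>" by simp
  also have "\<dots> \<le> hit (ennreal m) (visited f) (\<lambda>y. (Qm t ^^ k) (\<lambda>_. 1) (shift y f)) t \<one>"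
  proof (rule hit_mono)
    fix y assume "y \<in> C"
    then show "returns_mean t (visited f) k y \<le> (Qm t ^^ k) (\<lambda>_. 1) (shift y f)"
      using Suc.IH[of "shift y f"] returns_mean_shift[of y t f k] by simp
  qed simp
  finally show ?case by (simp add: Ret_def[of _ _ "(Qm t ^^ k) (\<lambda>_. 1)"])
qed simp

text \<open>By contraction, the square of the mean number of returns has \<open>Mw\<close>-integral
  at most 1 for every cut-off \<open>t\<close>, so its monotone limit is almost surely
  finite.\<close>

lemma AE_returns_mean_finite: "AE x in M2. \<forall>n. (SUP t. returns_mean t (visited (occ x)) n \<one>) < \<infinity>"
  unfolding AE_all_countable
proof
  fix n
  have m: "(\<lambda>x. returns_mean t (visited (occ x)) n \<one>) \<in> borel_measurable M2" for t
    using measurable_returns_integral[OF one_closed, where \<phi> = of_nat and t = t and n = n]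
    by (simp only: returns_mean_def shift_one_occ)
  have "(\<integral>\<^sup>+x. (SUP t. (returns_mean t (visited (occ x)) n \<one>)\<^sup>2) \<partial>Mw) = (SUP t. \<integral>\<^sup>+x. (returns_mean t (visited (occ x)) n \<one>)\<^sup>2 \<partial>Mw)"
    using m by (intro nn_integral_monotone_convergence_SUP) (auto simp: incseq_Suc_iff le_fun_def intro!: power_mono returns_mean_mono_t)
  also have "\<dots> \<le> 1"
  proof (rule SUP_least)
    fix t
    have "(\<integral>\<^sup>+x. (returns_mean t (visited (occ x)) n \<one>)\<^sup>2 \<partial>Mw) \<le> ip ((Qm t ^^ n) (\<lambda>_. 1)) ((Qm t ^^ n) (\<lambda>_. 1))"
      unfolding ip_def power2_eq_square by (intro nn_integral_mono mult_mono returns_mean_Qpow) auto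
    also have "\<dots> \<le> 1" using Qpow_contract[OF meas_field_one, where t = t and k = n] ip_one_one by (auto intro: order_trans)
    finally show "(\<integral>\<^sup>+x. (returns_mean t (visited (occ x)) n \<one>)\<^sup>2 \<partial>Mw) \<le> 1" .
  qed
  finally have "(\<integral>\<^sup>+x. inverse (occ x \<one>) * (SUP t. (returns_mean t (visited (occ x)) n \<one>)\<^sup>2) \<partial>M2) \<le> 1"
    using m by (subst (asm) nn_integral_Mw) (auto intro!: borel_measurable_SUP)
  then have "(\<integral>\<^sup>+x. inverse (occ x \<one>) * (SUP t. (returns_mean t (visited (occ x)) n \<one>)\<^sup>2) \<partial>M2) \<noteq> \<infinity>" by (auto simp: top_unique)
  then have "AE x in M2. inverse (occ x \<one>) * (SUP t. (returns_mean t (visited (occ x)) n \<one>)\<^sup>2) \<noteq> \<infinity>"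
    using m by (intro nn_integral_PInf_AE) (auto intro!: borel_measurable_SUP)
  then show "AE x in M2. (SUP t. returns_mean t (visited (occ x)) n \<one>) < \<infinity>" using AE_occ_finite
  proof eventually_elim
    case (elim x)
    have "occ x \<one> < \<infinity>" using elim(2) by blast
    then have "inverse (occ x \<one>) \<noteq> 0" by auto
    then have fin: "(SUP t. (returns_mean t (visited (occ x)) n \<one>)\<^sup>2) \<noteq> \<infinity>"
      using elim(1) by (auto simp: ennreal_mult_eq_top_iff)
    have "returns_mean t (visited (occ x)) n \<one> \<le> 1 + (SUP t. (returns_mean t (visited (occ x)) n \<one>)\<^sup>2)" for t
    proof -
      have "a \<le> 1 + a\<^sup>2" for a :: ennreal
      proof (cases "a \<le> 1")
        case False
        then have "a * 1 \<le> a * a" by (intro mult_left_mono) auto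
        then show ?thesis by (simp add: power2_eq_square add_increasing)
      qed (simp add: add_increasing2)
      also have "1 + (returns_mean t (visited (occ x)) n \<one>)\<^sup>2 \<le> 1 + (SUP t. (returns_mean t (visited (occ x)) n \<one>)\<^sup>2)"
        by (intro add_left_mono SUP_upper) simp
      finally show ?thesis .
    qed
    then have "(SUP t. returns_mean t (visited (occ x)) n \<one>) \<le> 1 + (SUP t. (returns_mean t (visited (occ x)) n \<one>)\<^sup>2)" by (rule SUP_least)
    moreover have "1 + X < \<infinity>" if "X \<noteq> \<infinity>" for X :: ennreal using that by (simp add: less_top)
    ultimately show ?case using fin le_less_trans by blast
  qed
qed

lemma AE_finite_hits_occ: "AE x in M2. AE \<omega> in N. finite {l. tree l \<omega> \<and> visited (occ x) (site l \<omega>)}"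
  using AE_survive_at_zero AE_returns_mean_finite
proof eventually_elim
  case (elim x)
  have "AE \<omega> in N. finite {l. tree l \<omega> \<and> visited (occ x) (\<one> \<otimes> site l \<omega>)}"
    by (rule AE_finite_hits) (use elim in \<open>auto simp: survive_at_def\<close>)
  then show ?case by simp
qed

end

section \<open>Independent branching random walks meet finitely often\<close>

definition desc :: "nat list \<Rightarrow> (nat list \<Rightarrow> 'b) \<Rightarrow> nat list \<Rightarrow> 'b" where
  "desc a \<omega> = (\<lambda>v. \<omega> (a @ v))"

lemma desc_Nil [simp]: "desc [] \<omega> = \<omega>" by (simp add: desc_def)
lemma desc_Cons: "desc (i # a) \<omega> = desc a (child i \<omega>)" by (simp add: desc_def child_def)

lemma measurable_desc [measurable (raw)]:
  "f \<in> measurable M (brw_space \<mu> q) \<Longrightarrow> (\<lambda>x. desc a (f x)) \<in> measurable M (brw_space \<mu> q)"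
  by (rule measurable_into_brw) (simp add: desc_def)

lemma nn_integral_desc:
  fixes q :: "'b pmf"
  assumes F [measurable]: "F \<in> borel_measurable (brw_space \<mu> q)"
  shows "(\<integral>\<^sup>+\<omega>. F (desc a \<omega>) \<partial>brw_space \<mu> q) = (\<integral>\<^sup>+\<omega>. F \<omega> \<partial>brw_space \<mu> q)"
proof -
  interpret prob_space "brw_space \<mu> q" by (rule prob_space_brw)
  have inj: "inj ((@) a)" by (auto simp: inj_on_def)
  have "desc a (\<lambda>v. if v \<in> range ((@) a) then \<eta> (inv_into UNIV ((@) a) v) else \<omega> v) = \<eta>" for \<eta> \<omega> :: "nat list \<Rightarrow> nat \<times> 'b"
    by (auto simp: desc_def inv_into_f_f[OF inj])
  then show ?thesis
    by (subst nn_integral_graft[OF inj]) (auto simp: emeasure_space_1[simplified])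
qed

text \<open>Neither of \<open>a\<close> and \<open>b\<close> extends the other, so redrawing the
  subtree at \<open>a\<close> leaves the one at \<open>b\<close> untouched.\<close>

lemma nn_integral_parallel:
  fixes q :: "'b pmf"
  assumes F [measurable]: "F \<in> borel_measurable (brw_space \<mu> q \<Otimes>\<^sub>M brw_space \<mu> q)" and ab: "parallel a b"
  shows "(\<integral>\<^sup>+\<omega>. F (desc b \<omega>, desc a \<omega>) \<partial>brw_space \<mu> q) = (\<integral>\<^sup>+x. F x \<partial>(brw_space \<mu> q \<Otimes>\<^sub>M brw_space \<mu> q))"
proof -
  let ?N = "brw_space \<mu> q"
  interpret prob_space ?N by (rule prob_space_brw)
  have inj: "inj ((@) a)" by (auto simp: inj_on_def)
  let ?gr = "\<lambda>\<eta> \<omega> v. if v \<in> range ((@) a) then \<eta> (inv_into UNIV ((@) a) v) else \<omega> v"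
  have 1: "desc a (?gr \<eta> \<omega>) = \<eta>" for \<eta> \<omega> :: "nat list \<Rightarrow> nat \<times> 'b"
    by (auto simp: desc_def inv_into_f_f[OF inj])
  have "b @ v \<notin> range ((@) a)" for v
  proof
    assume "b @ v \<in> range ((@) a)"
    then have "prefix a (b @ v)" by (auto simp: prefix_def)
    then have "prefix a b \<or> prefix b a" by (rule prefix_same_cases) simp
    then show False using ab by auto
  qed
  then have 2: "desc b (?gr \<eta> \<omega>) = desc b \<omega>" for \<eta> \<omega> :: "nat list \<Rightarrow> nat \<times> 'b"
    by (auto simp: desc_def fun_eq_iff)
  have "(\<integral>\<^sup>+\<omega>. F (desc b \<omega>, desc a \<omega>) \<partial>?N) = (\<integral>\<^sup>+\<omega>. \<integral>\<^sup>+\<eta>. F (desc b \<omega>, \<eta>) \<partial>?N \<partial>?N)"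
    by (subst nn_integral_graft[OF inj]) (simp_all add: 1 2)
  also have "\<dots> = (\<integral>\<^sup>+\<omega>. \<integral>\<^sup>+\<eta>. F (\<omega>, \<eta>) \<partial>?N \<partial>?N)"
    by (rule nn_integral_desc) simp
  also have "\<dots> = (\<integral>\<^sup>+x. F x \<partial>(?N \<Otimes>\<^sub>M ?N))"
    by (rule nn_integral_fst) simp
  finally show ?thesis .
qed

context brw begin

lemma tree_append: "tree (a @ l) \<omega> \<longleftrightarrow> tree a \<omega> \<and> tree l (desc a \<omega>)"
  by (induction a arbitrary: \<omega>) (auto simp: desc_Cons)

lemma site_append: "site (a @ l) \<omega> = site a \<omega> \<otimes> site l (desc a \<omega>)"
  by (induction a arbitrary: \<omega>) (auto simp: desc_Cons m_assoc)

definition in_trace :: "(nat list \<Rightarrow> nat \<times> 'a) \<Rightarrow> 'a \<Rightarrow> bool" where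
  "in_trace b y \<longleftrightarrow> (\<exists>l. tree l b \<and> site l b = y)"

definition n_hits :: "'a \<Rightarrow> (nat list \<Rightarrow> nat \<times> 'a) \<Rightarrow> (nat list \<Rightarrow> nat \<times> 'a) \<Rightarrow> ennreal" where
  "n_hits x b \<omega> = (\<integral>\<^sup>+l. indicator {l. tree l \<omega> \<and> in_trace b (x \<otimes> site l \<omega>)} l \<partial>count_space UNIV)"

lemma n_hits_finite_iff: "n_hits x b \<omega> < \<infinity> \<longleftrightarrow> finite {l. tree l \<omega> \<and> in_trace b (x \<otimes> site l \<omega>)}"
  unfolding n_hits_def by (simp add: emeasure_count_space less_top[symmetric])

lemma measurable_in_trace:
  assumes [measurable]: "f \<in> measurable M N" shows "Measurable.pred M (\<lambda>w. in_trace (f w) y)"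
proof -
  have "Measurable.pred M (\<lambda>w. site l (f w) = y)" for l
    using measurable_compose[OF measurable_site[OF assms], of "\<lambda>z. z = y" "count_space UNIV" l] by (simp add: pred_def)
  then show ?thesis unfolding in_trace_def by measurable
qed

lemma measurable_n_hits [measurable]:
  assumes x: "x \<in> C" shows "(\<lambda>w. n_hits x (fst w) (snd w)) \<in> borel_measurable M2"
  unfolding n_hits_def
proof (rule borel_measurable_count_space_integral)
  fix l
  have t: "Measurable.pred M2 (\<lambda>w. in_trace (fst w) (x \<otimes> site l (snd w)))"
    by (rule measurable_compose_countable'[where f = "\<lambda>g w. in_trace (fst w) (x \<otimes> g)" and g = "\<lambda>w. site l (snd w)" and I = C,
          OF measurable_in_trace[OF measurable_fst] measurable_site[OF measurable_snd] countable_C])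
  have "Measurable.pred M2 (\<lambda>w. tree l (snd w))" by (rule measurable_tree[OF measurable_snd])
  with t have "Measurable.pred M2 (\<lambda>w. tree l (snd w) \<and> in_trace (fst w) (x \<otimes> site l (snd w)))"
    by (rule pred_intros_logic(3)[rotated])
  then have s: "{w \<in> space M2. tree l (snd w) \<and> in_trace (fst w) (x \<otimes> site l (snd w))} \<in> sets M2"
    unfolding pred_def .
  have "(\<lambda>w. if tree l (snd w) \<and> in_trace (fst w) (x \<otimes> site l (snd w)) then 1 else 0 :: ennreal) \<in> borel_measurable M2"
    by (rule measurable_If[OF borel_measurable_const borel_measurable_const s])
  then show "(\<lambda>w. indicator {l. tree l (snd w) \<and> in_trace (fst w) (x \<otimes> site l (snd w))} l :: ennreal) \<in> borel_measurable M2"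
    by (simp only: indicator_def of_bool_def mem_Collect_eq)
qed simp

lemma n_hits_set_inc [simp]: "n_hits x b (set_inc s \<omega>) = n_hits x b \<omega>" by (simp add: n_hits_def)

lemma in_trace_occ: "in_trace (snd x) y \<Longrightarrow> visited (occ x) y"
proof -
  assume "in_trace (snd x) y"
  then obtain l where l: "tree l (snd x)" "site l (snd x) = y" by (auto simp: in_trace_def)
  have "1 \<le> edges (snd x) (indicator {y})"
  proof (cases "l = []")
    case True then show ?thesis using l by (simp add: edges_def add_increasing2)
  next
    case False
    let ?h = "\<lambda>l. indicator {\<omega>. tree l \<omega>} (snd x) * (indicator {y} (site (butlast l) (snd x)) + indicator {y} (site l (snd x))) :: ennreal"
    have "1 \<le> ?h l" using l by (simp add: add_increasing)
    also have "\<dots> \<le> (\<integral>\<^sup>+l. ?h l \<partial>count_space {l. l \<noteq> []})" using False by (intro nn_integral_ge_point) auto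
    finally show ?thesis by (simp add: edges_def add_increasing)
  qed
  then have "1 \<le> occ x y" unfolding occ_def mass_def by (simp add: add_increasing2)
  then show ?thesis by (auto simp: visited_def)
qed

definition inf_hits :: "'a \<Rightarrow> (nat list \<Rightarrow> nat \<times> 'a) \<Rightarrow> (nat list \<Rightarrow> nat \<times> 'a) \<Rightarrow> ennreal" where
  "inf_hits x b \<omega> = (if n_hits x b \<omega> < \<infinity> then 0 else 1)"

lemma measurable_inf_hits: "x \<in> C \<Longrightarrow> (\<lambda>w. inf_hits x (fst w) (snd w)) \<in> borel_measurable M2"
  unfolding inf_hits_def by measurable

lemma inf_hits_set_inc [simp]: "inf_hits x b (set_inc s \<omega>) = inf_hits x b \<omega>" by (simp add: inf_hits_def)

lemma measurable_bad2: "x \<in> C \<Longrightarrow> inf_hits x b \<in> borel_measurable N"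
  using measurable_compose[OF measurable_Pair1'[of b N N] measurable_inf_hits[of x]] by simp

lemma measurable_bad1: "x \<in> C \<Longrightarrow> (\<lambda>b. \<integral>\<^sup>+\<omega>. inf_hits x b \<omega> \<partial>N) \<in> borel_measurable N"
  using measurable_inf_hits[of x] by (intro N.borel_measurable_nn_integral) (simp add: case_prod_beta')

text \<open>The trace of \<open>b\<close> is part of the field of the two-sided tree
  \<open>(a, b)\<close>, for which finiteness is known.\<close>

lemma inf_hits_one: "(\<integral>\<^sup>+b. \<integral>\<^sup>+\<omega>. inf_hits \<one> b \<omega> \<partial>N \<partial>N) = 0"
proof -
  let ?Z = "\<lambda>b. \<integral>\<^sup>+\<omega>. inf_hits \<one> b \<omega> \<partial>N"
  have "AE x in M2. ?Z (snd x) = 0"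
    using AE_finite_hits_occ
  proof eventually_elim
    case (elim x)
    have "AE \<omega> in N. inf_hits \<one> (snd x) \<omega> = 0"
      using elim
    proof eventually_elim
      case (elim \<omega>)
      have "{l. tree l \<omega> \<and> in_trace (snd x) (\<one> \<otimes> site l \<omega>)} \<subseteq> {l. tree l \<omega> \<and> visited (occ x) (site l \<omega>)}"
        by (intro subsetI) (simp add: in_trace_occ)
      then have "finite {l. tree l \<omega> \<and> in_trace (snd x) (\<one> \<otimes> site l \<omega>)}" using elim by (rule finite_subset)
      then show ?case by (simp add: inf_hits_def n_hits_finite_iff[simplified])
    qed
    then show ?case by (subst nn_integral_0_iff_AE) (auto intro!: measurable_bad2)
  qed
  then have "(\<integral>\<^sup>+x. ?Z (snd x) \<partial>M2) = 0"
    using measurable_compose[OF measurable_snd measurable_bad1[of "\<one>"]] by (subst nn_integral_0_iff_AE) auto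
  also have "(\<integral>\<^sup>+x. ?Z (snd x) \<partial>M2) = (\<integral>\<^sup>+b. ?Z b \<partial>N)"
    using measurable_compose[OF measurable_snd measurable_bad1[of "\<one>"]]
    by (subst N.nn_integral_fst[symmetric]) (auto simp: N.emeasure_space_1[simplified])
  finally show ?thesis .
qed

lemma pk0_pos: "tailp 0 \<noteq> 0"
proof -
  have "tailp 1 \<le> tailp 0" unfolding tailp_def by (intro emeasure_mono) auto
  then show ?thesis using gain_pos by (auto simp: gain_def)
qed

text \<open>With probability at least \<open>tailp 0\<close> times \<open>q(s)\<close> the first
  child exists and steps to \<open>x s\<close>, and infinitely many hits from there are hits from
  \<open>x\<close>. So a null event at \<open>x\<close> forces one at \<open>x s\<close>.\<close>

lemma inf_hits_zero: "x \<in> C \<Longrightarrow> (\<integral>\<^sup>+b. \<integral>\<^sup>+\<omega>. inf_hits x b \<omega> \<partial>N \<partial>N) = 0"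
proof (induction x rule: C_induct)
  case one show ?case by (rule inf_hits_one)
next
  case (step x s)
  have sT: "s \<in> T" using step by (simp add: q_supp)
  have le: "tailp 0 * ennreal (pmf q s) * (\<integral>\<^sup>+\<omega>. inf_hits (x \<otimes> s) b \<omega> \<partial>N) \<le> (\<integral>\<^sup>+\<omega>. inf_hits x b \<omega> \<partial>N)" for b
  proof -
    have "tailp 0 * (ennreal (pmf q s) * (\<integral>\<^sup>+\<omega>. inf_hits (x \<otimes> s) b \<omega> \<partial>N)) \<le> tailp 0 * (\<Sum>s\<in>T. ennreal (pmf q s) * (\<integral>\<^sup>+\<omega>. inf_hits (x \<otimes> s) b \<omega> \<partial>N))"
      using sT by (intro mult_left_mono member_le_sum) auto
    also have "\<dots> = (\<integral>\<^sup>+\<omega>. indicator {\<omega>. 0 < fst (\<omega> [])} \<omega> * inf_hits (x \<otimes> inc (child 0 \<omega>)) b (child 0 \<omega>) \<partial>N)"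
      by (rule nn_integral_child[symmetric, where g = "\<lambda>s. inf_hits (x \<otimes> s) b"]) (use step in \<open>auto intro!: measurable_bad2\<close>)
    also have "\<dots> \<le> (\<integral>\<^sup>+\<omega>. inf_hits x b \<omega> \<partial>N)"
    proof (intro nn_integral_mono)
      fix \<omega>
      let ?y = "x \<otimes> inc (child 0 \<omega>)"
      have "finite {l. tree l (child 0 \<omega>) \<and> in_trace b (?y \<otimes> site l (child 0 \<omega>))}"
        if f: "finite {l. tree l \<omega> \<and> in_trace b (x \<otimes> site l \<omega>)}" and k: "0 < fst (\<omega> [])"
      proof -
        have "(#) 0 ` {l. tree l (child 0 \<omega>) \<and> in_trace b (?y \<otimes> site l (child 0 \<omega>))} \<subseteq> {l. tree l \<omega> \<and> in_trace b (x \<otimes> site l \<omega>)}"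
          using k step by (auto simp: m_assoc)
        from finite_subset[OF this f] show ?thesis by (rule finite_imageD) auto
      qed
      then show "indicator {\<omega>. 0 < fst (\<omega> [])} \<omega> * inf_hits ?y b (child 0 \<omega>) \<le> inf_hits x b \<omega>"
        unfolding inf_hits_def n_hits_finite_iff by (auto simp: indicator_def)
    qed
    finally show ?thesis by (simp add: mult.assoc)
  qed
  have "tailp 0 * ennreal (pmf q s) * (\<integral>\<^sup>+b. \<integral>\<^sup>+\<omega>. inf_hits (x \<otimes> s) b \<omega> \<partial>N \<partial>N) \<le> (\<integral>\<^sup>+b. \<integral>\<^sup>+\<omega>. inf_hits x b \<omega> \<partial>N \<partial>N)"
  proof -
    have "x \<otimes> s \<in> C" using step sT by auto
    then have "tailp 0 * ennreal (pmf q s) * (\<integral>\<^sup>+b. \<integral>\<^sup>+\<omega>. inf_hits (x \<otimes> s) b \<omega> \<partial>N \<partial>N)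
       = (\<integral>\<^sup>+b. tailp 0 * ennreal (pmf q s) * (\<integral>\<^sup>+\<omega>. inf_hits (x \<otimes> s) b \<omega> \<partial>N) \<partial>N)"
      by (intro nn_integral_cmult[symmetric] measurable_bad1)
    also have "\<dots> \<le> (\<integral>\<^sup>+b. \<integral>\<^sup>+\<omega>. inf_hits x b \<omega> \<partial>N \<partial>N)" by (intro nn_integral_mono le)
    finally show ?thesis .
  qed
  also have "\<dots> = 0" using step by simp
  finally show ?case using pk0_pos pmf_T_pos[OF sT] by simp
qed

text \<open>The two subtrees start at random vertices, so finiteness is wanted for all relative
  displacements \<open>x\<close> at once; there are countably many.\<close>

lemma AE_parallel:
  "AE \<omega> in N. \<forall>a b. parallel a b \<longrightarrow> (\<forall>x\<in>C. finite {l. tree l (desc a \<omega>) \<and> in_trace (desc b \<omega>) (x \<otimes> site l (desc a \<omega>))})"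
  unfolding AE_all_countable
proof (intro allI)
  fix a b :: "nat list"
  show "AE \<omega> in N. parallel a b \<longrightarrow> (\<forall>x\<in>C. finite {l. tree l (desc a \<omega>) \<and> in_trace (desc b \<omega>) (x \<otimes> site l (desc a \<omega>))})"
  proof (cases "parallel a b")
    case ab: True
    have "AE \<omega> in N. \<forall>x\<in>C. inf_hits x (desc b \<omega>) (desc a \<omega>) = 0"
    proof (subst AE_ball_countable[OF countable_C], intro ballI)
      fix x assume x: "x \<in> C"
      have F: "(\<lambda>w. inf_hits x (fst w) (snd w)) \<in> borel_measurable M2" by (rule measurable_inf_hits[OF x])
      have "(\<integral>\<^sup>+\<omega>. inf_hits x (desc b \<omega>) (desc a \<omega>) \<partial>N) = (\<integral>\<^sup>+w. inf_hits x (fst w) (snd w) \<partial>M2)"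
        using nn_integral_parallel[OF F ab] by simp
      also have "\<dots> = (\<integral>\<^sup>+b. \<integral>\<^sup>+\<omega>. inf_hits x b \<omega> \<partial>N \<partial>N)"
        using F by (subst N.nn_integral_fst[symmetric]) auto
      also have "\<dots> = 0" by (rule inf_hits_zero[OF x])
      finally have "(\<integral>\<^sup>+\<omega>. inf_hits x (desc b \<omega>) (desc a \<omega>) \<partial>N) = 0" .
      moreover have "(\<lambda>\<omega>. inf_hits x (desc b \<omega>) (desc a \<omega>)) \<in> borel_measurable N"
        using measurable_compose[OF _ F, of "\<lambda>\<omega>. (desc b \<omega>, desc a \<omega>)" N] by simp
      ultimately show "AE \<omega> in N. inf_hits x (desc b \<omega>) (desc a \<omega>) = 0"
        by (subst (asm) nn_integral_0_iff_AE) auto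
    qed
    then show ?thesis
      by eventually_elim (auto simp: inf_hits_def n_hits_finite_iff[simplified] split: if_splits)
  qed simp
qed

text \<open>The expected number of edge ends at \<open>x\<close> is \<open>1 + m\<close> times the
  Green function at \<open>m\<close>, hence finite.\<close>

lemma AE_transient: "AE \<omega> in N. \<forall>x\<in>C. finite {l. tree l \<omega> \<and> site l \<omega> = x}"
proof (subst AE_ball_countable[OF countable_C], intro ballI)
  fix x assume x: "x \<in> C"
  have "(\<integral>\<^sup>+\<omega>. edges \<omega> (indicator {x}) \<partial>N) = ennreal (1 + m) * green (ennreal m) x"
    using x by (simp add: edges_expect stpn_indicator green_def)
  also have "\<dots> < \<infinity>" using green_m_finite[OF x] by (simp add: ennreal_mult_less_top)
  finally have "AE \<omega> in N. edges \<omega> (indicator {x}) \<noteq> \<infinity>"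
    by (intro nn_integral_PInf_AE) auto
  then show "AE \<omega> in N. finite {l. tree l \<omega> \<and> site l \<omega> = x}"
  proof eventually_elim
    case (elim \<omega>)
    let ?L = "{l. l \<noteq> [] \<and> tree l \<omega> \<and> site l \<omega> = x}"
    have "emeasure (count_space {l. l \<noteq> []}) ?L = (\<integral>\<^sup>+l. indicator ?L l \<partial>count_space {l. l \<noteq> []})"
      by (subst nn_integral_indicator) auto
    also have "\<dots> \<le> edges \<omega> (indicator {x})"
      unfolding edges_def by (intro add_increasing nn_integral_mono) (auto simp: indicator_def)
    finally have "emeasure (count_space {l. l \<noteq> []}) ?L \<noteq> \<infinity>" using elim by (auto simp: top_unique)
    moreover have "?L \<subseteq> {l. l \<noteq> []}" by auto
    ultimately have "finite ?L" using emeasure_count_space_infinite by blast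
    moreover have "{l. tree l \<omega> \<and> site l \<omega> = x} \<subseteq> insert [] ?L" by auto
    ultimately show ?case by (meson finite_insert finite_subset)
  qed
qed

lemma AE_coord: "AE \<omega> in N. \<forall>u. 0 < fst (\<omega> u) \<and> snd (\<omega> u) \<in> T"
  unfolding AE_all_countable
proof
  fix u :: "nat list"
  have "AE c in measure_pmf (pair_pmf \<mu> q). 0 < fst c \<and> snd c \<in> T"
  proof (rule AE_pmfI)
    fix c assume "c \<in> set_pmf (pair_pmf \<mu> q)"
    then have "fst c \<in> set_pmf \<mu>" "snd c \<in> T" by (auto simp: set_pair_pmf)
    then show "0 < fst c \<and> snd c \<in> T" using mu0 by (metis gr0I pmf_eq_0_set_pmf)
  qed
  then show "AE \<omega> in N. 0 < fst (\<omega> u) \<and> snd (\<omega> u) \<in> T"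
    unfolding brw_space_def by (intro AE_PiM_component) (auto intro: prob_space_measure_pmf)
qed

text \<open>Follow first children from \<open>u\<close>. If \<open>p\<close> is the probability that
  this line never branches, then \<open>p + tailp 1 * p \<le> p\<close>: its first vertex must not
  branch, and the subtree of the first child has the same law.\<close>

lemma AE_branch: "AE \<omega> in N. \<forall>u. \<exists>n. 2 \<le> fst (\<omega> (u @ replicate n 0))"
  unfolding AE_all_countable
proof
  fix u :: "nat list"
  define Fb where "Fb \<omega> = (if \<exists>n. 2 \<le> fst (\<omega> (replicate n 0)) then 0 else 1 :: ennreal)" for \<omega> :: "nat list \<Rightarrow> nat \<times> 'a"
  have m [measurable]: "Fb \<in> borel_measurable N"
    unfolding Fb_def by measurable
  define p where "p = (\<integral>\<^sup>+\<omega>. Fb \<omega> \<partial>N)"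
  have p1: "p \<le> 1"
  proof -
    have "p \<le> (\<integral>\<^sup>+\<omega>. 1 \<partial>N)" unfolding p_def Fb_def by (intro nn_integral_mono) auto
    then show ?thesis by (simp add: N.emeasure_space_1[simplified])
  qed
  have dec: "Fb \<omega> + indicator {k. 1 < k} (fst (\<omega> [])) * Fb (child 0 \<omega>) \<le> Fb (child 0 \<omega>)" for \<omega>
  proof -
    have "2 \<le> fst (\<omega> []) \<Longrightarrow> \<exists>n. 2 \<le> fst (\<omega> (replicate n 0))" by (rule exI[of _ 0]) simp
    moreover have "\<exists>n. 2 \<le> fst (child 0 \<omega> (replicate n 0)) \<Longrightarrow> \<exists>n. 2 \<le> fst (\<omega> (replicate n 0))"
      unfolding child_def by (metis replicate_Suc)
    ultimately show ?thesis by (auto simp: Fb_def indicator_def)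
  qed
  have s: "(\<integral>\<^sup>+\<omega>. Fb (child 0 \<omega>) \<partial>N) = p"
    using nn_integral_desc[OF m, of "[0]"] by (simp add: p_def desc_Cons)
  have t: "(\<integral>\<^sup>+\<omega>. indicator {k. 1 < k} (fst (\<omega> [])) * Fb (child 0 \<omega>) \<partial>N) = tailp 1 * p"
  proof -
    have "(\<integral>\<^sup>+\<omega>. indicator {k. 1 < k} (fst (\<omega> [])) * Fb (child 0 \<omega>) \<partial>N)
        = (\<integral>\<^sup>+\<omega>. \<integral>\<^sup>+\<eta>. indicator {k. 1 < k} (fst (\<omega> [])) * Fb \<eta> \<partial>N \<partial>N)"
      by (subst nn_integral_plug[where i = 0]) auto
    also have "\<dots> = (\<integral>\<^sup>+\<omega>. indicator {k. 1 < k} (fst (\<omega> [])) \<partial>N) * p"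
      by (simp add: nn_integral_cmult nn_integral_multc p_def)
    also have "(\<integral>\<^sup>+\<omega>. indicator {k. 1 < k} (fst (\<omega> [])) \<partial>N) = tailp 1"
      by (subst nn_integral_root) (simp add: tailp_def)
    finally show ?thesis .
  qed
  have "p + tailp 1 * p = (\<integral>\<^sup>+\<omega>. Fb \<omega> + indicator {k. 1 < k} (fst (\<omega> [])) * Fb (child 0 \<omega>) \<partial>N)"
    unfolding t[symmetric] unfolding p_def by (rule nn_integral_add[symmetric]) measurable
  also have "\<dots> \<le> p" unfolding s[symmetric] by (intro nn_integral_mono dec)
  finally have "p + tailp 1 * p \<le> p + 0" by simp
  moreover have "p < \<infinity>" using p1 by (simp add: le_less_trans)
  ultimately have "tailp 1 * p = 0" using ennreal_add_left_cancel_le[of p "tailp 1 * p" 0] by auto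
  then have "p = 0" using gain_pos by (auto simp: gain_def)
  then have "(\<integral>\<^sup>+\<omega>. Fb (desc u \<omega>) \<partial>N) = 0" by (simp add: nn_integral_desc p_def)
  then have "AE \<omega> in N. Fb (desc u \<omega>) = 0" by (subst (asm) nn_integral_0_iff_AE) auto
  then show "AE \<omega> in N. \<exists>n. 2 \<le> fst (\<omega> (u @ replicate n 0))"
    by eventually_elim (auto simp: Fb_def desc_def split: if_splits)
qed

lemma in_tree_iff: "in_tree \<omega> u \<longleftrightarrow> tree u \<omega>"
proof (induction u arbitrary: \<omega>)
  case (Cons i u)
  have "in_tree \<omega> (i # u) \<longleftrightarrow> i < fst (\<omega> []) \<and> in_tree (child i \<omega>) u"
    by (auto simp: in_tree_def child_def less_Suc_eq_0_disj)
  then show ?case using Cons by simp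
qed (simp add: in_tree_def)

lemma brw_pos_eq: "(\<And>u. snd (\<omega> u) \<in> T) \<Longrightarrow> brw_pos G \<omega> u = site u \<omega>"
proof (induction u arbitrary: \<omega>)
  case (Cons i u)
  have fl: "x \<in> C \<Longrightarrow> foldl (\<lambda>x j. x \<otimes> f j) x js = x \<otimes> foldl (\<lambda>x j. x \<otimes> f j) \<one> js" if f: "\<And>j. f j \<in> C" for f and js :: "nat list" and x
  proof (induction js arbitrary: x)
    case (Cons j js)
    have 1: "foldl (\<lambda>x j. x \<otimes> f j) \<one> js \<in> C" using f
      by (induction js rule: rev_induct) auto
    show ?case using Cons.IH[of "x \<otimes> f j"] Cons.IH[of "f j"] Cons.prems f 1 by (simp add: m_assoc)
  qed simp
  have u: "[0..<length (i # u)] = 0 # map Suc [0..<length u]" by (simp only: map_Suc_upt list.size add_Suc_right add_0_right upt_conv_Cons zero_less_Suc)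
  have "brw_pos G \<omega> (i # u) = foldl (\<lambda>x j. x \<otimes> snd (child i \<omega> (take (Suc j) u))) (\<one> \<otimes> snd (\<omega> [i])) [0..<length u]"
    unfolding brw_pos_def u by (simp add: foldl_map child_def)
  also have "\<dots> = snd (\<omega> [i]) \<otimes> brw_pos G (child i \<omega>) u"
    unfolding brw_pos_def using Cons.prems by (subst fl) (auto simp: child_def)
  also have "brw_pos G (child i \<omega>) u = site u (child i \<omega>)" using Cons by (simp add: child_def)
  finally show ?case using Cons.prems by (simp add: inc_def child_def)
qed (simp add: brw_pos_def)

end

section \<open>Ends of the trace\<close>

text \<open>From each vertex jump to its last visit, then take the next step. Last visits exist
  because every vertex is visited finitely often, and no vertex can recur after its last
  visit.\<close>

lemma loop_erasure:
  fixes y :: "nat \<Rightarrow> 'v"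
  assumes E: "\<And>n. E (y n) (y (Suc n))" and fin: "\<And>x. finite {n. y n = x}"
  shows "\<exists>k. strict_mono k \<and> inj (\<lambda>n. y (k n)) \<and> (\<forall>n. E (y (k n)) (y (k (Suc n))))"
proof -
  define lst where "lst n = Max {j. y j = y n}" for n
  have lst: "y (lst n) = y n" "n \<le> lst n" "\<And>j. y j = y n \<Longrightarrow> j \<le> lst n" for n
    using Max_in[of "{j. y j = y n}"] Max_ge[of "{j. y j = y n}"] fin by (auto simp: lst_def)
  define k where "k = rec_nat (lst 0) (\<lambda>_ i. lst (Suc i))"
  have k: "k 0 = lst 0" "k (Suc n) = lst (Suc (k n))" for n by (simp_all add: k_def)
  have sm: "strict_mono k"
    by (rule strict_monoI_Suc) (use lst(2) in \<open>simp add: k Suc_le_lessD\<close>)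
  have max: "j \<le> k n" if "y j = y (k n)" for j n
    using that lst by (cases n) (simp_all add: k)
  have "inj (\<lambda>n. y (k n))"
  proof (rule injI)
    fix i j assume eq: "y (k i) = y (k j)"
    have "k i \<le> k j" "k j \<le> k i" using max[of "k i" j] max[of "k j" i] eq by auto
    then show "i = j" using sm by (simp add: strict_mono_eq)
  qed
  moreover have "E (y (k n)) (y (k (Suc n)))" for n using E[of "k n"] lst by (simp add: k)
  ultimately show ?thesis using sm by blast
qed

text \<open>The deterministic input for a single sample point: a leafless tree \<open>L\<close> of
  labels with positions \<open>X\<close>. Transience is \<open>X_finite\<close>; that disjoint
  subtrees meet finitely often is \<open>X_parallel\<close>.\<close>

locale tree_walk =
  fixes L :: "nat list set" and X :: "nat list \<Rightarrow> 'v"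
  assumes Nil_L: "[] \<in> L" and L_butlast: "\<And>u i. u @ [i] \<in> L \<Longrightarrow> u \<in> L"
    and L_extend: "\<And>u. u \<in> L \<Longrightarrow> u @ [0] \<in> L" and L_finite: "\<And>u. finite {i. u @ [i] \<in> L}"
    and X_finite: "\<And>x. finite {l \<in> L. X l = x}"
    and X_parallel: "\<And>a b. parallel a b \<Longrightarrow> finite (X ` {l \<in> L. prefix a l} \<inter> X ` {l \<in> L. prefix b l})"
    and L_branch: "\<And>u. u \<in> L \<Longrightarrow> \<exists>v w. v \<in> L \<and> w \<in> L \<and> prefix u v \<and> prefix u w \<and> parallel v w"
begin

definition V where "V = X ` L"
definition E where "E x y \<longleftrightarrow> (\<exists>u i. u @ [i] \<in> L \<and> {x, y} = {X u, X (u @ [i])})"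
definition branch where "branch a = X ` {l \<in> L. prefix a l}"
definition end_of where "end_of r = ray_equiv V E `` {r}"

lemma L_prefix: "l \<in> L \<Longrightarrow> prefix u l \<Longrightarrow> u \<in> L"
proof (induction l rule: rev_induct)
  case (snoc i l)
  then show ?case using L_butlast by (auto simp: prefix_snoc)
qed simp

lemma L_take: "l \<in> L \<Longrightarrow> take n l \<in> L"
  by (rule L_prefix) (auto simp: take_is_prefix)

lemma finite_level: "finite {l \<in> L. length l = n}"
proof (induction n)
  case (Suc n)
  have "{l \<in> L. length l = Suc n} \<subseteq> (\<Union>u\<in>{l \<in> L. length l = n}. (\<lambda>i. u @ [i]) ` {i. u @ [i] \<in> L})"
  proof
    fix l assume l: "l \<in> {l \<in> L. length l = Suc n}"
    then obtain u i where "l = u @ [i]" by (cases l rule: rev_cases) auto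
    then show "l \<in> (\<Union>u\<in>{l \<in> L. length l = n}. (\<lambda>i. u @ [i]) ` {i. u @ [i] \<in> L})"
      using l L_butlast by auto
  qed
  then show ?case by (rule finite_subset) (use Suc L_finite in auto)
qed simp

lemma finite_levels: "finite {l \<in> L. length l \<le> n}"
proof -
  have "{l \<in> L. length l \<le> n} = (\<Union>k\<le>n. {l \<in> L. length l = k})" by auto
  then show ?thesis using finite_level by simp
qed

lemma E_sym: "E x y \<Longrightarrow> E y x" unfolding E_def by (metis insert_commute)
lemma E_edge: "u @ [i] \<in> L \<Longrightarrow> E (X u) (X (u @ [i]))" unfolding E_def by blast

lemma conn_sym: "conn_in W E x y \<Longrightarrow> conn_in W E y x"
proof -
  assume a: "conn_in W E x y"
  have "(\<lambda>a b. a \<in> W \<and> b \<in> W \<and> E a b)\<^sup>*\<^sup>* x y \<Longrightarrow> (\<lambda>a b. a \<in> W \<and> b \<in> W \<and> E a b)\<^sup>*\<^sup>* y x"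
    by (induction rule: rtranclp_induct) (auto intro: converse_rtranclp_into_rtranclp E_sym)
  then show ?thesis using a by (auto simp: conn_in_def)
qed

lemma conn_trans: "conn_in W E x y \<Longrightarrow> conn_in W E y z \<Longrightarrow> conn_in W E x z"
  by (auto simp: conn_in_def)

lemma conn_refl: "x \<in> W \<Longrightarrow> conn_in W E x x" by (simp add: conn_in_def)

lemma conn_edge: "x \<in> W \<Longrightarrow> y \<in> W \<Longrightarrow> E x y \<Longrightarrow> conn_in W E x y" by (auto simp: conn_in_def)

lemma ray_tail:
  assumes r: "is_ray V E r" and F: "finite F"
  shows "\<exists>N. \<forall>n\<ge>N. \<forall>m\<ge>N. conn_in (V - F) E (r n) (r m)"
proof -
  have "finite (r -` F)" using r F by (intro finite_vimageI) (auto simp: is_ray_def)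
  then obtain N where N: "\<forall>n\<in>r -` F. n < N" using finite_nat_set_iff_bounded by blast
  have off: "r n \<in> V - F" if "N \<le> n" for n using N that r by (auto simp: is_ray_def dest: bspec)
  have up: "conn_in (V - F) E (r N) (r n)" if "N \<le> n" for n
    using that
  proof (induction rule: dec_induct)
    case base show ?case using off by (simp add: conn_refl)
  next
    case (step n)
    have "conn_in (V - F) E (r n) (r (Suc n))"
      using step off r by (intro conn_edge) (auto simp: is_ray_def)
    then show ?case using step conn_trans by blast
  qed
  show ?thesis using up conn_sym conn_trans by blast
qed

lemma ray_equiv_refl: "is_ray V E r \<Longrightarrow> (r, r) \<in> ray_equiv V E"
  unfolding ray_equiv_def using ray_tail by blast

lemma end_of_in: "is_ray V E r \<Longrightarrow> r \<in> end_of r" using ray_equiv_refl by (auto simp: end_of_def)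

lemma end_of_end: "is_ray V E r \<Longrightarrow> end_of r \<in> graph_ends V E"
  unfolding graph_ends_def end_of_def by (intro quotientI) simp

lemma end_end_of: "w \<in> graph_ends V E \<Longrightarrow> \<exists>r. is_ray V E r \<and> w = end_of r"
  unfolding graph_ends_def end_of_def by (auto elim!: quotientE)

lemma branch_mono: "prefix u v \<Longrightarrow> branch v \<subseteq> branch u" unfolding branch_def by (auto intro: prefix_order.trans)

text \<open>Loop erasure of a line of descent. The times kept satisfy \<open>k n \<ge> n\<close>, so
  the ray enters each branch along the line no later than the line itself.\<close>

lemma line_ray:
  assumes \<phi>: "\<And>n. \<phi> n \<in> L" "\<And>n. \<exists>i. \<phi> (Suc n) = \<phi> n @ [i]"
  shows "\<exists>r. is_ray V E r \<and> (\<forall>N n. N \<le> n \<longrightarrow> r n \<in> branch (\<phi> N))"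
proof -
  have len: "length (\<phi> n) = length (\<phi> 0) + n" for n
  proof (induction n)
    case (Suc n) then show ?case using \<phi>(2)[of n] by auto
  qed simp
  have inj: "inj \<phi>" by (rule injI) (metis len add_left_cancel)
  have pre: "prefix (\<phi> N) (\<phi> n)" if "N \<le> n" for N n
    using that
  proof (induction rule: dec_induct)
    case (step n) then show ?case using \<phi>(2)[of n] by (auto simp: prefix_def)
  qed simp
  have E1: "E (X (\<phi> n)) (X (\<phi> (Suc n)))" for n
    using \<phi>(2)[of n] \<phi>(1)[of "Suc n"] E_edge by auto
  have fin: "finite {n. X (\<phi> n) = x}" for x
  proof -
    have "\<phi> ` {n. X (\<phi> n) = x} \<subseteq> {l \<in> L. X l = x}" using \<phi> by auto
    then have "finite (\<phi> ` {n. X (\<phi> n) = x})" using X_finite finite_subset by blast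
    then show ?thesis by (rule finite_imageD) (use inj inj_on_subset in blast)
  qed
  obtain k where k: "strict_mono k" "inj (\<lambda>n. X (\<phi> (k n)))" "\<And>n. E (X (\<phi> (k n))) (X (\<phi> (k (Suc n))))"
    using loop_erasure[of E "\<lambda>n. X (\<phi> n)"] E1 fin by blast
  let ?r = "\<lambda>n. X (\<phi> (k n))"
  have "is_ray V E ?r" using k \<phi>(1) by (auto simp: is_ray_def V_def)
  moreover have "?r n \<in> branch (\<phi> N)" if "N \<le> n" for N n
  proof -
    have "N \<le> k n" using that strict_mono_imp_increasing[OF k(1), of n] by simp
    then show ?thesis using pre \<phi>(1) by (auto simp: branch_def)
  qed
  ultimately show ?thesis by blast
qed

lemma ray_in:
  assumes "v \<in> L" shows "\<exists>r. is_ray V E r \<and> (\<forall>n. r n \<in> branch v)"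
proof -
  have "v @ replicate n 0 \<in> L" for n
  proof (induction n)
    case (Suc n)
    have "v @ replicate (Suc n) 0 = (v @ replicate n 0) @ [0]" by (simp add: replicate_append_same)
    then show ?case by (simp only: L_extend[OF Suc])
  qed (use assms in simp)
  moreover have "\<exists>i. v @ replicate (Suc n) 0 = (v @ replicate n 0) @ [i]" for n
    by (simp add: replicate_append_same[symmetric])
  ultimately obtain r where "is_ray V E r" "\<forall>N n. N \<le> n \<longrightarrow> r n \<in> branch (v @ replicate N 0)"
    using line_ray[of "\<lambda>n. v @ replicate n 0"] by blast
  then show ?thesis by (metis append_Nil2 replicate_0 zero_le)
qed

definition outer where "outer v = X ` {l \<in> L. \<not> prefix v l}"

text \<open>A label not below \<open>v\<close> is a proper prefix of \<open>v\<close> or lies below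
  a sibling of some vertex on the path to \<open>v\<close>. Prefixes and siblings are finite in
  number, and each sibling's branch meets that of \<open>v\<close> finitely often.\<close>

lemma finite_boundary: "finite (branch v \<inter> outer v)"
proof -
  let ?P = "{take j v |j. j < length v}"
  let ?Q = "\<Union>j<length v. (\<lambda>i. take j v @ [i]) ` {i. take j v @ [i] \<in> L \<and> i \<noteq> v ! j}"
  have "finite ?Q"
  proof (intro finite_UN_I finite_imageI)
    show "finite {i. take j v @ [i] \<in> L \<and> i \<noteq> v ! j}" for j
      by (rule finite_subset[OF _ L_finite[of "take j v"]]) auto
  qed simp
  moreover have par: "parallel v a" if a: "a \<in> ?Q" for a
  proof -
    obtain j i where j: "j < length v" "a = take j v @ [i]" "i \<noteq> v ! j" using a by auto
    then have "v = take j v @ v ! j # drop (Suc j) v" by (simp add: id_take_nth_drop)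
    then show ?thesis using j
      by (metis parallel_append not_equal_is_parallel parallelE parallelI Cons_prefix_Cons same_prefix_prefix)
  qed
  ultimately have "finite (\<Union>a\<in>?Q. branch v \<inter> branch a)"
    using X_parallel unfolding branch_def by (intro finite_UN_I) auto
  moreover have "finite (X ` ?P)" by simp
  moreover have "branch v \<inter> outer v \<subseteq> X ` ?P \<union> (\<Union>a\<in>?Q. branch v \<inter> branch a)"
  proof
    fix x assume x: "x \<in> branch v \<inter> outer v"
    then obtain l where l: "l \<in> L" "\<not> prefix v l" "x = X l" by (auto simp: outer_def)
    show "x \<in> X ` ?P \<union> (\<Union>a\<in>?Q. branch v \<inter> branch a)"
    proof (cases "prefix l v")
      case True
      then have "l = take (length l) v" "length l < length v"
        using l by (auto simp: prefix_def)
      then show ?thesis using l by blast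
    next
      case False
      then have "parallel v l" using l by auto
      then obtain as b bs c cs where d: "b \<noteq> c" "v = as @ b # bs" "l = as @ c # cs"
        using parallel_decomp by blast
      then have as: "as = take (length as) v" "length as < length v" "v ! length as = b" by auto
      have "prefix (as @ [c]) l" using d by (auto simp: prefix_def)
      then have "as @ [c] \<in> L" "X l \<in> branch (as @ [c])" using l L_prefix by (auto simp: branch_def)
      moreover from this have "as @ [c] \<in> ?Q" using as d by (intro UN_I[of "length as"]) auto
      ultimately show ?thesis using x l by blast
    qed
  qed
  ultimately show ?thesis by (meson finite_UnI finite_subset)
qed

text \<open>Once the boundary of \<open>branch v\<close> and the vertex \<open>X v\<close> are
  removed, no edge leads out of the branch: its end inside would also carry a label outside the
  subtree, or be \<open>X v\<close>.\<close>

lemma separated: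
  assumes vw: "parallel v w" and r: "\<And>n. N \<le> n \<Longrightarrow> r n \<in> branch v" and r': "\<And>n. N' \<le> n \<Longrightarrow> r' n \<in> branch w"
  shows "(r, r') \<notin> ray_equiv V E"
proof
  assume eq: "(r, r') \<in> ray_equiv V E"
  define F where "F = insert (X v) (branch v \<inter> outer v)"
  have "finite F" using finite_boundary by (simp add: F_def)
  then obtain M where M: "\<forall>n\<ge>M. \<forall>m\<ge>M. conn_in (V - F) E (r n) (r' m)"
    using eq by (auto simp: ray_equiv_def)
  define n where "n = max M (max N N')"
  have c: "conn_in (V - F) E (r n) (r' n)" using M by (simp add: n_def)
  have stay: "b \<in> branch v" if a: "a \<in> branch v" "a \<in> V - F" and b: "b \<in> V - F" and e: "E a b" for a b
  proof -
    obtain u i where u: "u @ [i] \<in> L" "{a, b} = {X u, X (u @ [i])}" using e by (auto simp: E_def)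
    have uL: "u \<in> L" using u L_butlast by blast
    have ao: "a \<notin> outer v" using a by (auto simp: F_def)
    have "prefix v u"
    proof (cases "a = X u")
      case True then show ?thesis using ao uL by (auto simp: outer_def)
    next
      case False
      then have au: "a = X (u @ [i])" using u by (auto simp: doubleton_eq_iff)
      then have "prefix v (u @ [i])" using ao u by (auto simp: outer_def)
      moreover have "v \<noteq> u @ [i]" using au a by (auto simp: F_def)
      ultimately show ?thesis by (simp add: prefix_snoc)
    qed
    then have "X u \<in> branch v" "X (u @ [i]) \<in> branch v" using uL u by (auto simp: branch_def prefix_snoc)
    then show ?thesis using u by (auto simp: doubleton_eq_iff)
  qed
  have "(\<lambda>a b. a \<in> V - F \<and> b \<in> V - F \<and> E a b)\<^sup>*\<^sup>* (r n) (r' n)" using c by (simp add: conn_in_def)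
  then have "r' n \<in> branch v"
  proof (induction rule: rtranclp_induct)
    case base show ?case using r by (simp add: n_def)
  next
    case (step y z) then show ?case using stay by blast
  qed
  moreover have "r' n \<in> outer v"
  proof -
    have "r' n \<in> branch w" using r' by (simp add: n_def)
    then obtain l where l: "l \<in> L" "prefix w l" "r' n = X l" by (auto simp: branch_def)
    have "\<not> prefix v l" using vw l(2) prefix_same_cases by blast
    then show ?thesis using l by (auto simp: outer_def)
  qed
  ultimately have "r' n \<in> F" by (simp add: F_def)
  then show False using c by (auto simp: conn_in_def)
qed

lemma end_of_neq:
  assumes "parallel v w" "is_ray V E r'" "\<And>n. N \<le> n \<Longrightarrow> r n \<in> branch v" "\<And>n. N' \<le> n \<Longrightarrow> r' n \<in> branch w"
  shows "end_of r \<noteq> end_of r'"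
  using separated[OF assms(1), of N r N' r', OF assms(3,4)] end_of_in[OF assms(2)] by (auto simp: end_of_def)

lemma subtree_conn:
  assumes "branch u \<inter> F = {}" "u \<in> L" "l \<in> L" "prefix u l"
  shows "conn_in (V - F) E (X u) (X l)"
proof -
  obtain z where z: "l = u @ z" using assms by (auto simp: prefix_def)
  have "u @ z \<in> L \<Longrightarrow> conn_in (V - F) E (X u) (X (u @ z))"
  proof (induction z rule: rev_induct)
    case Nil
    have "X u \<in> V - F" using assms(1,2) by (auto simp: V_def branch_def)
    then show ?case by (simp add: conn_refl)
  next
    case (snoc i z)
    then have uz: "u @ z \<in> L" using L_butlast[of "u @ z" i] by simp
    have "X (u @ z) \<in> branch u" "X (u @ z @ [i]) \<in> branch u"
      using uz snoc.prems by (auto simp: branch_def)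
    then have "X (u @ z) \<in> V - F" "X (u @ z @ [i]) \<in> V - F"
      using assms(1) uz snoc.prems by (auto simp: V_def)
    moreover have "E (X (u @ z)) (X (u @ z @ [i]))" using E_edge[of "u @ z" i] snoc.prems by simp
    ultimately show ?case by (intro conn_trans[OF snoc.IH[OF uz]] conn_edge)
  qed
  then show ?thesis using assms z by simp
qed

text \<open>Some subtree, reached by the ray, is so deep that its image misses \<open>F\<close>. It
  is joined to the ray off \<open>F\<close>, so two separated rays inside it would both represent
  \<open>w\<close>.\<close>

theorem not_isolated: "\<not> isolated_end V E w"
proof
  assume "isolated_end V E w"
  then obtain F where w: "w \<in> graph_ends V E" and F: "finite F" and iso: "end_nbhd V E F w \<subseteq> {w}"
    by (auto simp: isolated_end_def)
  obtain r where r: "is_ray V E r" "w = end_of r" using end_end_of[OF w] by blast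
  have "{l \<in> L. X l \<in> F} = (\<Union>x\<in>F. {l \<in> L. X l = x})" by auto
  then have "finite {l \<in> L. X l \<in> F}" using F X_finite by simp
  then have "finite (length ` {l \<in> L. X l \<in> F})" by simp
  then obtain n1 where "\<forall>k\<in>length ` {l \<in> L. X l \<in> F}. k < n1"
    using finite_nat_set_iff_bounded by blast
  then have n1: "\<And>l. l \<in> L \<Longrightarrow> X l \<in> F \<Longrightarrow> length l < n1" by auto
  obtain N where N: "\<forall>n\<ge>N. \<forall>m\<ge>N. conn_in (V - F) E (r n) (r m)" using ray_tail[OF r(1) F] by blast
  \<comment> \<open>The ray is injective and finitely many labels have length at most
    \<open>n1\<close>, so it eventually leaves their image.\<close>
  have "finite (r -` (X ` {l \<in> L. length l \<le> n1}))"
    using r finite_levels by (intro finite_vimageI finite_imageI) (auto simp: is_ray_def)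
  then obtain N2 where N2': "\<forall>n\<in>r -` (X ` {l \<in> L. length l \<le> n1}). n < N2" using finite_nat_set_iff_bounded by blast
  have N2: "r (max N N2) \<notin> X ` {l \<in> L. length l \<le> n1}"
  proof
    assume "r (max N N2) \<in> X ` {l \<in> L. length l \<le> n1}"
    then have "max N N2 < N2" using N2' by blast
    then show False by simp
  qed
  obtain l where l: "l \<in> L" "r (max N N2) = X l" using r by (auto simp: is_ray_def V_def)
  then have ll: "n1 < length l" using N2 by (auto simp: not_le)
  define u where "u = take n1 l"
  have u: "u \<in> L" "prefix u l" "length u = n1" using l ll L_take by (auto simp: u_def take_is_prefix)
  have disj: "branch u \<inter> F = {}"
  proof (rule ccontr)
    assume "branch u \<inter> F \<noteq> {}"
    then obtain l' where "l' \<in> L" "prefix u l'" "X l' \<in> F" by (auto simp: branch_def)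
    then show False using n1[of l'] u prefix_length_le[of u l'] by auto
  qed
  have nb: "end_of r' \<in> end_nbhd V E F w" if r': "is_ray V E r'" "\<And>n. r' n \<in> branch u" for r'
  proof -
    have "conn_in (V - F) E (r n) (r' k)" if "N \<le> n" for n k
    proof -
      have 1: "conn_in (V - F) E (r n) (X l)" using N that l by (metis max.cobounded1)
      have 2: "conn_in (V - F) E (X l) (X u)" using subtree_conn[OF disj u(1) l(1) u(2)] by (rule conn_sym)
      obtain l' where "l' \<in> L" "prefix u l'" "r' k = X l'" using r'(2)[of k] by (auto simp: branch_def)
      then have 3: "conn_in (V - F) E (X u) (r' k)" using subtree_conn[OF disj u(1)] by auto
      show ?thesis using 1 2 3 conn_trans by blast
    qed
    then show ?thesis
      unfolding end_nbhd_def using end_of_end[OF r'(1)] end_of_in[OF r'(1)] end_of_in[OF r(1)] r(2) by blast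
  qed
  obtain v v' where v: "v \<in> L" "v' \<in> L" "prefix u v" "prefix u v'" "parallel v v'"
    using L_branch[OF u(1)] by blast
  obtain r1 where r1: "is_ray V E r1" "\<And>n. r1 n \<in> branch v" using ray_in[OF v(1)] by blast
  obtain r2 where r2: "is_ray V E r2" "\<And>n. r2 n \<in> branch v'" using ray_in[OF v(2)] by blast
  have "end_of r1 \<noteq> end_of r2" using r1(2) r2(2) by (intro end_of_neq[OF v(5) r2(1), of 0 _ 0]) auto
  moreover have "end_of r1 = w" using nb[OF r1(1)] r1(2) branch_mono[OF v(3)] iso by blast
  moreover have "end_of r2 = w" using nb[OF r2(1)] r2(2) branch_mono[OF v(4)] iso by blast
  ultimately show False by simp
qed

text \<open>Labels are countable, so a representing ray is coded by the set of its pairs of index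
  and label.\<close>

lemma ends_lepoll: "graph_ends V E \<lesssim> (UNIV :: nat set set)"
proof -
  define g where "g w = (SOME r. is_ray V E r \<and> w = end_of r)" for w
  have g: "is_ray V E (g w)" "w = end_of (g w)" if "w \<in> graph_ends V E" for w
    using someI_ex[OF end_end_of[OF that]] by (auto simp: g_def)
  define lab where "lab x = (SOME l. X l = x)" for x
  have lab: "X (lab x) = x" if "x \<in> V" for x
    using that unfolding lab_def by (metis (mono_tags) V_def imageE someI)
  define code where "code r = range (\<lambda>n. prod_encode (n, to_nat (lab (r n :: 'v))))" for r
  have "inj_on (\<lambda>w. code (g w)) (graph_ends V E)"
  proof (rule inj_onI)
    fix w w' assume w: "w \<in> graph_ends V E" "w' \<in> graph_ends V E" and eq: "code (g w) = code (g w')"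
    have "g w n = g w' n" for n
    proof -
      have "prod_encode (n, to_nat (lab (g w n))) \<in> code (g w')" using eq by (auto simp: code_def)
      then have "lab (g w n) = lab (g w' n)" by (auto simp: code_def)
      moreover have "g w n \<in> V" "g w' n \<in> V" using g w by (auto simp: is_ray_def)
      ultimately show ?thesis using lab by metis
    qed
    then have "g w = g w'" by auto
    then show "w = w'" using g w by metis
  qed
  then show ?thesis unfolding lepoll_def by blast
qed

text \<open>Embeds a binary tree: the set \<open>B\<close> prescribes the turns, and two sets first
  differing at \<open>n\<close> lead into parallel branches after \<open>n + 1\<close>
  turns.\<close>

lemma lepoll_ends: "(UNIV :: nat set set) \<lesssim> graph_ends V E"
proof -
  obtain f0 f1 where f: "\<And>u. u \<in> L \<Longrightarrow> f0 u \<in> L \<and> f1 u \<in> L \<and> prefix u (f0 u) \<and> prefix u (f1 u) \<and> parallel (f0 u) (f1 u)"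
    using L_branch by metis
  define nd where "nd B = rec_nat [] (\<lambda>n u. if n \<in> B then f1 u else f0 u)" for B
  have nd: "nd B 0 = []" "nd B (Suc n) = (if n \<in> B then f1 (nd B n) else f0 (nd B n))" for B n
    by (simp_all add: nd_def)
  have ndL: "nd B n \<in> L" for B n
    by (induction n) (use Nil_L f in \<open>auto simp: nd\<close>)
  have pre1: "prefix (nd B n) (nd B (Suc n))" for B n using f ndL by (auto simp: nd)
  have pre: "prefix (nd B n) (nd B k)" if "n \<le> k" for B n k
    using that by (induction rule: dec_induct) (auto intro: prefix_order.trans pre1)
  have strict: "strict_prefix u (f0 u)" "strict_prefix u (f1 u)" if "u \<in> L" for u
    using f[OF that] by (auto simp: strict_prefix_def)
  have len: "n \<le> length (nd B n)" for B n
  proof (induction n)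
    case (Suc n)
    have "strict_prefix (nd B n) (nd B (Suc n))" using strict[OF ndL] by (auto simp: nd)
    then show ?case using Suc prefix_length_less by fastforce
  qed simp
  \<comment> \<open>A step of \<open>nd\<close> may skip generations. Cutting \<open>nd B k\<close>
    to length \<open>k\<close>, which \<open>len\<close> allows, gives the line of descent through
    all \<open>nd B k\<close> with no generation omitted.\<close>
  define \<phi> where "\<phi> B k = take k (nd B k)" for B k
  have \<phi>L: "\<phi> B k \<in> L" for B k using L_take ndL by (simp add: \<phi>_def)
  have tk: "take j (nd B n) = take j (nd B k)" if "j \<le> n" "n \<le> k" for B j n k
    using pre[OF that(2), of B] len[of n B] that by (auto simp: prefix_def)
  have \<phi>S: "\<exists>i. \<phi> B (Suc k) = \<phi> B k @ [i]" for B k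
  proof -
    have "\<phi> B (Suc k) = take k (nd B (Suc k)) @ [nd B (Suc k) ! k]"
      using len[of "Suc k" B] by (simp add: \<phi>_def take_Suc_conv_app_nth)
    then show ?thesis using tk[of k k "Suc k" B] by (simp add: \<phi>_def)
  qed
  have "\<exists>r. is_ray V E r \<and> (\<forall>N n. N \<le> n \<longrightarrow> r n \<in> branch (\<phi> B N))" for B
    using line_ray[of "\<phi> B"] \<phi>L \<phi>S by blast
  then obtain \<rho> where \<rho>: "\<And>B. is_ray V E (\<rho> B)" "\<And>B N n. N \<le> n \<Longrightarrow> \<rho> B n \<in> branch (\<phi> B N)" by metis
  have \<rho>nd: "\<rho> B n \<in> branch (nd B k)" if "length (nd B k) \<le> n" for B n k
  proof -
    let ?N = "length (nd B k)"
    have "prefix (nd B k) (nd B ?N)" by (rule pre) (rule len)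
    then have "\<phi> B ?N = nd B k" by (auto simp: \<phi>_def prefix_def)
    then show ?thesis using \<rho>(2)[where B = B, OF that] by simp
  qed
  have "inj (\<lambda>B. end_of (\<rho> B))"
  proof (rule injI, rule ccontr)
    fix B B' assume eq: "end_of (\<rho> B) = end_of (\<rho> B')" and ne: "B \<noteq> B'"
    then have ex: "\<exists>n. (n \<in> B) \<noteq> (n \<in> B')" by auto
    define n where "n = (LEAST n. (n \<in> B) \<noteq> (n \<in> B'))"
    have n: "(n \<in> B) \<noteq> (n \<in> B')" unfolding n_def by (rule LeastI_ex[OF ex])
    have least: "(k \<in> B) = (k \<in> B')" if "k < n" for k using not_less_Least that unfolding n_def by blast
    have same: "k \<le> n \<Longrightarrow> nd B k = nd B' k" for k
      by (induction k) (use least in \<open>auto simp: nd\<close>)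
    have "parallel (nd B (Suc n)) (nd B' (Suc n))"
      using n same[of n] f[OF ndL[of B' n]] by (auto simp: nd)
    then have "end_of (\<rho> B) \<noteq> end_of (\<rho> B')"
      by (rule end_of_neq[OF _ \<rho>(1)]) (rule \<rho>nd, assumption)+
    then show False using eq by simp
  qed
  moreover have "(\<lambda>B. end_of (\<rho> B)) ` UNIV \<subseteq> graph_ends V E" using end_of_end \<rho>(1) by auto
  ultimately show ?thesis unfolding lepoll_def by blast
qed

theorem ends_continuum: "graph_ends V E \<approx> (UNIV :: real set)"
  using lepoll_antisym[OF ends_lepoll lepoll_ends] nat_sets_eqpoll_reals eqpoll_trans by blast

end

context brw begin

lemma tree_walk_trace:
  assumes coord: "\<forall>u. 0 < fst (\<omega> u) \<and> snd (\<omega> u) \<in> T"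
    and trans: "\<forall>x\<in>C. finite {l. tree l \<omega> \<and> site l \<omega> = x}"
    and par: "\<forall>a b. parallel a b \<longrightarrow> (\<forall>x\<in>C. finite {l. tree l (desc a \<omega>) \<and> in_trace (desc b \<omega>) (x \<otimes> site l (desc a \<omega>))})"
    and br: "\<forall>u. \<exists>n. 2 \<le> fst (\<omega> (u @ replicate n 0))"
  shows "tree_walk {l. tree l \<omega>} (\<lambda>l. site l \<omega>)"
proof
  have snoc: "tree (u @ [i]) \<omega> \<longleftrightarrow> tree u \<omega> \<and> i < fst (\<omega> u)" for u i
    by (simp add: tree_append desc_def)
  show "[] \<in> {l. tree l \<omega>}" by simp
  show "u \<in> {l. tree l \<omega>}" if "u @ [i] \<in> {l. tree l \<omega>}" for u i using that by (simp add: snoc)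
  show "u @ [0] \<in> {l. tree l \<omega>}" if "u \<in> {l. tree l \<omega>}" for u using that coord by (simp add: snoc)
  show "finite {i. u @ [i] \<in> {l. tree l \<omega>}}" for u by (simp add: snoc)
  show "finite {l \<in> {l. tree l \<omega>}. site l \<omega> = x}" for x
  proof (cases "x \<in> C")
    case True then show ?thesis using trans by simp
  next
    case False
    then have "{l \<in> {l. tree l \<omega>}. site l \<omega> = x} = {}" by auto
    then show ?thesis by (metis finite.emptyI)
  qed
  show "finite ((\<lambda>l. site l \<omega>) ` {l \<in> {l. tree l \<omega>}. prefix a l} \<inter> (\<lambda>l. site l \<omega>) ` {l \<in> {l. tree l \<omega>}. prefix b l})"
    if ab: "parallel a b" for a b
  proof -
    \<comment> \<open>The displacement from the start of the subtree at \<open>b\<close> to that of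
      the subtree at \<open>a\<close>; in \<open>par\<close> the former is read from the
      identity.\<close>
    let ?x = "inv (site b \<omega>) \<otimes> site a \<omega>"
    let ?J = "{l. tree l (desc a \<omega>) \<and> in_trace (desc b \<omega>) (?x \<otimes> site l (desc a \<omega>))}"
    have "finite ?J" using par ab by simp
    moreover have "(\<lambda>l. site l \<omega>) ` {l \<in> {l. tree l \<omega>}. prefix a l} \<inter> (\<lambda>l. site l \<omega>) ` {l \<in> {l. tree l \<omega>}. prefix b l}
        \<subseteq> (\<lambda>l. site (a @ l) \<omega>) ` ?J"
    proof
      fix y assume "y \<in> (\<lambda>l. site l \<omega>) ` {l \<in> {l. tree l \<omega>}. prefix a l} \<inter> (\<lambda>l. site l \<omega>) ` {l \<in> {l. tree l \<omega>}. prefix b l}"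
      then obtain l l' where l: "tree (a @ l) \<omega>" "y = site (a @ l) \<omega>" "tree (b @ l') \<omega>" "y = site (b @ l') \<omega>"
        by (auto simp: prefix_def)
      have "site b \<omega> \<otimes> site l' (desc b \<omega>) = site a \<omega> \<otimes> site l (desc a \<omega>)" using l by (simp add: site_append)
      then have "site l' (desc b \<omega>) = ?x \<otimes> site l (desc a \<omega>)"
        by (metis inv_closed inv_solve_left m_assoc m_closed site_C)
      then have "l \<in> ?J" using l by (auto simp: tree_append in_trace_def)
      then show "y \<in> (\<lambda>l. site (a @ l) \<omega>) ` ?J" using l by blast
    qed
    ultimately show ?thesis by (meson finite_imageI finite_subset)
  qed
  show "\<exists>v w. v \<in> {l. tree l \<omega>} \<and> w \<in> {l. tree l \<omega>} \<and> prefix u v \<and> prefix u w \<and> parallel v w"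
    if u: "u \<in> {l. tree l \<omega>}" for u
  proof -
    obtain n where n: "2 \<le> fst (\<omega> (u @ replicate n 0))" using br by blast
    have t: "tree (u @ replicate k 0) \<omega>" for k
    proof (induction k)
      case (Suc k)
      have "u @ replicate (Suc k) 0 = (u @ replicate k 0) @ [0]" by (simp add: replicate_append_same)
      then show ?case using snoc[of "u @ replicate k 0" 0] Suc coord by simp
    qed (use u in simp)
    let ?p = "u @ replicate n 0"
    have "tree (?p @ [0]) \<omega>" "tree (?p @ [1]) \<omega>" using t[of n] n snoc[of ?p] by auto
    moreover have "parallel (?p @ [0]) (?p @ [1])" by (simp add: parallel_def)
    moreover have "prefix u (?p @ [i])" for i by (simp add: prefix_def)
    ultimately show ?thesis by blast
  qed
qed

theorem trace_ends:
  "AE \<omega> in brw_space \<mu> q. graph_ends (trace_V G \<omega>) (trace_E G \<omega>) \<approx> (UNIV :: real set) \<and>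
     (\<forall>w\<in>graph_ends (trace_V G \<omega>) (trace_E G \<omega>). \<not> isolated_end (trace_V G \<omega>) (trace_E G \<omega>) w)"
  using AE_coord AE_transient AE_parallel AE_branch
proof eventually_elim
  case (elim \<omega>)
  interpret tree_walk "{l. tree l \<omega>}" "\<lambda>l. site l \<omega>"
    using elim by (rule tree_walk_trace)
  have pos: "brw_pos G \<omega> u = site u \<omega>" for u using elim(1) by (intro brw_pos_eq) blast
  have "trace_V G \<omega> = V" by (auto simp: trace_V_def V_def in_tree_iff pos)
  moreover have "trace_E G \<omega> = E" by (simp add: trace_E_def E_def in_tree_iff pos fun_eq_iff)
  ultimately show ?case using ends_continuum not_isolated by simp
qed

end

text \<open>Laziness: staying put for \<open>n\<close> steps is one way to return, so the return
  probability is at least \<open>q(1)^n\<close>.\<close>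

lemma spectral_radius_pos:
  assumes "group G" and one: "\<one>\<^bsub>G\<^esub> \<in> set_pmf q"
  shows "ennreal (pmf q \<one>\<^bsub>G\<^esub>) \<le> spectral_radius_rw G q"
proof -
  interpret group G by fact
  let ?c = "pmf q \<one>\<^bsub>G\<^esub>"
  have ge: "?c ^ n \<le> return_prob G q n" for n
  proof (induction n)
    case (Suc n)
    let ?f = "\<lambda>x. map_pmf (\<lambda>s. x \<otimes>\<^bsub>G\<^esub> s) q" and ?p = "rw_step_dist G q n"
    have c: "?c \<le> pmf (?f \<one>\<^bsub>G\<^esub>) \<one>\<^bsub>G\<^esub>"
      unfolding pmf_map by (subst measure_pmf_single[symmetric], intro measure_pmf.finite_measure_mono) auto
    have "ennreal (pmf ?p \<one>\<^bsub>G\<^esub> * pmf (?f \<one>\<^bsub>G\<^esub>) \<one>\<^bsub>G\<^esub>)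
        = (\<integral>\<^sup>+x. ennreal (pmf (?f \<one>\<^bsub>G\<^esub>) \<one>\<^bsub>G\<^esub>) * indicator {\<one>\<^bsub>G\<^esub>} x \<partial>measure_pmf ?p)"
      by (subst nn_integral_cmult) (simp_all add: emeasure_pmf_single ennreal_mult mult.commute)
    also have "\<dots> \<le> (\<integral>\<^sup>+x. ennreal (pmf (?f x) \<one>\<^bsub>G\<^esub>) \<partial>measure_pmf ?p)"
      by (intro nn_integral_mono) (auto simp: indicator_def)
    also have "\<dots> = ennreal (return_prob G q (Suc n))"
      by (simp add: return_prob_def ennreal_pmf_bind)
    finally have "pmf ?p \<one>\<^bsub>G\<^esub> * pmf (?f \<one>\<^bsub>G\<^esub>) \<one>\<^bsub>G\<^esub> \<le> return_prob G q (Suc n)"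
      by (simp add: return_prob_def)
    moreover have "?c ^ n * ?c \<le> pmf ?p \<one>\<^bsub>G\<^esub> * pmf (?f \<one>\<^bsub>G\<^esub>) \<one>\<^bsub>G\<^esub>"
      using Suc c by (intro mult_mono) (auto simp: return_prob_def)
    ultimately show ?case by (simp add: mult.commute)
  qed (simp add: return_prob_def)
  have c0: "0 < ?c" using one by (simp add: pmf_positive)
  have "?c \<le> return_prob G q n powr (1 / real n)" if "n \<ge> 1" for n
  proof -
    have "?c = (?c ^ n) powr (1 / real n)"
      using that c0 by (simp add: powr_realpow[symmetric] powr_powr)
    also have "\<dots> \<le> return_prob G q n powr (1 / real n)" using ge[of n] c0 by (intro powr_mono2) auto
    finally show ?thesis .
  qed
  then have "\<forall>\<^sub>F n in sequentially. ennreal ?c \<le> ennreal (return_prob G q n powr (1 / real n))"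
    by (auto simp: eventually_sequentially intro!: exI[of _ 1] ennreal_leI)
  then show ?thesis unfolding spectral_radius_rw_def by (intro le_Limsup) auto
qed

theorem theorem1:
  fixes G :: "('a, 'b) monoid_scheme" and S :: "'a set" and \<mu> :: "nat pmf" and q :: "'a pmf"
  assumes "group G"
    and "finite S" and "S \<subseteq> carrier G" and "\<forall>s\<in>S. inv\<^bsub>G\<^esub> s \<in> S"
    and "generate G S = carrier G"
    and "hyperbolic_group G S"
    and "planar_cayley G S"
    and "offspring_mean \<mu> > 1" and "pmf \<mu> 0 = 0" and "pmf \<mu> 1 > 0"
    and "set_pmf q = insert \<one>\<^bsub>G\<^esub> S" and "\<forall>s\<in>S. pmf q s = pmf q (inv\<^bsub>G\<^esub> s)"
    and "offspring_mean \<mu> * spectral_radius_rw G q \<le> 1"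
  shows "AE \<omega> in brw_space \<mu> q.
           graph_ends (trace_V G \<omega>) (trace_E G \<omega>) \<approx> (UNIV :: real set) \<and>
           (\<forall>w\<in>graph_ends (trace_V G \<omega>) (trace_E G \<omega>).
              \<not> isolated_end (trace_V G \<omega>) (trace_E G \<omega>) w)"
proof -
  have one: "\<one>\<^bsub>G\<^esub> \<in> set_pmf q" using assms(11) by simp
  then have "0 < ennreal (pmf q \<one>\<^bsub>G\<^esub>)" by (simp add: pmf_positive)
  also have "\<dots> \<le> spectral_radius_rw G q" by (rule spectral_radius_pos[OF assms(1) one])
  finally have "0 < spectral_radius_rw G q" .
  \<comment> \<open>An infinite mean times a positive spectral radius would be infinite, against the
    bound 1.\<close>
  then have "offspring_mean \<mu> \<noteq> \<infinity>"
    using assms(13) by (auto simp: ennreal_top_mult top_unique split: if_splits)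
  then obtain m where m: "offspring_mean \<mu> = ennreal m" by (cases "offspring_mean \<mu>") auto
  have "1 < m" using assms(8) by (simp add: m)
  moreover have "ennreal m * spectral_radius_rw G q \<le> 1" using assms(13) by (simp only: m)
  ultimately interpret brw G S \<mu> q m
    using assms(2,3,4,5,9,11,12) m by (intro brw.intro[OF assms(1)] brw_axioms.intro) blast+
  show ?thesis by (rule trace_ends)
qed

end
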